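(* Let $\pi$ be an admissible policy with exploratory state process $\tilde{\mathbf Y}^\pi$ and let $U:[0,T]\times\mathbb R^4\to\mathbb R$. For an initial state $(t,\mathbf y)\in[0,T]\times\mathbb R^4$, with $\tilde{\mathbf Y}^\pi_t=\mathbf y$, put $$M_s=U(s,\tilde{\mathbf Y}^\pi_s)+\int_t^s\int_{\mathcal A}\pi_u(v)\big[r(\tilde{\mathbf Y}^\pi_u,v)-\gamma\log(\pi_u(v))\big]\,\mathrm dv\,\mathrm du,\qquad t\le s\le T.$$ Then $U$ is the value function of $\pi$ (i.e. $U=V^\pi$) if and only if $U$ satisfies the terminal condition $U(T,\mathbf y)=f(\mathbf y)$ and, for each initial state $(t,\mathbf y)$, $\{M_s\}_{t\le s\le T}$ is an $(\mathcal F^{\tilde{\mathbf Y}^\pi},\mathbb P^{W,N})$-martingale on $[t,T]$.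
   Context: Fix $T>0$ and constants $b,k,\gamma\ge0$, $\sigma,\kappa,\alpha,\varphi,\rho$, $\lambda>0$. $W$ is a standard Brownian motion and $N$ a homogeneous Poisson process with intensity $\lambda$ on a probability space with measure $\mathbb P^{W,N}$ and generated filtration $\{\mathcal F^{W,N}_t\}$; $\mathcal F_t=\mathcal F_t^{W,N}\vee\sigma(Z)$ with $Z$ independent of $W,N$. $\eta_1,\eta_2,\dots$ are non-negative i.i.d. copies of $\eta$ with finite moments. $\mathcal A\subset\mathbb R$ is the action space. States are $\mathbf y=(S,x,q,\mu)^{\mathsf T}$, with $$\mathbf b(t,\mathbf y,v)=(-bv,(S-kv)v,-v,-\kappa\mu)^{\mathsf T},\quad \boldsymbol\sigma=(\sigma,0,0,0)^{\mathsf T},\quad\boldsymbol\eta_m=(0,0,0,\eta_m)^{\mathsf T},$$ $$f(\mathbf y)=x+q(S-\alpha q),\qquad r(\mathbf y,v)=-\varphi(v-\rho\mu)^2.$$ Standing assumptions on the model: $\mathbf b$ is continuous, Lipschitz in $\mathbf y$ uniformly in $(t,v)\in[0,T]\times\mathcal A$, of linear growth in $\mathbf y$ uniformly in $(t,v)$, and $r,f$ are of polynomial growth. Exploratory state $\tilde{\mathbf Y}^\pi=(\tilde S^\pi,\tilde X^\pi,\tilde Q^\pi,\mu)^{\mathsf T}$: $$\mathrm d\tilde{\mathbf Y}^\pi_t=\int_{\mathcal A}\mathbf b(t,\tilde{\mathbf Y}^\pi_t,v)\pi(v\mid t,\tilde{\mathbf Y}^\pi_t)\mathrm dv\,\mathrm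 dt+\boldsymbol\sigma\,\mathrm dW_t+\boldsymbol\eta_{1+N_{t-}}\,\mathrm dN_t,$$ $\pi_u(v)=\pi(v\mid u,\tilde{\mathbf Y}^\pi_u)$, and $\mathcal F^{\tilde{\mathbf Y}^\pi}$ is the natural filtration of $\tilde{\mathbf Y}^\pi$. The value function of $\pi$ is $$V^\pi(t,\mathbf y)=\mathbb E^{\mathbb P^{W,N}}\Big[f(\tilde{\mathbf Y}^\pi_T)+\int_t^T\!\!\int_{\mathcal A}\big(r(\tilde{\mathbf Y}^\pi_u,v)-\gamma\log\pi_u(v)\big)\pi_u(v)\,\mathrm dv\,\mathrm du\,\Big|\,\tilde{\mathbf Y}^\pi_t=\mathbf y\Big].$$ $\pi$ is admissible if: (i) $\pi(\cdot\mid t,\mathbf y)$ is a probability density on $\mathcal A$, $\mathcal F_t$-measurable; (ii) for every initial $(t,\mathbf y)$ the exploratory state equation has a unique weak solution; (iii) $\int_{\mathcal A}|\pi(v\mid t,\mathbf y)-\pi(v\mid t',\mathbf y')|\mathrm dv\to0$ as $(t,\mathbf y)\to(t',\mathbf y')$ and, for some $C>0$, $\int_{\mathcal A}|\pi(v\mid t,\mathbf y)-\pi(v\mid t,\mathbf y')|\mathrm dv\le C|\mathbf y-\mathbf y'|$; (iv) for some $C>0$, $p\ge1$, $\int_{\mathcal A}|\varphi(v-\rho\mu)^2+\gamma\log\pi(v\mid t,\mathbf y)|\pi(v\mid t,\mathbf y)\mathrm dv\le C(1+|\mathbf y|^p)$. *)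

theory Defs
  imports "HOL-Probability.Probability"
begin

text \<open>
  States are \<open>(S, x, q, \<mu>)\<close>; the library norm on this product type is the Euclidean norm of
  four-dimensional space.
\<close>

type_synonym state = "real \<times> real \<times> real \<times> real"

text \<open>A feedback policy; \<open>\<pi> v t y\<close> is the density of the action \<open>v\<close> at time \<open>t\<close> in state \<open>y\<close>.\<close>

type_synonym policy = "real \<Rightarrow> real \<Rightarrow> state \<Rightarrow> real"

record model =
  horizon :: real       \<comment> \<open>\<open>T\<close>\<close>
  perm_impact :: real   \<comment> \<open>\<open>b\<close>\<close>
  temp_impact :: real   \<comment> \<open>\<open>k\<close>\<close>
  temperature :: real   \<comment> \<open>\<open>\<gamma>\<close>\<close>
  volatility :: real    \<comment> \<open>\<open>\<sigma>\<close>\<close>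
  decay :: real         \<comment> \<open>\<open>\<kappa>\<close>\<close>
  term_penalty :: real  \<comment> \<open>\<open>\<alpha>\<close>\<close>
  run_penalty :: real   \<comment> \<open>\<open>\<phi>\<close>\<close>
  tracking :: real      \<comment> \<open>\<open>\<rho>\<close>\<close>
  intensity :: real     \<comment> \<open>\<open>\<lambda>\<close>, the Poisson intensity\<close>
  actions :: "real set" \<comment> \<open>the action space\<close>
  mark_law :: "real measure" \<comment> \<open>the law of \<open>\<eta>\<close>\<close>

definition valid_model :: "model \<Rightarrow> bool" where
  "valid_model m \<longleftrightarrow>
     0 < horizon m \<and> 0 \<le> perm_impact m \<and> 0 \<le> temp_impact m \<and> 0 \<le> temperature m \<and>
     0 < intensity m \<and> actions m \<in> sets borel \<and>
     prob_space (mark_law m) \<and> sets (mark_law m) = sets borel \<and>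
     (AE x in mark_law m. 0 \<le> x) \<and>
     (\<forall>p::nat. integrable (mark_law m) (\<lambda>x. x ^ p))"

fun drift :: "model \<Rightarrow> real \<Rightarrow> state \<Rightarrow> real \<Rightarrow> state" where
  "drift m t (S, x, q, \<mu>) v =
     (- perm_impact m * v, (S - temp_impact m * v) * v, - v, - decay m * \<mu>)"

fun terminal_reward :: "model \<Rightarrow> state \<Rightarrow> real" where
  "terminal_reward m (S, x, q, \<mu>) = x + q * (S - term_penalty m * q)"

fun reward :: "model \<Rightarrow> state \<Rightarrow> real \<Rightarrow> real" where
  "reward m (S, x, q, \<mu>) v = - run_penalty m * (v - tracking m * \<mu>)\<^sup>2"

definition standing_assumptions :: "model \<Rightarrow> bool" where
  "standing_assumptions m \<longleftrightarrow>
     continuous_on ({0..horizon m} \<times> UNIV \<times> actions m) (\<lambda>(t, y, v). drift m t y v) \<and>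
     (\<exists>C>0. \<forall>t\<in>{0..horizon m}. \<forall>v\<in>actions m. \<forall>y y'.
        norm (drift m t y v - drift m t y' v) \<le> C * norm (y - y')) \<and>
     (\<exists>C>0. \<forall>t\<in>{0..horizon m}. \<forall>v\<in>actions m. \<forall>y.
        norm (drift m t y v) \<le> C * (1 + norm y)) \<and>
     (\<exists>C>0. \<exists>p\<ge>1. \<forall>y. \<forall>v\<in>actions m.
        \<bar>reward m y v\<bar> \<le> C * (1 + norm y powr p + \<bar>v\<bar> powr p)) \<and>
     (\<exists>C>0. \<exists>p\<ge>1. \<forall>y. \<bar>terminal_reward m y\<bar> \<le> C * (1 + norm y powr p))"


subsection \<open>Processes\<close>

text \<open>
  The sigma-algebra generated by the variables \<open>X i\<close>, \<open>i \<in> I\<close>. For a process \<open>X\<close> started at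
  time \<open>t\<close>, its natural filtration is \<open>\<lambda>s. generated P X {t..s}\<close>.
\<close>

definition generated ::
  "'w measure \<Rightarrow> ('i \<Rightarrow> 'w \<Rightarrow> 'a::topological_space) \<Rightarrow> 'i set \<Rightarrow> 'w measure" where
  "generated P X I = sigma (space P) {X i -` B \<inter> space P | i B. i \<in> I \<and> B \<in> sets borel}"

definition martingale_on ::
  "'w measure \<Rightarrow> (real \<Rightarrow> 'w measure) \<Rightarrow> real \<Rightarrow> real \<Rightarrow> (real \<Rightarrow> 'w \<Rightarrow> real) \<Rightarrow> bool" where
  "martingale_on P G t T X \<longleftrightarrow>
     (\<forall>s\<in>{t..T}. subalgebra P (G s)) \<and>
     (\<forall>s u. t \<le> s \<and> s \<le> u \<and> u \<le> T \<longrightarrow> sets (G s) \<subseteq> sets (G u)) \<and>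
     (\<forall>s\<in>{t..T}. X s \<in> borel_measurable (G s)) \<and>
     (\<forall>s\<in>{t..T}. integrable P (X s)) \<and>
     (\<forall>s u. t \<le> s \<and> s \<le> u \<and> u \<le> T \<longrightarrow>
        (AE \<omega> in P. real_cond_exp P (G s) (X u) \<omega> = X s \<omega>))"

definition independent_increments :: "'w measure \<Rightarrow> (real \<Rightarrow> 'w \<Rightarrow> real) \<Rightarrow> bool" where
  "independent_increments P X \<longleftrightarrow>
     (\<forall>(t :: nat \<Rightarrow> real) (n :: nat). mono t \<and> 0 \<le> t 0 \<longrightarrow>
        prob_space.indep_vars P (\<lambda>_. borel) (\<lambda>i \<omega>. X (t (Suc i)) \<omega> - X (t i) \<omega>) {..<n})"

definition brownian_motion :: "'w measure \<Rightarrow> (real \<Rightarrow> 'w \<Rightarrow> real) \<Rightarrow> bool" where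
  "brownian_motion P W \<longleftrightarrow>
     (\<forall>\<omega>\<in>space P. W 0 \<omega> = 0 \<and> continuous_on {0..} (\<lambda>s. W s \<omega>)) \<and>
     independent_increments P W \<and>
     (\<forall>s u. 0 \<le> s \<and> s < u \<longrightarrow>
        distributed P lborel (\<lambda>\<omega>. W u \<omega> - W s \<omega>) (normal_density 0 (sqrt (u - s))))"

definition left_limit :: "(real \<Rightarrow> nat) \<Rightarrow> real \<Rightarrow> nat" where
  "left_limit n u = Lim (at_left u) n"

definition counting_path :: "(real \<Rightarrow> nat) \<Rightarrow> bool" where
  "counting_path n \<longleftrightarrow>
     n 0 = 0 \<and> mono_on {0..} n \<and> (\<forall>u\<ge>0. continuous (at_right u) n) \<and>
     (\<forall>u>0. n u \<le> left_limit n u + 1)"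

definition poisson_process :: "'w measure \<Rightarrow> real \<Rightarrow> (real \<Rightarrow> 'w \<Rightarrow> nat) \<Rightarrow> bool" where
  "poisson_process P rate N \<longleftrightarrow>
     (\<forall>\<omega>\<in>space P. counting_path (\<lambda>s. N s \<omega>)) \<and>
     independent_increments P (\<lambda>s \<omega>. real (N s \<omega>)) \<and>
     (\<forall>s u. 0 \<le> s \<and> s < u \<longrightarrow>
        distr P (count_space UNIV) (\<lambda>\<omega>. N u \<omega> - N s \<omega>) =
          measure_pmf (poisson_pmf (rate * (u - s))))"

definition cadlag_on :: "real \<Rightarrow> real \<Rightarrow> (real \<Rightarrow> 'a::topological_space) \<Rightarrow> bool" where
  "cadlag_on t T g \<longleftrightarrow>
     (\<forall>s\<in>{t..T}. continuous (at s within {s..T}) g \<and> (\<exists>l. (g \<longlongrightarrow> l) (at s within {t..<s})))"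

text \<open>
  The pathwise integral of \<open>h (1 + n(u-))\<close> against \<open>dn(u)\<close> over \<open>(t, s]\<close> for a counting path \<open>n\<close>:
  the sum over its (finitely many) jump times.
\<close>

definition jump_integral :: "(real \<Rightarrow> nat) \<Rightarrow> (nat \<Rightarrow> real) \<Rightarrow> real \<Rightarrow> real \<Rightarrow> real" where
  "jump_integral n h t s =
     (\<Sum>u | t < u \<and> u \<le> s \<and> n u \<noteq> left_limit n u.
        h (1 + left_limit n u) * (real (n u) - real (left_limit n u)))"


subsection \<open>Exploratory dynamics\<close>

definition exploratory_drift :: "model \<Rightarrow> policy \<Rightarrow> real \<Rightarrow> state \<Rightarrow> state" where
  "exploratory_drift m \<pi> t y = (LINT v:actions m|lborel. \<pi> v t y *\<^sub>R drift m t y v)"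

text \<open>
  The driving noise on a filtered probability space. The last condition says that Brownian motion,
  Poisson process and the marks revealed by the jumps do not anticipate the filtration. The marks
  are \<open>eta 1, eta 2, \<dots>\<close>; \<open>eta 0\<close> plays no role.
\<close>

definition driving_noise ::
  "model \<Rightarrow> 'w measure \<Rightarrow> (real \<Rightarrow> 'w measure) \<Rightarrow>
   (real \<Rightarrow> 'w \<Rightarrow> real) \<Rightarrow> (real \<Rightarrow> 'w \<Rightarrow> nat) \<Rightarrow> (nat \<Rightarrow> 'w \<Rightarrow> real) \<Rightarrow> bool" where
  "driving_noise m P F W N eta \<longleftrightarrow>
     prob_space P \<and> filtration (space P) F \<and> (\<forall>s. subalgebra P (F s)) \<and>
     brownian_motion P W \<and> poisson_process P (intensity m) N \<and>
     prob_space.indep_vars P (\<lambda>_. borel) eta {1..} \<and>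
     (\<forall>i\<ge>1. distr P borel (eta i) = mark_law m) \<and>
     prob_space.indep_sets P
       ((!) [sets (generated P W {0..}), sets (generated P N {0..}), sets (generated P eta {1..})])
       {..<3} \<and>
     (let J = (\<lambda>s u \<omega>. jump_integral (\<lambda>r. N r \<omega>) (\<lambda>i. eta i \<omega>) s u) in
        (\<forall>s\<ge>0. W s \<in> borel_measurable (F s) \<and> N s \<in> borel_measurable (F s) \<and>
                J 0 s \<in> borel_measurable (F s)) \<and>
        (\<forall>s\<ge>0. prob_space.indep_set P (sets (F s))
           (sets (generated P
             (\<lambda>u \<omega>. (W u \<omega> - W s \<omega>, real (N u \<omega>) - real (N s \<omega>), J s u \<omega>)) {s..}))))"

text \<open>
  Weak solutions of the exploratory state equation on \<open>[t, T]\<close> started in state \<open>y\<close> at time \<open>t\<close>.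
  The noise is additive, so no stochastic integral beyond \<open>jump_integral\<close> occurs.
\<close>

definition weak_solution ::
  "model \<Rightarrow> policy \<Rightarrow> real \<Rightarrow> state \<Rightarrow> 'w measure \<Rightarrow> (real \<Rightarrow> 'w measure) \<Rightarrow>
   (real \<Rightarrow> 'w \<Rightarrow> real) \<Rightarrow> (real \<Rightarrow> 'w \<Rightarrow> nat) \<Rightarrow> (nat \<Rightarrow> 'w \<Rightarrow> real) \<Rightarrow> (real \<Rightarrow> 'w \<Rightarrow> state) \<Rightarrow> bool"
where
  "weak_solution m \<pi> t y P F W N eta Y \<longleftrightarrow>
     driving_noise m P F W N eta \<and>
     (\<forall>s\<in>{t..horizon m}. Y s \<in> borel_measurable (F s)) \<and>
     (\<forall>\<omega>\<in>space P. cadlag_on t (horizon m) (\<lambda>s. Y s \<omega>)) \<and>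
     (AE \<omega> in P. \<forall>s\<in>{t..horizon m}.
        set_integrable lborel {t..s} (\<lambda>u. exploratory_drift m \<pi> u (Y u \<omega>)) \<and>
        Y s \<omega> = y + (LINT u:{t..s}|lborel. exploratory_drift m \<pi> u (Y u \<omega>))
          + (volatility m * (W s \<omega> - W t \<omega>), 0, 0, 0)
          + (0, 0, 0, jump_integral (\<lambda>r. N r \<omega>) (\<lambda>i. eta i \<omega>) t s))"

text \<open>
  One cannot quantify over all sample spaces inside a definition. The type of joint paths of state,
  Brownian motion, Poisson process and marks suffices: a weak solution on any sample space can be
  transported to it along the map sending a sample point to its paths, with the same law of \<open>Y\<close>.
\<close>

type_synonym path_space =
  "(real \<Rightarrow> state) \<times> (real \<Rightarrow> real) \<times> (real \<Rightarrow> nat) \<times> (nat \<Rightarrow> real)"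

definition path_law :: "real \<Rightarrow> real \<Rightarrow> 'w measure \<Rightarrow> (real \<Rightarrow> 'w \<Rightarrow> state) \<Rightarrow> (real \<Rightarrow> state) measure"
where
  "path_law t T P Y = distr P (PiM {t..T} (\<lambda>_. borel)) (\<lambda>\<omega>. \<lambda>s\<in>{t..T}. Y s \<omega>)"

definition unique_weak_solution :: "model \<Rightarrow> policy \<Rightarrow> real \<Rightarrow> state \<Rightarrow> bool" where
  "unique_weak_solution m \<pi> t y \<longleftrightarrow>
     (\<exists>(P :: path_space measure) F W N eta Y. weak_solution m \<pi> t y P F W N eta Y) \<and>
     (\<forall>(P :: path_space measure) F W N eta Y (P' :: path_space measure) F' W' N' eta' Y'.
        weak_solution m \<pi> t y P F W N eta Y \<and> weak_solution m \<pi> t y P' F' W' N' eta' Y' \<longrightarrow>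
        path_law t (horizon m) P Y = path_law t (horizon m) P' Y')"

text \<open>
  Since \<open>\<pi>\<close> is a deterministic feedback density, its measurability means joint Borel measurability:
  then \<open>\<pi> v t (Y t)\<close> is adapted whenever \<open>Y\<close> is. Where \<open>\<pi>\<close> vanishes, \<open>ln 0 = 0\<close> gives the usual
  convention \<open>0 log 0 = 0\<close>.
\<close>

definition admissible :: "model \<Rightarrow> policy \<Rightarrow> bool" where
  "admissible m \<pi> \<longleftrightarrow>
     (\<forall>t\<in>{0..horizon m}. \<forall>y.
        (\<forall>v\<in>actions m. 0 \<le> \<pi> v t y) \<and>
        set_integrable lborel (actions m) (\<lambda>v. \<pi> v t y) \<and>
        (LINT v:actions m|lborel. \<pi> v t y) = 1) \<and>
     (\<lambda>(v, t, y). \<pi> v t y) \<in>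
        borel_measurable (restrict_space borel (actions m \<times> {0..horizon m} \<times> UNIV)) \<and>
     (\<forall>t\<in>{0..horizon m}. \<forall>y. unique_weak_solution m \<pi> t y) \<and>
     (\<forall>t'\<in>{0..horizon m}. \<forall>y'.
        ((\<lambda>(t, y). LINT v:actions m|lborel. \<bar>\<pi> v t y - \<pi> v t' y'\<bar>) \<longlongrightarrow> 0)
          (at (t', y') within {0..horizon m} \<times> UNIV)) \<and>
     (\<exists>C>0. \<forall>t\<in>{0..horizon m}. \<forall>y y'.
        (LINT v:actions m|lborel. \<bar>\<pi> v t y - \<pi> v t y'\<bar>) \<le> C * norm (y - y')) \<and>
     (\<exists>C>0. \<exists>p\<ge>1. \<forall>t\<in>{0..horizon m}. \<forall>S x q \<mu>.
        let g = (\<lambda>v. \<bar>run_penalty m * (v - tracking m * \<mu>)\<^sup>2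
                     + temperature m * ln (\<pi> v t (S, x, q, \<mu>))\<bar> * \<pi> v t (S, x, q, \<mu>)) in
        set_integrable lborel (actions m) g \<and>
        (LINT v:actions m|lborel. g v) \<le> C * (1 + norm (S, x, q, \<mu>) powr p))"

definition entropic_reward :: "model \<Rightarrow> policy \<Rightarrow> real \<Rightarrow> state \<Rightarrow> real" where
  "entropic_reward m \<pi> t y =
     (LINT v:actions m|lborel. (reward m y v - temperature m * ln (\<pi> v t y)) * \<pi> v t y)"

text \<open>
  Below, \<open>P t y\<close> and \<open>Y t y\<close> are the probability measure and the exploratory state process for the
  initial state \<open>(t, y)\<close>; starting the process there renders the conditioning on the state at
  time \<open>t\<close> being \<open>y\<close>.
\<close>

definition value_function ::
  "model \<Rightarrow> policy \<Rightarrow> (real \<Rightarrow> state \<Rightarrow> 'w measure) \<Rightarrow> (real \<Rightarrow> state \<Rightarrow> real \<Rightarrow> 'w \<Rightarrow> state) \<Rightarrow>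
   real \<Rightarrow> state \<Rightarrow> real" where
  "value_function m \<pi> P Y t y =
     (LINT \<omega>|P t y. terminal_reward m (Y t y (horizon m) \<omega>)
        + (LINT u:{t..horizon m}|lborel. entropic_reward m \<pi> u (Y t y u \<omega>)))"

definition performance_process ::
  "model \<Rightarrow> policy \<Rightarrow> (real \<Rightarrow> state \<Rightarrow> real) \<Rightarrow> real \<Rightarrow> (real \<Rightarrow> 'w \<Rightarrow> state) \<Rightarrow> real \<Rightarrow> 'w \<Rightarrow> real"
where
  "performance_process m \<pi> U t Y s \<omega> =
     U s (Y s \<omega>) + (LINT u:{t..s}|lborel. entropic_reward m \<pi> u (Y u \<omega>))"

end

theory Submission
  imports Defs
begin

text \<open>
  The theorem holds because the exploratory state is a Markov process.

  If \<open>M\<close> is a martingale on \<open>[t, T]\<close> and \<open>U\<close> has the right terminal values, then \<open>M\<close> starts in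
  \<open>U(t, y)\<close> and ends in the total reward, so comparing expectations gives \<open>U(t, y) = V(t, y)\<close>
  (\<open>value_of_martingale\<close>).

  For the value function it suffices that \<open>M\<^sub>s\<close> is the conditional expectation of \<open>M\<^sub>T\<close> given the
  past of the state up to \<open>s\<close>; the tower property then gives the martingale. Cutting the running
  reward at \<open>s\<close>, this says that the reward still to come has conditional expectation \<open>V(s, Y\<^sub>s)\<close>
  (\<open>future_reward\<close>). By Fubini it is enough to know, for each single time \<open>u \<ge> s\<close>, that the
  conditional law of \<open>Y\<^sub>u\<close> given the past up to \<open>s\<close> is \<open>kernel s u Y\<^sub>s\<close>, the law at time \<open>u\<close> of the
  solution started at time \<open>s\<close> (\<open>markov_nn_integral\<close>).

  The difficulty is that for different initial states these solutions live on unrelated probability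
  spaces. The Euler scheme compares them. The noise enters the equation additively, and the averaged
  drift \<open>\<beta>\<close> is continuous and satisfies
  \<open>norm (\<beta> t y - \<beta> t y') \<le> L * (1 + norm y') * norm (y - y')\<close>. Hence along every single path of a
  solution, from every intermediate time \<open>s\<close> on, the Euler schemes converge to that solution
  (\<open>euler_tendsto\<close>, \<open>euler_end_tendsto\<close>). The end point of a scheme with finitely many steps is a
  function of \<open>Y\<^sub>s\<close> and of finitely many noise increments after \<open>s\<close>. These are independent of the past
  (\<open>increments_freeze\<close>), and their joint law is the same on all probability spaces
  (\<open>increments_distr\<close>). So for bounded continuous \<open>g\<close> the expectations of \<open>g(Y\<^sub>u)\<close> on a past event
  and of \<open>\<integral> g d(kernel s u Y\<^sub>s)\<close> on this event are limits of the same numbers (\<open>markov_continuous\<close>),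
  and such \<open>g\<close> determine a finite measure.

  Integrability comes from the same schemes: a discrete Gronwall argument bounds them by averages of
  the noise (\<open>euler_growth\<close>), whose moments are finite, and Fatou's lemma carries the bound
  \<open>E (norm Y\<^sub>u) ^ (2 * q) \<le> K * (1 + norm y ^ (2 * q))\<close> over to the solutions (\<open>solution_moment\<close>).
  All rewards grow at most polynomially.
\<close>

section \<open>Right-continuous paths and uniform grids\<close>

abbreviation mesh :: "real \<Rightarrow> real \<Rightarrow> nat \<Rightarrow> real" where "mesh s u n \<equiv> (u - s) / real (Suc n)"

text \<open>
  The grid divides \<open>[s, u]\<close> into \<open>n + 1\<close> steps, so that the mesh is a quotient by a positive number
  for every \<open>n\<close> and sequences may be indexed from \<open>0\<close>.
\<close>

definition grid :: "real \<Rightarrow> real \<Rightarrow> nat \<Rightarrow> nat \<Rightarrow> real" where "grid s u n k = s + real k * mesh s u n"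

lemma grid_mono: "s \<le> u \<Longrightarrow> mono (grid s u n)"
  by (auto simp: grid_def mono_def intro!: mult_right_mono divide_right_mono)

lemma grid_0 [simp]: "grid s u n 0 = s" by (simp add: grid_def)
lemma grid_Suc_n: "grid s u n (Suc n) = u" by (simp add: grid_def del: of_nat_Suc)

lemma grid_in: assumes "s \<le> u" "k \<le> Suc n" shows "grid s u n k \<in> {s..u}"
  using monoD[OF grid_mono[OF assms(1)], of 0 k n] monoD[OF grid_mono[OF assms(1)] assms(2), of n]
  by (simp add: grid_Suc_n)

text \<open>
  The grid point next to the right of \<open>r\<close>. Rounding up rather than down is what makes
  right-continuity alone sufficient for convergence.
\<close>

definition grid_ceil :: "real \<Rightarrow> real \<Rightarrow> nat \<Rightarrow> real \<Rightarrow> real" where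
  "grid_ceil s u n r = s + of_int \<lceil>(r - s) / mesh s u n\<rceil> * mesh s u n"

lemma grid_ceil_bounds:
  assumes "s < u" "r \<in> {s..u}"
  shows "r \<le> grid_ceil s u n r" "grid_ceil s u n r \<le> u" "s \<le> grid_ceil s u n r"
    "grid_ceil s u n r \<le> r + mesh s u n"
proof -
  define h where "h = mesh s u n"
  have h: "h > 0" using assms by (simp add: h_def)
  have *: "grid_ceil s u n r = s + of_int \<lceil>(r - s) / h\<rceil> * h" by (simp add: grid_ceil_def h_def)
  have "(r - s) / h \<le> of_int \<lceil>(r - s) / h\<rceil>" by simp
  then have 1: "r - s \<le> of_int \<lceil>(r - s) / h\<rceil> * h" by (simp only: pos_divide_le_eq[OF h])
  then show A: "r \<le> grid_ceil s u n r" by (simp add: *)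
  then show "s \<le> grid_ceil s u n r" using assms by auto
  have "of_int \<lceil>(r - s) / h\<rceil> \<le> (r - s) / h + 1" by linarith
  then have "of_int \<lceil>(r - s) / h\<rceil> * h \<le> ((r - s) / h + 1) * h" using h by (intro mult_right_mono) auto
  also have "\<dots> = r - s + h" using h by (simp add: field_simps)
  finally show "grid_ceil s u n r \<le> r + mesh s u n" by (simp only: * h_def[symmetric])
  have "real (Suc n) * h = u - s" by (simp add: h_def)
  then have "(r - s) / h \<le> real (Suc n)" unfolding pos_divide_le_eq[OF h] using assms by auto
  then have "\<lceil>(r - s) / h\<rceil> \<le> int (Suc n)" by (simp add: ceiling_le_iff)
  then have "real_of_int \<lceil>(r - s) / h\<rceil> \<le> real (Suc n)" by linarith
  then have "of_int \<lceil>(r - s) / h\<rceil> * h \<le> real (Suc n) * h" using h by (intro mult_right_mono) auto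
  also have "\<dots> = u - s" by (simp add: h_def)
  finally show "grid_ceil s u n r \<le> u" by (simp add: *)
qed

lemma grid_ceil_tendsto:
  assumes "s < u" "r \<in> {s..u}"
  shows "(\<lambda>n. grid_ceil s u n r) \<longlonglongrightarrow> r"
proof (rule real_tendsto_sandwich)
  show "\<forall>\<^sub>F n in sequentially. r \<le> grid_ceil s u n r" using grid_ceil_bounds[OF assms] by simp
  show "\<forall>\<^sub>F n in sequentially. grid_ceil s u n r \<le> r + mesh s u n"
    using grid_ceil_bounds[OF assms] by simp
  show "(\<lambda>n. r + mesh s u n) \<longlonglongrightarrow> r"
    using tendsto_add[OF tendsto_const[of r] LIMSEQ_Suc[OF lim_const_over_n[of "u - s"]]] by simp
qed auto

lemma right_continuous_grid_ceil:
  fixes \<phi> :: "real \<Rightarrow> 'a::metric_space"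
  assumes "s < u" "r \<in> {s..u}" "continuous (at r within {r..u}) \<phi>"
  shows "(\<lambda>n. \<phi> (grid_ceil s u n r)) \<longlonglongrightarrow> \<phi> r"
proof -
  have "\<forall>n. grid_ceil s u n r \<in> {r..u}" using grid_ceil_bounds[OF assms(1,2)] by auto
  then show ?thesis
    using assms(3) grid_ceil_tendsto[OF assms(1,2)] unfolding continuous_within_sequentially
    by (auto simp: o_def)
qed

lemma grid_ceil_eq:
  assumes "s < u" "r \<in> {s + real j * mesh s u n <.. s + real (Suc j) * mesh s u n}"
  shows "grid_ceil s u n r = s + real (Suc j) * mesh s u n"
proof -
  define h where "h = mesh s u n"
  have h: "h > 0" using assms by (simp add: h_def)
  have "real j < (r - s) / h" "(r - s) / h \<le> real (Suc j)"
    using assms(2) unfolding h_def[symmetric] pos_less_divide_eq[OF h] pos_divide_le_eq[OF h] by auto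
  then have "\<lceil>(r - s) / h\<rceil> = int (Suc j)" by (intro ceiling_unique) auto
  then show ?thesis unfolding grid_ceil_def h_def[symmetric] by simp
qed

text \<open>
  Rounding the time up to a grid gives a function that takes countably many values in time, hence is
  jointly measurable; right-continuity passes to the limit. Times outside \<open>[s, u]\<close> are projected to
  the interval so that the statement needs no restricted measure space.
\<close>

lemma jointly_measurable_right_continuous:
  fixes Y :: "real \<Rightarrow> 'w \<Rightarrow> 'a::{metric_space}"
  assumes su: "s \<le> u" and meas: "\<And>r. r \<in> {s..u} \<Longrightarrow> Y r \<in> borel_measurable M"
    and rc: "\<And>r x. r \<in> {s..u} \<Longrightarrow> x \<in> space M \<Longrightarrow> continuous (at r within {r..u}) (\<lambda>r. Y r x)"
  shows "(\<lambda>(r, x). Y (max s (min u r)) x) \<in> borel_measurable (borel \<Otimes>\<^sub>M M)"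
proof (cases "s = u")
  case True
  then have "(\<lambda>(r, x). Y (max s (min u r)) x) = (\<lambda>p. Y u (snd p))" by (auto simp: fun_eq_iff)
  then show ?thesis using meas[of u] True by simp
next
  case False
  then have lt: "s < u" using su by simp
  let ?c = "\<lambda>r::real. max s (min u r)"
  have c: "?c r \<in> {s..u}" for r using su by auto
  define Y' where "Y' = (\<lambda>r. Y (?c r))"
  have [measurable]: "Y' r \<in> borel_measurable M" for r unfolding Y'_def by (rule meas[OF c])
  show ?thesis
  proof (rule borel_measurable_LIMSEQ_metric)
    fix n
    have "(\<lambda>p. Y' (grid_ceil s u n (?c (fst p))) (snd p)) \<in> borel_measurable (borel \<Otimes>\<^sub>M M)"
      unfolding grid_ceil_def
    proof (rule measurable_compose_countable[where
          f="\<lambda>i p. Y' (s + of_int i * mesh s u n) (snd p)" and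
          g="\<lambda>p. \<lceil>(?c (fst p) - s) / mesh s u n\<rceil>"])
    qed measurable
    then show "(\<lambda>p. Y (grid_ceil s u n (?c (fst p))) (snd p)) \<in> borel_measurable (borel \<Otimes>\<^sub>M M)"
      using grid_ceil_bounds[OF lt c] by (simp add: Y'_def max_absorb2 min_absorb2)
  next
    fix p :: "real \<times> 'w" assume "p \<in> space (borel \<Otimes>\<^sub>M M)"
    then have "snd p \<in> space M" by (auto simp: space_pair_measure)
    then show "(\<lambda>n. Y (grid_ceil s u n (?c (fst p))) (snd p)) \<longlonglongrightarrow> (case p of (r, x) \<Rightarrow> Y (?c r) x)"
      using right_continuous_grid_ceil[OF lt c rc[OF c], of "snd p" "fst p"] by (simp add: split_def)
  qed
qed

text \<open>
  The right Riemann sum over the first \<open>k\<close> grid intervals is the integral of the rounded function,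
  so one number, the \<open>L\<^sup>1\<close> distance between \<open>\<phi>\<close> and its rounding, bounds the error for all \<open>k\<close>
  at once. It tends to zero by dominated convergence.
\<close>

lemma right_riemann_sums:
  fixes \<phi> :: "real \<Rightarrow> 'a::euclidean_space"
  assumes lt: "s < u" and rc: "\<And>r. r \<in> {s..u} \<Longrightarrow> continuous (at r within {r..u}) \<phi>"
    and bd: "\<And>r. r \<in> {s..u} \<Longrightarrow> norm (\<phi> r) \<le> B"
  shows "\<exists>\<delta>. \<delta> \<longlonglongrightarrow> 0 \<and> (\<forall>n k. k \<le> Suc n \<longrightarrow>
      norm ((\<Sum>j<k. mesh s u n *\<^sub>R \<phi> (s + real (Suc j) * mesh s u n))
        - (LINT r:{s..s + real k * mesh s u n}|lborel. \<phi> r)) \<le> \<delta> n)"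
proof -
  define \<psi> where "\<psi> n r = \<phi> (grid_ceil s u n r)" for n r
  define \<delta> where "\<delta> n = (LINT r:{s..u}|lborel. norm (\<psi> n r - \<phi> r))" for n
  have gc: "grid_ceil s u n r \<in> {s..u}" if "r \<in> {s..u}" for n r
    using grid_ceil_bounds[OF lt that] by auto
  have m\<psi>: "\<psi> n \<in> borel_measurable lborel" for n
    unfolding \<psi>_def grid_ceil_def
    by (rule measurable_compose_countable[where
          f="\<lambda>i p. \<phi> (s + of_int i * mesh s u n)"]) measurable
  have lim: "(\<lambda>n. \<psi> n r) \<longlonglongrightarrow> \<phi> r" if "r \<in> {s..u}" for r
    unfolding \<psi>_def by (rule right_continuous_grid_ceil[OF lt that rc[OF that]])
  have m\<phi>: "(\<lambda>r. indicator {s..u} r *\<^sub>R \<phi> r) \<in> borel_measurable lborel"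
  proof (rule borel_measurable_LIMSEQ_metric)
    show "(\<lambda>r. indicator {s..u} r *\<^sub>R \<psi> n r) \<in> borel_measurable lborel" for n
      using m\<psi>[of n] by measurable
    show "(\<lambda>n. indicator {s..u} r *\<^sub>R \<psi> n r) \<longlonglongrightarrow> indicator {s..u} r *\<^sub>R \<phi> r" for r
      using lim[of r] by (cases "r \<in> {s..u}") auto
  qed
  have B: "0 \<le> B" using bd[of s] lt by (auto intro: order_trans[OF norm_ge_zero])
  have intB: "integrable lborel (\<lambda>r. indicator {s..u} r *\<^sub>R C)" for C :: real
    using lt by (intro integrable_scaleR_left) (auto simp: emeasure_lborel_Icc_eq)
  have i\<phi>: "set_integrable lborel {s..u} \<phi>"
    unfolding set_integrable_def
    by (rule Bochner_Integration.integrable_bound[OF intB[of B] m\<phi>]) (use bd B in \<open>auto simp: indicator_def\<close>)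
  have i\<psi>: "set_integrable lborel {s..u} (\<psi> n)" for n
    unfolding set_integrable_def
  proof (rule Bochner_Integration.integrable_bound[OF intB[of B]])
    show "(\<lambda>r. indicator {s..u} r *\<^sub>R \<psi> n r) \<in> borel_measurable lborel"
      using m\<psi>[of n] by measurable
    show "AE x in lborel. norm (indicat_real {s..u} x *\<^sub>R \<psi> n x) \<le> norm (indicat_real {s..u} x *\<^sub>R B)"
      using bd[OF gc] B by (auto simp: indicator_def \<psi>_def)
  qed
  have lim\<delta>: "\<delta> \<longlonglongrightarrow> 0"
  proof -
    have "(\<lambda>n. LINT r|lborel. indicator {s..u} r *\<^sub>R norm (\<psi> n r - \<phi> r))
        \<longlonglongrightarrow> (LINT r|lborel. indicator {s..u} r *\<^sub>R (0::real))"
    proof (rule integral_dominated_convergence[OF _ _ intB[of "2 * B"]])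
      show "(\<lambda>r. indicator {s..u} r *\<^sub>R norm (\<psi> n r - \<phi> r)) \<in> borel_measurable lborel" for n
      proof -
        have "(\<lambda>r. indicator {s..u} r *\<^sub>R norm (\<psi> n r - \<phi> r))
           = (\<lambda>r. norm (indicator {s..u} r *\<^sub>R \<psi> n r - indicator {s..u} r *\<^sub>R \<phi> r))"
          by (auto simp: indicator_def)
        moreover have "(\<lambda>r. indicator {s..u} r *\<^sub>R \<psi> n r) \<in> borel_measurable lborel"
          using m\<psi>[of n] by measurable
        ultimately show ?thesis using m\<phi> by simp
      qed
      show "AE r in lborel. (\<lambda>n. indicator {s..u} r *\<^sub>R norm (\<psi> n r - \<phi> r)) \<longlonglongrightarrow> indicator {s..u} r *\<^sub>R (0::real)"
      proof (rule AE_I2)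
        fix r show "(\<lambda>n. indicator {s..u} r *\<^sub>R norm (\<psi> n r - \<phi> r)) \<longlonglongrightarrow> indicator {s..u} r *\<^sub>R (0::real)"
          using tendsto_norm_zero[OF LIM_zero[OF lim[of r]]] by (cases "r \<in> {s..u}") auto
      qed
      show "AE r in lborel. norm (indicator {s..u} r *\<^sub>R norm (\<psi> n r - \<phi> r)) \<le> indicator {s..u} r *\<^sub>R (2 * B)" for n
      proof (rule AE_I2)
        fix r show "norm (indicator {s..u} r *\<^sub>R norm (\<psi> n r - \<phi> r)) \<le> indicator {s..u} r *\<^sub>R (2 * B)"
          using norm_triangle_ineq4[of "\<psi> n r" "\<phi> r"] bd[of r] bd[OF gc, of r n]
          by (auto simp: indicator_def \<psi>_def)
      qed
    qed simp
    then show ?thesis by (simp add: \<delta>_def[abs_def] set_lebesgue_integral_def)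
  qed
  have "norm ((\<Sum>j<k. mesh s u n *\<^sub>R \<phi> (s + real (Suc j) * mesh s u n))
        - (LINT r:{s..s + real k * mesh s u n}|lborel. \<phi> r)) \<le> \<delta> n"
    if k: "k \<le> Suc n" for n k
  proof -
  define h where "h = mesh s u n"
  have h: "h > 0" using lt by (simp add: h_def)
  have hk: "s + real j * h \<le> u" if "j \<le> Suc n" for j
  proof -
    have "real j * h \<le> real (Suc n) * h" using h that by (intro mult_right_mono) auto
    also have "\<dots> = u - s" by (simp add: h_def)
    finally show ?thesis by simp
  qed
  have i\<psi>': "set_integrable lborel A (\<psi> n)" if "A \<in> sets borel" "A \<subseteq> {s..u}" for A
    using set_integrable_subset[OF i\<psi>] that by auto
  have sum: "(\<Sum>j<k. h *\<^sub>R \<phi> (s + real (Suc j) * h)) = (LINT r:{s<..s + real k * h}|lborel. \<psi> n r)"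
    if "k \<le> Suc n" for k
    using that
  proof (induction k)
    case 0 then show ?case by (simp add: set_lebesgue_integral_def)
  next
    case (Suc k)
    have split: "{s<..s + real (Suc k) * h} = {s<..s + real k * h} \<union> {s + real k * h<..s + real (Suc k) * h}"
    proof -
      have "s \<le> s + real k * h" "s + real k * h \<le> s + real (Suc k) * h" using h by (auto simp: algebra_simps)
      then show ?thesis by auto
    qed
    have "(LINT r:{s<..s + real (Suc k) * h}|lborel. \<psi> n r) =
        (LINT r:{s<..s + real k * h}|lborel. \<psi> n r) + (LINT r:{s + real k * h<..s + real (Suc k) * h}|lborel. \<psi> n r)"
      unfolding split
    proof (rule set_integral_Un)
      show "set_integrable lborel {s<..s + real k * h} (\<psi> n)"
        using hk[of k] Suc by (intro i\<psi>') auto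
      have "s \<le> s + real k * h" using h by simp
      then show "set_integrable lborel {s + real k * h<..s + real (Suc k) * h} (\<psi> n)"
        using hk[of "Suc k"] Suc(2) by (intro i\<psi>') (auto simp: simp del: of_nat_Suc)
    qed auto
    also have "(LINT r:{s + real k * h<..s + real (Suc k) * h}|lborel. \<psi> n r)
        = (LINT r:{s + real k * h<..s + real (Suc k) * h}|lborel. \<phi> (s + real (Suc k) * h))"
    proof (rule set_lebesgue_integral_cong)
      show "\<forall>r. r \<in> {s + real k * h<..s + real (Suc k) * h} \<longrightarrow> \<psi> n r = \<phi> (s + real (Suc k) * h)"
        using grid_ceil_eq[OF lt, of _ k n] unfolding \<psi>_def h_def by simp
    qed simp
    also have "\<dots> = h *\<^sub>R \<phi> (s + real (Suc k) * h)"
      using h by (simp add: set_lebesgue_integral_def measure_def algebra_simps)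
    finally show ?case using Suc by simp
  qed
  let ?I = "{s..s + real k * h}" and ?A = "{s<..s + real k * h}"
  have I: "?I \<subseteq> {s..u}" "?A \<subseteq> {s..u}" "?I \<in> sets borel" "?A \<in> sets borel" using hk[OF k] by auto
  have mI: "(\<lambda>r. indicator ?I r *\<^sub>R \<psi> n r) \<in> borel_measurable lborel"
      "(\<lambda>r. indicator ?A r *\<^sub>R \<psi> n r) \<in> borel_measurable lborel"
    using m\<psi>[of n] by measurable
  have "(LINT r:?A|lborel. \<psi> n r) = (LINT r:?I|lborel. \<psi> n r)"
    unfolding set_lebesgue_integral_def
  proof (rule integral_cong_AE[OF mI(2,1)])
    show "AE r in lborel. indicator ?A r *\<^sub>R \<psi> n r = indicator ?I r *\<^sub>R \<psi> n r"
      using AE_lborel_singleton[of s] by eventually_elim (auto simp: indicator_def)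
  qed
  then have "norm ((\<Sum>j<k. h *\<^sub>R \<phi> (s + real (Suc j) * h)) - (LINT r:?I|lborel. \<phi> r))
      = norm (LINT r:?I|lborel. \<psi> n r - \<phi> r)"
    using sum[OF k] set_integrable_subset[OF i\<phi> _ I(1)] i\<psi>'[OF I(3,1)] by (simp add: set_integral_diff)
  also have "\<dots> \<le> (LINT r:?I|lborel. norm (\<psi> n r - \<phi> r))"
    using set_integrable_subset[OF i\<phi> _ I(1)] i\<psi>'[OF I(3,1)]
    by (intro set_integral_norm_bound set_integral_diff) auto
  also have "\<dots> \<le> \<delta> n"
    unfolding \<delta>_def
    unfolding set_lebesgue_integral_def
  proof (rule integral_mono)
    have "set_integrable lborel {s..u} (\<lambda>r. norm (\<psi> n r - \<phi> r))"
      by (intro set_integrable_norm set_integral_diff i\<phi> i\<psi>)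
    then show "integrable lborel (\<lambda>r. indicator {s..u} r *\<^sub>R norm (\<psi> n r - \<phi> r))"
      "integrable lborel (\<lambda>r. indicator ?I r *\<^sub>R norm (\<psi> n r - \<phi> r))"
      using set_integrable_subset[of lborel "{s..u}" "\<lambda>r. norm (\<psi> n r - \<phi> r)" ?I] I(1)
      by (auto simp: set_integrable_def)
  qed (use I in \<open>auto simp: indicator_def\<close>)
  finally show ?thesis by (simp only: h_def[symmetric])
  qed
  then show ?thesis using lim\<delta> by blast
qed

lemma set_integral_Icc_split:
  fixes g :: "real \<Rightarrow> 'a::{banach, second_countable_topology}"
  assumes i: "set_integrable lborel {a..c} g" and abc: "a \<le> b" "b \<le> c"
  shows "(LINT v:{a..c}|lborel. g v) = (LINT v:{a..b}|lborel. g v) + (LINT v:{b..c}|lborel. g v)"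
proof -
  have i1: "set_integrable lborel {a..b} g" "set_integrable lborel {a..<b} g" "set_integrable lborel {b..c} g"
    by (rule set_integrable_subset[OF i]; use abc in auto)+
  have "(LINT v:{a..c}|lborel. g v) = (LINT v:{a..<b} \<union> {b..c}|lborel. g v)"
    using abc by (intro arg_cong[where f="\<lambda>A. set_lebesgue_integral lborel A g"]) auto
  also have "\<dots> = (LINT v:{a..<b}|lborel. g v) + (LINT v:{b..c}|lborel. g v)"
    by (rule set_integral_Un[OF _ i1(2,3)]) auto
  also have "(LINT v:{a..<b}|lborel. g v) = (LINT v:{a..b}|lborel. g v)"
    unfolding set_lebesgue_integral_def
  proof (rule integral_cong_AE)
    show "AE v in lborel. indicator {a..<b} v *\<^sub>R g v = indicator {a..b} v *\<^sub>R g v"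
      using AE_lborel_singleton[of b] by eventually_elim (auto simp: indicator_def)
  qed (use i1 in \<open>auto simp: set_integrable_def\<close>)
  finally show ?thesis .
qed

lemma set_integral_singleton: "(LINT v:{a..a::real}|lborel. g v) = (0 :: 'a::{banach, second_countable_topology})"
  unfolding set_lebesgue_integral_def
  by (rule integral_eq_zero_AE) (use AE_lborel_singleton[of a] in eventually_elim, simp)

text \<open>
  One-sided limits make the function bounded near each point, and finitely many such neighbourhoods
  cover the interval.
\<close>

lemma cadlag_on_bounded:
  fixes g :: "real \<Rightarrow> 'a::real_normed_vector"
  assumes cl: "cadlag_on t T g"
  obtains B where "\<And>r. r \<in> {t..T} \<Longrightarrow> norm (g r) \<le> B"
proof -
  have loc: "\<exists>U. open U \<and> s \<in> U \<and> (\<exists>B. \<forall>r\<in>U \<inter> {t..T}. norm (g r) \<le> B)" if s: "s \<in> {t..T}" for s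
  proof -
    have "(g \<longlongrightarrow> g s) (at s within {s..T})"
      using cl s by (auto simp: cadlag_on_def continuous_within)
    then have "\<forall>\<^sub>F r in at s within {s..T}. dist (g r) (g s) < 1" by (rule tendstoD) simp
    then obtain U1 where U1: "open U1" "s \<in> U1" "\<And>r. r \<in> U1 \<Longrightarrow> r \<noteq> s \<Longrightarrow> r \<in> {s..T} \<Longrightarrow> dist (g r) (g s) < 1"
      unfolding eventually_at_topological by blast
    obtain l where "(g \<longlongrightarrow> l) (at s within {t..<s})" using cl s unfolding cadlag_on_def by blast
    then have "\<forall>\<^sub>F r in at s within {t..<s}. dist (g r) l < 1" by (rule tendstoD) simp
    then obtain U2 where U2: "open U2" "s \<in> U2" "\<And>r. r \<in> U2 \<Longrightarrow> r \<noteq> s \<Longrightarrow> r \<in> {t..<s} \<Longrightarrow> dist (g r) l < 1"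
      unfolding eventually_at_topological by blast
    have "norm (g r) \<le> 1 + norm (g s) + norm l" if r: "r \<in> (U1 \<inter> U2) \<inter> {t..T}" for r
    proof -
      consider "r = s" | "r > s" | "r < s" by linarith
      then show ?thesis
      proof cases
        case 2 then have "dist (g r) (g s) < 1" using r by (intro U1(3)) auto
        then show ?thesis using norm_triangle_sub[of "g r" "g s"] norm_ge_zero[of l] unfolding dist_norm by linarith
      next
        case 3 then have "dist (g r) l < 1" using r by (intro U2(3)) auto
        then show ?thesis using norm_triangle_sub[of "g r" l] norm_ge_zero[of "g s"] unfolding dist_norm by linarith
      qed auto
    qed
    then show ?thesis using U1(1,2) U2(1,2) by (intro exI[of _ "U1 \<inter> U2"] conjI exI ballI open_Int IntI)
  qed
  then obtain U B where U: "\<And>s. s \<in> {t..T} \<Longrightarrow> open (U s) \<and> s \<in> U s \<and> (\<forall>r\<in>U s \<inter> {t..T}. norm (g r) \<le> B s)"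
    by metis
  obtain D where D: "D \<subseteq> {t..T}" "finite D" "{t..T} \<subseteq> (\<Union>s\<in>D. U s)"
    using compactE_image[OF compact_Icc, of "{t..T}" U t T] U by blast
  show thesis
  proof
    fix r assume r: "r \<in> {t..T}"
    then obtain s where s: "s \<in> D" "r \<in> U s" using D by auto
    then have "norm (g r) \<le> B s" using U D r by auto
    also have "B s \<le> Max (B ` D)" using s D by auto
    finally show "norm (g r) \<le> Max (B ` D)" .
  qed
qed

section \<open>The Euler scheme for additive noise\<close>

lemma discrete_gronwall:
  fixes a :: "nat \<Rightarrow> real"
  assumes step: "\<And>k. k \<le> n \<Longrightarrow> a k \<le> \<epsilon> + c * (\<Sum>j<k. a j)" and c: "0 \<le> c" and kn: "k \<le> n"
  shows "a k \<le> \<epsilon> * (1 + c) ^ k"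
proof -
  have S: "\<epsilon> + c * (\<Sum>j<k. a j) \<le> \<epsilon> * (1 + c) ^ k" if "k \<le> n" for k
    using that
  proof (induction k)
    case (Suc k)
    have "\<epsilon> + c * (\<Sum>j<Suc k. a j) = (\<epsilon> + c * (\<Sum>j<k. a j)) + c * a k"
      by (simp add: algebra_simps)
    also have "\<dots> \<le> (\<epsilon> + c * (\<Sum>j<k. a j)) + c * (\<epsilon> + c * (\<Sum>j<k. a j))"
      using step[of k] Suc.prems c by (intro add_left_mono mult_left_mono) simp_all
    also have "\<dots> = (\<epsilon> + c * (\<Sum>j<k. a j)) * (1 + c)" by (simp add: algebra_simps)
    also have "\<dots> \<le> \<epsilon> * (1 + c) ^ k * (1 + c)"
      using Suc c by (intro mult_right_mono) auto
    finally show ?case by (simp add: algebra_simps)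
  qed simp
  show ?thesis using S[OF kn] step[OF kn] by linarith
qed

lemma one_plus_power_le_exp:
  assumes "0 \<le> (x::real)" "k \<le> Suc n"
  shows "(1 + x / real (Suc n)) ^ k \<le> exp x"
proof -
  have "(1 + x / real (Suc n)) ^ k \<le> (1 + x / real (Suc n)) ^ Suc n"
    using assms by (intro power_increasing) auto
  also have "\<dots> \<le> exp (x / real (Suc n)) ^ Suc n"
    using assms by (intro power_mono exp_ge_add_one_self) auto
  also have "\<dots> = exp (real (Suc n) * (x / real (Suc n)))" by (simp only: exp_of_nat_mult)
  also have "\<dots> = exp x" by simp
  finally show ?thesis .
qed

lemma norm_add3_le: "norm ((a::'a::real_normed_vector) + b + c) \<le> norm a + norm b + norm c"
  by (meson add_right_mono norm_triangle_ineq norm_triangle_le)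

text \<open>
  The increments \<open>D\<close> of the driving path are added as they are; only the drift is discretised.
\<close>

primrec euler :: "(real \<Rightarrow> 'a \<Rightarrow> 'a::real_vector) \<Rightarrow> real \<Rightarrow> real \<Rightarrow> 'a \<Rightarrow> (nat \<Rightarrow> 'a) \<Rightarrow> nat \<Rightarrow> 'a" where
  "euler \<beta> s h y D 0 = y"
| "euler \<beta> s h y D (Suc k) = euler \<beta> s h y D k + h *\<^sub>R \<beta> (s + real k * h) (euler \<beta> s h y D k) + D k"

text \<open>
  The error against the true path satisfies a discrete Gronwall inequality whose inhomogeneous part is
  a Riemann-sum error of \<open>r \<mapsto> \<beta> r (Y r)\<close>. The Lipschitz condition compares an arbitrary point only
  with the point of the true path, which is bounded; so a constant that grows with the second argument
  still gives a uniform \<open>L\<close>.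
\<close>

lemma euler_tendsto:
  fixes \<beta> :: "real \<Rightarrow> 'a::euclidean_space \<Rightarrow> 'a" and Y Z :: "real \<Rightarrow> 'a"
  assumes lt: "s < u"
    and eq: "\<And>r. r \<in> {s..u} \<Longrightarrow> Y r = Y s + (LINT v:{s..r}|lborel. \<beta> v (Y v)) + (Z r - Z s)"
    and rc: "\<And>r. r \<in> {s..u} \<Longrightarrow> continuous (at r within {r..u}) (\<lambda>r. \<beta> r (Y r))"
    and bd: "\<And>r. r \<in> {s..u} \<Longrightarrow> norm (\<beta> r (Y r)) \<le> B"
    and lip: "\<And>r z. r \<in> {s..u} \<Longrightarrow> norm (\<beta> r z - \<beta> r (Y r)) \<le> L * norm (z - Y r)"
  shows "(\<lambda>n. euler \<beta> s (mesh s u n) (Y s)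
            (\<lambda>k. Z (s + real (Suc k) * mesh s u n) - Z (s + real k * mesh s u n))
            (Suc n)) \<longlonglongrightarrow> Y u"
proof -
  have "\<exists>\<delta>. \<delta> \<longlonglongrightarrow> 0 \<and> (\<forall>n k. k \<le> Suc n \<longrightarrow>
      norm ((\<Sum>j<k. mesh s u n *\<^sub>R \<beta> (s + real (Suc j) * mesh s u n)
                       (Y (s + real (Suc j) * mesh s u n)))
        - (LINT r:{s..s + real k * mesh s u n}|lborel. \<beta> r (Y r))) \<le> \<delta> n)"
    by (rule right_riemann_sums[OF lt rc bd])
  then obtain \<delta> where \<delta>: "\<delta> \<longlonglongrightarrow> 0" and riem: "\<forall>n k. k \<le> Suc n \<longrightarrow>
      norm ((\<Sum>j<k. mesh s u n *\<^sub>R \<beta> (s + real (Suc j) * mesh s u n)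
                       (Y (s + real (Suc j) * mesh s u n)))
        - (LINT r:{s..s + real k * mesh s u n}|lborel. \<beta> r (Y r))) \<le> \<delta> n"
    by (elim exE conjE)
  define L' where "L' = max L 0"
  have lip': "norm (\<beta> r z - \<beta> r (Y r)) \<le> L' * norm (z - Y r)" if "r \<in> {s..u}" for r z
    using lip[OF that, of z] mult_right_mono[of L L' "norm (z - Y r)"] by (simp add: L'_def)
  define E where "E n = euler \<beta> s (mesh s u n) (Y s)
            (\<lambda>k. Z (s + real (Suc k) * mesh s u n) - Z (s + real k * mesh s u n))" for n
  define C where "C = exp (L' * (u - s))"
  have err: "norm (E n (Suc n) - Y u) \<le> (\<delta> n + 2 * B * mesh s u n) * C" for n
  proof -
    define h where "h = mesh s u n"
    have h: "h > 0" using lt by (simp add: h_def)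
    have hn: "real (Suc n) * h = u - s" by (simp add: h_def)
    define \<tau> where "\<tau> k = s + real k * h" for k
    have \<tau>: "\<tau> k \<in> {s..u}" if "k \<le> Suc n" for k
    proof -
      have "real k * h \<le> real (Suc n) * h" using h that by (intro mult_right_mono) auto
      then show ?thesis using h unfolding hn by (auto simp: \<tau>_def)
    qed
    define \<phi> where "\<phi> r = \<beta> r (Y r)" for r
    have E0: "E n 0 = Y s" by (simp add: E_def)
    have ES: "E n (Suc k) = E n k + h *\<^sub>R \<beta> (\<tau> k) (E n k) + (Z (\<tau> (Suc k)) - Z (\<tau> k))" for k
      unfolding E_def euler.simps h_def[symmetric] \<tau>_def ..
    have Ek: "E n k = Y s + (\<Sum>j<k. h *\<^sub>R \<beta> (\<tau> j) (E n j)) + (Z (\<tau> k) - Z s)" for k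
      by (induction k) (simp_all add: E0 ES, simp add: \<tau>_def)
    \<comment> \<open>The scheme uses left end points, the Riemann sums right end points: one boundary term of size \<open>h\<close>.\<close>
    have shift: "(\<Sum>j<k. h *\<^sub>R \<phi> (\<tau> j)) = (\<Sum>j<k. h *\<^sub>R \<phi> (\<tau> (Suc j))) + h *\<^sub>R (\<phi> (\<tau> 0) - \<phi> (\<tau> k))" for k
      by (induction k) (simp_all add: algebra_simps)
    define e where "e k = norm (E n k - Y (\<tau> k))" for k
    have "e k \<le> (\<delta> n + 2 * B * h) + (h * L') * (\<Sum>j<k. e j)" if k: "k \<le> Suc n" for k
    proof -
      have "E n k - Y (\<tau> k) = (\<Sum>j<k. h *\<^sub>R (\<beta> (\<tau> j) (E n j) - \<phi> (\<tau> j)))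
          + ((\<Sum>j<k. h *\<^sub>R \<phi> (\<tau> (Suc j))) - (LINT v:{s..\<tau> k}|lborel. \<beta> v (Y v)))
          + h *\<^sub>R (\<phi> (\<tau> 0) - \<phi> (\<tau> k))"
        unfolding Ek[of k] eq[OF \<tau>[OF k]] using shift[of k]
        by (simp add: scaleR_diff_right sum_subtractf)
      then have "e k \<le> norm (\<Sum>j<k. h *\<^sub>R (\<beta> (\<tau> j) (E n j) - \<phi> (\<tau> j)))
          + norm ((\<Sum>j<k. h *\<^sub>R \<phi> (\<tau> (Suc j))) - (LINT v:{s..\<tau> k}|lborel. \<beta> v (Y v)))
          + norm (h *\<^sub>R (\<phi> (\<tau> 0) - \<phi> (\<tau> k)))"
        unfolding e_def by (simp only: norm_add3_le)
      moreover have "norm (\<Sum>j<k. h *\<^sub>R (\<beta> (\<tau> j) (E n j) - \<phi> (\<tau> j))) \<le> (\<Sum>j<k. (h * L') * e j)"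
      proof (rule sum_norm_le)
        fix j assume "j \<in> {..<k}"
        then have "\<tau> j \<in> {s..u}" using \<tau> k by simp
        then show "norm (h *\<^sub>R (\<beta> (\<tau> j) (E n j) - \<phi> (\<tau> j))) \<le> (h * L') * e j"
          using lip'[of "\<tau> j" "E n j"] h by (simp add: \<phi>_def e_def)
      qed
      moreover have "norm ((\<Sum>j<k. h *\<^sub>R \<phi> (\<tau> (Suc j))) - (LINT v:{s..\<tau> k}|lborel. \<beta> v (Y v))) \<le> \<delta> n"
        using riem[rule_format, OF k] unfolding \<phi>_def \<tau>_def h_def[symmetric] .
      moreover have "norm (h *\<^sub>R (\<phi> (\<tau> 0) - \<phi> (\<tau> k))) \<le> 2 * B * h"
      proof -
        have "norm (\<phi> (\<tau> 0) - \<phi> (\<tau> k)) \<le> B + B"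
          using bd[OF \<tau>[of 0]] bd[OF \<tau>[OF k]] unfolding \<phi>_def
          by (intro order_trans[OF norm_triangle_ineq4 add_mono]) auto
        then show ?thesis using h by (simp add: mult.commute)
      qed
      ultimately show ?thesis by (simp add: sum_distrib_left)
    qed
    then have "e (Suc n) \<le> (\<delta> n + 2 * B * h) * (1 + h * L') ^ Suc n"
      using h by (intro discrete_gronwall[where n="Suc n"]) (auto simp: L'_def)
    also have "(1 + h * L') ^ Suc n \<le> C"
      using one_plus_power_le_exp[of "L' * (u - s)" "Suc n" n] lt unfolding C_def h_def
      by (simp add: L'_def mult.commute)
    finally have "e (Suc n) \<le> (\<delta> n + 2 * B * h) * C"
    proof -
      have "0 \<le> \<delta> n" using order_trans[OF norm_ge_zero riem[rule_format, of 0 n]] by simp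
      moreover have "0 \<le> B" using order_trans[OF norm_ge_zero bd[of s]] lt by simp
      ultimately have "0 \<le> \<delta> n + 2 * B * h" using h by simp
      then show ?thesis
        using \<open>e (Suc n) \<le> (\<delta> n + 2 * B * h) * (1 + h * L') ^ Suc n\<close> \<open>(1 + h * L') ^ Suc n \<le> C\<close>
        by (meson mult_left_mono order_trans)
    qed
    moreover have "\<tau> (Suc n) = u" unfolding \<tau>_def hn by simp
    ultimately show ?thesis by (simp add: e_def h_def)
  qed
  have "(\<lambda>n. (\<delta> n + 2 * B * mesh s u n) * C) \<longlonglongrightarrow> (0 + 2 * B * 0) * C"
    by (intro tendsto_intros \<delta> LIMSEQ_Suc[OF lim_const_over_n[of "u - s"]])
  then have "(\<lambda>n. E n (Suc n) - Y u) \<longlonglongrightarrow> 0"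
    by (intro Lim_null_comparison[OF always_eventually[OF allI[OF err]]]) simp
  then show ?thesis unfolding E_def by (simp add: LIM_zero_iff)
qed

text \<open>
  The difference between the scheme and the driving path grows only through the drift, so it is
  controlled by the average size of the driving path over the grid.
\<close>

lemma euler_growth:
  fixes \<beta> :: "real \<Rightarrow> 'a::real_normed_vector \<Rightarrow> 'a" and Z :: "nat \<Rightarrow> 'a"
  assumes growth: "\<And>r z. r \<in> {s..u} \<Longrightarrow> norm (\<beta> r z) \<le> C * (1 + norm z)"
    and su: "s \<le> u" "u - s \<le> T" and C: "0 \<le> C" and Z0: "Z 0 = 0"
  shows "norm (euler \<beta> s (mesh s u n) y (\<lambda>k. Z (Suc k) - Z k) (Suc n))
    \<le> (norm y + C * T + C * T * ((\<Sum>j<Suc n. norm (Z j)) / real (Suc n))) * exp (C * T) + norm (Z (Suc n))"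
proof -
  define h where "h = mesh s u n"
  have h: "h \<ge> 0" using su by (simp add: h_def)
  have hn: "real (Suc n) * h = u - s" by (simp add: h_def)
  have T: "T \<ge> 0" using su by simp
  have \<tau>: "s + real k * h \<in> {s..u}" if "k \<le> Suc n" for k
  proof -
    have "real k * h \<le> real (Suc n) * h" using h that by (intro mult_right_mono) auto
    then show ?thesis using h unfolding hn by auto
  qed
  define E where "E = euler \<beta> s h y (\<lambda>k. Z (Suc k) - Z k)"
  have Ek: "E k - Z k = y + (\<Sum>j<k. h *\<^sub>R \<beta> (s + real j * h) (E j))" for k
    by (induction k) (simp_all add: E_def Z0)
  define w where "w k = norm (E k - Z k)" for k
  define A where "A = (\<Sum>j<Suc n. norm (Z j)) / real (Suc n)"
  define a where "a = norm y + C * T + C * T * A"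
  have A: "A \<ge> 0" by (simp add: A_def sum_nonneg)
  have a: "a \<ge> 0" using C T A by (simp add: a_def)
  have hC: "h * C * (\<Sum>j<k. (1 + norm (Z j))) \<le> C * T + C * T * A" if k: "k \<le> Suc n" for k
  proof -
    have "h * C * (\<Sum>j<k. (1 + norm (Z j))) \<le> h * C * (\<Sum>j<Suc n. (1 + norm (Z j)))"
      using h C k by (intro mult_left_mono sum_mono2) auto
    also have "\<dots> = h * C * (real (Suc n) + real (Suc n) * A)" by (simp add: A_def sum.distrib)
    also have "\<dots> = C * (u - s) + C * (u - s) * A" unfolding hn[symmetric] by (simp add: algebra_simps)
    also have "\<dots> \<le> C * T + C * T * A"
      using su C A by (intro add_mono mult_mono mult_nonneg_nonneg mult_left_mono) auto
    finally show ?thesis .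
  qed
  have "w k \<le> a + (h * C) * (\<Sum>j<k. w j)" if k: "k \<le> Suc n" for k
  proof -
    have "w k \<le> norm y + (\<Sum>j<k. norm (h *\<^sub>R \<beta> (s + real j * h) (E j)))"
      unfolding w_def Ek by (rule order_trans[OF norm_triangle_ineq add_left_mono[OF norm_sum]])
    also have "(\<Sum>j<k. norm (h *\<^sub>R \<beta> (s + real j * h) (E j))) \<le> (\<Sum>j<k. h * (C * (1 + norm (Z j) + w j)))"
    proof (rule sum_mono)
      fix j assume "j \<in> {..<k}"
      then have "norm (\<beta> (s + real j * h) (E j)) \<le> C * (1 + norm (E j))" using \<tau> k by (intro growth) auto
      also have "\<dots> \<le> C * (1 + norm (Z j) + w j)"
        using norm_triangle_sub[of "E j" "Z j"] C by (intro mult_left_mono) (auto simp: w_def)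
      finally show "norm (h *\<^sub>R \<beta> (s + real j * h) (E j)) \<le> h * (C * (1 + norm (Z j) + w j))"
        using h by (simp add: mult_left_mono)
    qed
    also have "\<dots> = h * C * (\<Sum>j<k. (1 + norm (Z j))) + (h * C) * (\<Sum>j<k. w j)"
      by (simp add: sum_distrib_left sum.distrib[symmetric] algebra_simps)
    finally show ?thesis using hC[OF k] by (simp add: a_def)
  qed
  then have "w (Suc n) \<le> a * (1 + h * C) ^ Suc n"
    using h C by (intro discrete_gronwall[where n="Suc n"]) auto
  also have "(1 + h * C) ^ Suc n \<le> exp (C * (u - s))"
    using one_plus_power_le_exp[of "C * (u - s)" "Suc n" n] su C unfolding h_def by (simp add: mult.commute)
  also have "\<dots> \<le> exp (C * T)" using su C by (simp add: mult_left_mono)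
  finally have "w (Suc n) \<le> a * exp (C * T)" using a by (simp add: mult_left_mono)
  moreover have "norm (E (Suc n)) \<le> w (Suc n) + norm (Z (Suc n))"
    unfolding w_def using norm_triangle_sub[of "E (Suc n)" "Z (Suc n)"] by simp
  ultimately have "norm (E (Suc n)) \<le> a * exp (C * T) + norm (Z (Suc n))" by linarith
  then show ?thesis unfolding E_def h_def a_def A_def .
qed

lemma euler_cong: "(\<And>k. k < n \<Longrightarrow> D k = D' k) \<Longrightarrow> euler \<beta> s h y D n = euler \<beta> s h y D' n"
  by (induction n) auto

section \<open>Jumps of a counting path and moment inequalities\<close>

text \<open>
  On \<open>[0, r)\<close> the path takes finitely many values and attains the largest of them; by monotonicity
  it stays there until \<open>r\<close>.
\<close>

lemma counting_path_left_limit: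
  assumes n: "counting_path n" and r: "0 < r"
  shows "\<exists>d. 0 \<le> d \<and> d < r \<and> (\<forall>x. d < x \<longrightarrow> x < r \<longrightarrow> n x = left_limit n r)"
proof -
  have mono: "n x \<le> n y" if "0 \<le> x" "x \<le> y" for x y
    using n that by (auto simp: counting_path_def mono_on_def)
  have sub: "n ` {0..<r} \<subseteq> {..n r}" using mono by auto
  then have fin: "finite (n ` {0..<r})" by (rule finite_subset) simp
  have ne: "n ` {0..<r} \<noteq> {}" using r by auto
  define c where "c = Max (n ` {0..<r})"
  obtain d where d: "0 \<le> d" "d < r" "n d = c" using Max_in[OF fin ne] unfolding c_def by auto
  have const: "n x = c" if "d < x" "x < r" for x
  proof (rule antisym)
    show "n x \<le> c" unfolding c_def using that d fin by (intro Max_ge) auto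
    show "c \<le> n x" using mono[of d x] d that by auto
  qed
  have "\<forall>\<^sub>F x in at_left r. n x = c"
    using eventually_at_left_real[OF d(2)] by eventually_elim (auto intro: const)
  then have "(n \<longlongrightarrow> c) (at_left r)" by (rule tendsto_eventually)
  then have "left_limit n r = c" unfolding left_limit_def by (intro tendsto_Lim) auto
  then show ?thesis using d(1,2) const by auto
qed

text \<open>
  Jumps have size one and every level above \<open>n t\<close> is first reached, by right-continuity, at a jump.
  So \<open>n\<close> maps the jump times in \<open>(t, u]\<close> bijectively to the levels in \<open>(n t, n u]\<close>.
\<close>

lemma jump_integral_eq_sum:
  assumes n: "counting_path n" and t: "0 \<le> t" "t \<le> u"
  shows "jump_integral n h t u = (\<Sum>i\<in>{n t<..n u}. h i)"
proof -
  have mono: "n x \<le> n y" if "0 \<le> x" "x \<le> y" for x y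
    using n that by (auto simp: counting_path_def mono_on_def)
  define J where "J = {r. t < r \<and> r \<le> u \<and> n r \<noteq> left_limit n r}"
  have below: "\<exists>x. max 0 y \<le> x \<and> x < r \<and> n x = left_limit n r" if "0 < r" "y < r" for y r
  proof -
    obtain d where d: "0 \<le> d" "d < r" "\<And>x. d < x \<Longrightarrow> x < r \<Longrightarrow> n x = left_limit n r"
      using counting_path_left_limit[OF n \<open>0 < r\<close>] by blast
    have "n ((max d y + r) / 2) = left_limit n r" using d(1,2) that by (intro d(3)) auto
    moreover have "max 0 y \<le> (max d y + r) / 2" "(max d y + r) / 2 < r" using d that by auto
    ultimately show ?thesis by blast
  qed
  have jump: "n r = Suc (left_limit n r)" if "r \<in> J" for r
  proof -
    have r: "0 < r" using that t by (auto simp: J_def)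
    obtain x where "0 \<le> x" "x < r" "n x = left_limit n r" using below[OF r r] by auto
    then have "left_limit n r \<le> n r" using mono[of x r] by auto
    moreover have "n r \<le> left_limit n r + 1" using n r by (auto simp: counting_path_def)
    moreover have "n r \<noteq> left_limit n r" using that by (auto simp: J_def)
    ultimately show ?thesis by linarith
  qed
  have less: "n x < n r" if *: "r \<in> J" "0 \<le> x" "x < r" for x r
  proof -
    have r: "0 < r" using * by auto
    obtain z where z: "max 0 x \<le> z" "z < r" "n z = left_limit n r" using below[OF r *(3)] by auto
    then have "n x \<le> left_limit n r" using mono[of x z] * by auto
    then show ?thesis using jump[OF *(1)] by simp
  qed
  have "bij_betw n J {n t<..n u}"
    unfolding bij_betw_def
  proof
    show "inj_on n J"
    proof (rule linorder_inj_onI')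
      fix x y assume "x \<in> J" "y \<in> J" "x < y"
      then show "n x \<noteq> n y" using less[of y x] t by (auto simp: J_def)
    qed
    show "n ` J = {n t<..n u}"
    proof
      show "n ` J \<subseteq> {n t<..n u}" using less mono t by (auto simp: J_def)
      show "{n t<..n u} \<subseteq> n ` J"
      proof
        fix i assume i: "i \<in> {n t<..n u}"
        define S where "S = {x. t \<le> x \<and> i \<le> n x}"
        have S: "u \<in> S" "bdd_below S" using i t by (auto simp: S_def intro!: bdd_belowI[of _ t])
        \<comment> \<open>The first time at which the level \<open>i\<close> is reached; it is a jump time with \<open>n r = i\<close>.\<close>
        define r where "r = Inf S"
        have ru: "r \<le> u" unfolding r_def by (rule cInf_lower[OF S])
        have tr: "t \<le> r" unfolding r_def using S(1) by (intro cInf_greatest) (auto simp: S_def)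
        have "continuous (at_right r) n" using n tr t by (auto simp: counting_path_def)
        then have "(n \<longlongrightarrow> n r) (at_right r)" by (simp add: continuous_within)
        then have "\<forall>\<^sub>F x in at_right r. n x = n r" by (simp add: tendsto_discrete)
        then obtain b where b: "b > r" "\<And>x. r < x \<Longrightarrow> x < b \<Longrightarrow> n x = n r"
          unfolding eventually_at_right_field by auto
        obtain x where x: "x \<in> S" "x < b" using cInf_lessD[of S b] S(1) b(1) unfolding r_def by auto
        have "r \<le> x" unfolding r_def by (rule cInf_lower[OF x(1) S(2)])
        then have nr: "i \<le> n r" using b(2)[of x] x by (cases "x = r") (auto simp: S_def)
        have t_lt_r: "t < r" using tr nr i by (cases "t = r") auto
        then have r0: "0 < r" using t by simp
        obtain z where z: "max 0 t \<le> z" "z < r" "n z = left_limit n r" using below[OF r0 t_lt_r] by auto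
        have "z \<notin> S" using cInf_lower[OF _ S(2), of z] z(2) unfolding r_def by auto
        then have "left_limit n r < i" using z by (auto simp: S_def)
        moreover have "n r \<le> left_limit n r + 1" using n r0 by (auto simp: counting_path_def)
        ultimately have "n r = i" "r \<in> J" using nr t_lt_r ru by (auto simp: J_def)
        then show "i \<in> n ` J" by auto
      qed
    qed
  qed
  then have "(\<Sum>i\<in>{n t<..n u}. h i) = (\<Sum>r\<in>J. h (n r))" by (rule sum.reindex_bij_betw[symmetric])
  also have "\<dots> = (\<Sum>r\<in>J. h (1 + left_limit n r) * (real (n r) - real (left_limit n r)))"
    by (rule sum.cong) (simp_all add: jump)
  finally show ?thesis unfolding jump_integral_def J_def ..
qed

lemma jump_integral_split:
  assumes n: "counting_path n" and t: "0 \<le> t" "t \<le> s" "s \<le> u"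
  shows "jump_integral n h t u = jump_integral n h t s + jump_integral n h s u"
proof -
  have "n t \<le> n s" "n s \<le> n u" using n t by (auto simp: counting_path_def mono_on_def)
  then have "{n t<..n u} = {n t<..n s} \<union> {n s<..n u}" by auto
  then show ?thesis
    using jump_integral_eq_sum[OF n] t by (simp add: sum.union_disjoint)
qed

lemma sum_power_le:
  fixes a :: "'i \<Rightarrow> real"
  assumes "finite A" "\<And>i. i \<in> A \<Longrightarrow> 0 \<le> a i" "0 < p"
  shows "(\<Sum>i\<in>A. a i) ^ p \<le> real (card A) ^ p * (\<Sum>i\<in>A. a i ^ p)"
proof (cases "A = {}")
  case False
  define b where "b = Max (a ` A)"
  have b: "b \<in> a ` A" "\<And>i. i \<in> A \<Longrightarrow> a i \<le> b" using assms False by (auto simp: b_def)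
  have b0: "0 \<le> b" using b assms by auto
  have "(\<Sum>i\<in>A. a i) ^ p \<le> (real (card A) * b) ^ p"
    using assms b sum_bounded_above[of A a b] by (intro power_mono sum_nonneg) auto
  also have "\<dots> = real (card A) ^ p * b ^ p" by (simp add: power_mult_distrib)
  also have "b ^ p \<le> (\<Sum>i\<in>A. a i ^ p)"
    using b(1) assms by (auto intro: member_le_sum)
  finally show ?thesis by (simp add: mult_left_mono)
qed (use assms in \<open>simp add: power_0_left\<close>)

lemma power_mean_le:
  fixes a :: "'i \<Rightarrow> real"
  assumes "finite A" "A \<noteq> {}" "even p"
  shows "((\<Sum>i\<in>A. a i) / card A) ^ p \<le> (\<Sum>i\<in>A. a i ^ p) / card A"
proof -
  have "(\<Sum>i\<in>A. (1 / real (card A)) *\<^sub>R a i) ^ p \<le> (\<Sum>i\<in>A. (1 / real (card A)) * a i ^ p)"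
    using assms by (intro convex_on_sum[OF _ _ convex_power_even]) (auto simp: card_gt_0_iff)
  then show ?thesis by (simp add: sum_divide_distrib)
qed

lemma power_add_le:
  fixes a b :: real
  assumes "0 \<le> a" "0 \<le> b"
  shows "(a + b) ^ p \<le> 2 ^ p * (a ^ p + b ^ p)"
proof -
  have "(a + b) ^ p \<le> (2 * max a b) ^ p" using assms by (intro power_mono) auto
  also have "\<dots> = 2 ^ p * max a b ^ p" by (simp add: power_mult_distrib)
  also have "max a b ^ p \<le> a ^ p + b ^ p" using assms by (auto simp: max_def)
  finally show ?thesis by (simp add: mult_left_mono)
qed

lemma power_le_fact_exp: "real n ^ p \<le> fact p * exp (real n)"
proof -
  have "real n ^ p /\<^sub>R fact p \<le> (\<Sum>k. real n ^ k /\<^sub>R fact k)"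
    using sum_le_suminf[OF summable_exp_generic, of "{p}" "real n"] by simp
  then show ?thesis by (simp add: exp_def field_simps)
qed

lemma poisson_moment_finite:
  assumes "0 < rate"
  shows "(\<integral>\<^sup>+k. ennreal (real k ^ p) \<partial>measure_pmf (poisson_pmf rate)) < \<infinity>"
proof -
  have *: "summable (\<lambda>k. rate ^ k / fact k * exp (- rate) * (fact p * exp (real k)))"
  proof -
    have "summable (\<lambda>k. (exp (- rate) * fact p) * ((rate * exp 1) ^ k /\<^sub>R fact k))"
      by (intro summable_mult summable_exp_generic)
    then show ?thesis by (rule summable_cong[THEN iffD1, rotated])
       (auto simp: field_simps power_mult_distrib exp_of_nat_mult[symmetric])
  qed
  have "(\<integral>\<^sup>+k. ennreal (real k ^ p) \<partial>measure_pmf (poisson_pmf rate))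
      \<le> (\<integral>\<^sup>+k. ennreal (fact p * exp (real k)) \<partial>measure_pmf (poisson_pmf rate))"
    by (intro nn_integral_mono ennreal_leI power_le_fact_exp)
  also have "\<dots> = (\<integral>\<^sup>+k. ennreal (rate ^ k / fact k * exp (- rate)) * ennreal (fact p * exp (real k)) \<partial>count_space UNIV)"
    using assms by (simp add: nn_integral_measure_pmf)
  also have "\<dots> = (\<Sum>k. ennreal (rate ^ k / fact k * exp (- rate) * (fact p * exp (real k))))"
    using assms by (subst nn_integral_count_space_nat) (simp add: ennreal_mult'[symmetric])
  also have "\<dots> < \<infinity>"
    using * assms by (subst suminf_ennreal_eq[OF _ summable_sums]) auto
  finally show ?thesis .
qed

text \<open>
  The shape of the bound in \<open>euler_growth\<close>, with \<open>A\<close> the average of the noise and \<open>B\<close> its final value.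
\<close>

lemma power_affine_bound:
  fixes a b e :: real
  assumes "0 \<le> a" "0 \<le> b" "1 \<le> e"
  shows "\<exists>c\<ge>0. \<forall>y A B. 0 \<le> y \<longrightarrow> 0 \<le> A \<longrightarrow> 0 \<le> B \<longrightarrow>
    ((y + a + b * A) * e + B) ^ p \<le> c * ((1 + y ^ p) + (A ^ p + B ^ p))"
proof (intro exI conjI allI impI)
  let ?g = "e * (1 + a + b)"
  show "0 \<le> ?g ^ p * (2 ^ p * 2 ^ p)" using assms by simp
  fix y A B :: real assume yAB: "0 \<le> y" "0 \<le> A" "0 \<le> B"
  have "(y + a + b * A) * e + B \<le> ?g * ((1 + y) + (A + B))"
  proof -
    have "y + a + b * A \<le> (1 + a + b) * (1 + y + A)"
      using assms yAB by (simp add: algebra_simps mult_nonneg_nonneg add_nonneg_nonneg)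
    then have "(y + a + b * A) * e \<le> ((1 + a + b) * (1 + y + A)) * e" using assms by (intro mult_right_mono) auto
    moreover have "1 * B \<le> ?g * B" using assms yAB
      by (intro mult_right_mono) (auto intro: order_trans[OF _ mult_mono[of 1 e 1 "1 + a + b"]])
    ultimately show ?thesis by (simp add: algebra_simps)
  qed
  then have "((y + a + b * A) * e + B) ^ p \<le> (?g * ((1 + y) + (A + B))) ^ p"
    using assms yAB by (intro power_mono) auto
  also have "\<dots> = ?g ^ p * ((1 + y) + (A + B)) ^ p" by (simp add: power_mult_distrib)
  also have "\<dots> \<le> ?g ^ p * (2 ^ p * ((1 + y) ^ p + (A + B) ^ p))"
    using assms yAB by (intro mult_left_mono power_add_le) auto
  also have "\<dots> \<le> ?g ^ p * (2 ^ p * (2 ^ p * (1 ^ p + y ^ p) + 2 ^ p * (A ^ p + B ^ p)))"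
    using assms yAB by (intro mult_left_mono add_mono power_add_le) auto
  also have "\<dots> = ?g ^ p * (2 ^ p * 2 ^ p) * ((1 + y ^ p) + (A ^ p + B ^ p))" by (simp add: algebra_simps)
  finally show "((y + a + b * A) * e + B) ^ p \<le> ?g ^ p * (2 ^ p * 2 ^ p) * ((1 + y ^ p) + (A ^ p + B ^ p))" .
qed

section \<open>The driving noise\<close>

definition shock ::
  "model \<Rightarrow> (real \<Rightarrow> 'w \<Rightarrow> real) \<Rightarrow> (real \<Rightarrow> 'w \<Rightarrow> nat) \<Rightarrow> (nat \<Rightarrow> 'w \<Rightarrow> real) \<Rightarrow> real \<Rightarrow> real \<Rightarrow> 'w \<Rightarrow> state"
where
  "shock m W N eta s r \<omega> =
     (volatility m * (W r \<omega> - W s \<omega>), 0, 0, jump_integral (\<lambda>r. N r \<omega>) (\<lambda>i. eta i \<omega>) s r)"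

text \<open>
  A bound for the moments of order \<open>2 * q\<close> of all shocks within the horizon. It is built from
  the laws of Brownian motion, Poisson process and marks, hence is common to all probability spaces.
  The first summand bounds the Gaussian moment, the second the moment of
  \<open>\<Sum>i\<in>{1..N T}. eta i\<close>, using \<open>(\<Sum>i\<in>A. a i) ^ p \<le> card A ^ p * (\<Sum>i\<in>A. a i ^ p)\<close>.
\<close>

definition shock_moment :: "model \<Rightarrow> nat \<Rightarrow> ennreal" where
  "shock_moment m q = 2 ^ (2 * q) *
     (ennreal (volatility m ^ (2 * q) * (fact (2 * q) / fact q) * horizon m ^ q) +
      (\<integral>\<^sup>+k. ennreal (real k ^ (2 * q + 1)) \<partial>measure_pmf (poisson_pmf (intensity m * horizon m))) *
      (\<integral>\<^sup>+x. ennreal (\<bar>x\<bar> ^ (2 * q)) \<partial>mark_law m))"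

lemma mark_moment_finite:
  assumes "valid_model m"
  shows "(\<integral>\<^sup>+x. ennreal (\<bar>x\<bar> ^ p) \<partial>mark_law m) < \<infinity>"
proof -
  have "integrable (mark_law m) (\<lambda>x. x ^ p)" using assms by (auto simp: valid_model_def)
  from integrableD(2)[OF integrable_norm[OF this]] show ?thesis
    by (simp add: power_abs top.not_eq_extremum)
qed

lemma shock_moment_finite:
  assumes "valid_model m"
  shows "shock_moment m q < \<infinity>"
proof -
  have "0 < intensity m * horizon m" using assms by (auto simp: valid_model_def)
  then have "(\<integral>\<^sup>+k. ennreal (real k ^ (2 * q + 1)) \<partial>measure_pmf (poisson_pmf (intensity m * horizon m))) < \<top>"
    using poisson_moment_finite by (simp only: infinity_ennreal_def)
  moreover have "(\<integral>\<^sup>+x. ennreal (\<bar>x\<bar> ^ (2 * q)) \<partial>mark_law m) < \<top>"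
    using mark_moment_finite[OF assms] by (simp only: infinity_ennreal_def)
  ultimately show ?thesis
    unfolding shock_moment_def infinity_ennreal_def ennreal_mult_less_top ennreal_add_less_top
    by (auto simp: power_less_top_ennreal)
qed

lemma space_generated [simp]: "space (generated P X I) = space P"
  unfolding generated_def by (rule space_measure_of) blast

lemma sets_generated: "sets (generated P X I) = sigma_sets (space P) {X i -` B \<inter> space P | i B. i \<in> I \<and> B \<in> sets borel}"
  unfolding generated_def by (rule sets_measure_of) blast

lemma generated_measurable:
  fixes X :: "'i \<Rightarrow> 'w \<Rightarrow> 'a::topological_space"
  assumes "i \<in> I" shows "X i \<in> borel_measurable (generated P X I)"
proof (rule measurableI)
  fix A assume "A \<in> sets (borel :: 'a measure)"
  then show "X i -` A \<inter> space (generated P X I) \<in> sets (generated P X I)"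
    using assms unfolding sets_generated space_generated by (intro sigma_sets.Basic) blast
qed simp

lemma sets_generated_subset:
  assumes sub: "space G = space P" and "\<And>i. i \<in> I \<Longrightarrow> X i \<in> borel_measurable G"
  shows "sets (generated P X I) \<subseteq> sets G"
  unfolding sets_generated sub[symmetric]
  using assms(2) by (intro sets.sigma_sets_subset) (auto dest: measurable_sets)

text \<open>
  The random bounds take countably many values; for each of them the sum is finite and fixed.
\<close>

lemma random_sum_measurable:
  assumes "a \<in> measurable M (count_space UNIV)" "b \<in> measurable M (count_space UNIV)"
    and "\<And>i::nat. 1 \<le> i \<Longrightarrow> e i \<in> borel_measurable M"
  shows "(\<lambda>x. \<Sum>i\<in>{a x<..b x}. e i x :: real) \<in> borel_measurable M"
proof -
  have "(\<lambda>x. \<Sum>i\<in>{k<..b x}. e i x) \<in> borel_measurable M" for k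
  proof (rule measurable_compose_countable[where f="\<lambda>l x. \<Sum>i\<in>{k<..l}. e i x" and g=b])
    show "(\<lambda>x. \<Sum>i\<in>{k<..l}. e i x) \<in> borel_measurable M" for l
      by (intro borel_measurable_sum assms) auto
  qed (fact assms)
  then show ?thesis
    by (intro measurable_compose_countable[where f="\<lambda>k x. \<Sum>i\<in>{k<..b x}. e i x" and g=a] assms(1))
qed

text \<open>
  Independence stated for two sigma-algebras lets the two variables have different value types.
\<close>

lemma (in prob_space) distr_pair_indep_set:
  assumes ind: "indep_set (sets F) (sets G)" and sp: "space F = space M" "space G = space M"
    and X: "X \<in> measurable F S" and Y: "Y \<in> measurable G T"
  shows "distr M (S \<Otimes>\<^sub>M T) (\<lambda>\<omega>. (X \<omega>, Y \<omega>)) = distr M S X \<Otimes>\<^sub>M distr M T Y"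
proof -
  have ev: "sets F \<subseteq> events" "sets G \<subseteq> events"
    using ind by (auto simp: indep_set_def indep_sets_def UNIV_bool)
  have [measurable]: "random_variable S X" "random_variable T Y"
    using X Y ev sp by (auto simp: measurable_def)
  interpret X: prob_space "distr M S X" by (rule prob_space_distr) simp
  interpret Y: prob_space "distr M T Y" by (rule prob_space_distr) simp
  show ?thesis
  proof (rule pair_measure_eqI[symmetric])
    fix A B assume "A \<in> sets (distr M S X)" "B \<in> sets (distr M T Y)"
    then have [measurable]: "A \<in> sets S" "B \<in> sets T" by auto
    have "X -` A \<inter> space M \<in> sets F" "Y -` B \<inter> space M \<in> sets G"
      using measurable_sets[OF X, of A] measurable_sets[OF Y, of B] sp by auto
    from indep_setD[OF ind this]
    have "prob ((X -` A \<inter> space M) \<inter> (Y -` B \<inter> space M)) = prob (X -` A \<inter> space M) * prob (Y -` B \<inter> space M)" .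
    moreover have "(\<lambda>\<omega>. (X \<omega>, Y \<omega>)) -` (A \<times> B) \<inter> space M = (X -` A \<inter> space M) \<inter> (Y -` B \<inter> space M)" by auto
    ultimately show "emeasure (distr M S X) A * emeasure (distr M T Y) B =
        emeasure (distr M (S \<Otimes>\<^sub>M T) (\<lambda>\<omega>. (X \<omega>, Y \<omega>))) (A \<times> B)"
      by (simp add: emeasure_distr emeasure_eq_measure ennreal_mult)
  qed (simp_all add: X.sigma_finite_measure_axioms Y.sigma_finite_measure_axioms)
qed

locale noise =
  fixes m :: model and P :: "'w measure" and F :: "real \<Rightarrow> 'w measure"
    and W :: "real \<Rightarrow> 'w \<Rightarrow> real" and N :: "real \<Rightarrow> 'w \<Rightarrow> nat" and eta :: "nat \<Rightarrow> 'w \<Rightarrow> real"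
  assumes valid: "valid_model m" and driving: "driving_noise m P F W N eta"
begin

sublocale prob_space P using driving by (simp add: driving_noise_def)

abbreviation "J s r \<omega> \<equiv> jump_integral (\<lambda>r. N r \<omega>) (\<lambda>i. eta i \<omega>) s r"
abbreviation "Z \<equiv> shock m W N eta"
abbreviation "dZ s u n \<omega> \<equiv> \<lambda>k. Z (grid s u n k) (grid s u n (Suc k)) \<omega>"

lemma subalg: "subalgebra P (F s)" using driving by (simp add: driving_noise_def)
lemma space_F [simp]: "space (F s) = space P" using subalg[of s] by (simp add: subalgebra_def)
lemma F_mono: "s \<le> r \<Longrightarrow> sets (F s) \<subseteq> sets (F r)"
  using driving by (auto simp: driving_noise_def filtration_def)

lemma W_measurable: "0 \<le> s \<Longrightarrow> W s \<in> borel_measurable P"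
  using driving by (auto simp: driving_noise_def Let_def intro: measurable_from_subalg[OF subalg[of s]])

lemma N_measurable:
  assumes "0 \<le> s" shows "N s \<in> measurable P (count_space UNIV)"
proof -
  have "N s \<in> borel_measurable P"
    using driving assms by (auto simp: driving_noise_def Let_def intro: measurable_from_subalg[OF subalg[of s]])
  then show ?thesis by (simp add: measurable_cong_sets[OF refl sets_borel_eq_count_space])
qed

lemma eta_measurable: "1 \<le> i \<Longrightarrow> eta i \<in> borel_measurable P"
  using driving by (auto simp: driving_noise_def indep_vars_def)

lemma counting_path_N: "\<omega> \<in> space P \<Longrightarrow> counting_path (\<lambda>s. N s \<omega>)"
  using driving by (auto simp: driving_noise_def poisson_process_def)

lemma N_mono: "\<omega> \<in> space P \<Longrightarrow> 0 \<le> s \<Longrightarrow> s \<le> r \<Longrightarrow> N s \<omega> \<le> N r \<omega>"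
  using counting_path_N by (auto simp: counting_path_def mono_on_def)

lemma J_eq: "\<omega> \<in> space P \<Longrightarrow> 0 \<le> s \<Longrightarrow> s \<le> r \<Longrightarrow> J s r \<omega> = (\<Sum>i\<in>{N s \<omega><..N r \<omega>}. eta i \<omega>)"
  by (rule jump_integral_eq_sum[OF counting_path_N])

lemma J_measurable: assumes "0 \<le> s" "s \<le> r" shows "J s r \<in> borel_measurable P"
proof -
  have "(\<lambda>\<omega>. \<Sum>i\<in>{N s \<omega><..N r \<omega>}. eta i \<omega>) \<in> borel_measurable P"
    using assms by (intro random_sum_measurable N_measurable eta_measurable) auto
  then show ?thesis by (rule measurable_cong[THEN iffD1, rotated]) (use assms in \<open>simp add: J_eq\<close>)
qed

lemma Z_measurable: assumes "0 \<le> s" "s \<le> r" shows "Z s r \<in> borel_measurable P"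
proof -
  have [measurable]: "W r \<in> borel_measurable P" "W s \<in> borel_measurable P" "J s r \<in> borel_measurable P"
    using assms J_measurable by (auto intro: W_measurable)
  show ?thesis unfolding shock_def[abs_def] by (intro borel_measurable_Pair) simp_all
qed

lemma Z_add: "\<omega> \<in> space P \<Longrightarrow> 0 \<le> s \<Longrightarrow> s \<le> r \<Longrightarrow> r \<le> u \<Longrightarrow> Z s u \<omega> = Z s r \<omega> + Z r u \<omega>"
  using jump_integral_split[OF counting_path_N, of \<omega> s r u "\<lambda>i. eta i \<omega>"] by (simp add: shock_def algebra_simps)

lemma Z_self: "Z s s \<omega> = 0"
proof -
  have "{u. s < u \<and> u \<le> s \<and> N u \<omega> \<noteq> left_limit (\<lambda>r. N r \<omega>) u} = {}" by auto
  then show ?thesis unfolding shock_def jump_integral_def by (simp only:) (simp add: zero_prod_def)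
qed

text \<open>
  The process of joint increments after \<open>s\<close> contains the increment of the noise over each
  \<open>(s, u]\<close>, and by additivity also those over \<open>(r, u]\<close>.
\<close>

lemma indep_future:
  assumes "0 \<le> s"
  shows "\<exists>G. subalgebra P G \<and> indep_set (sets (F s)) (sets G) \<and>
     (\<forall>r u. s \<le> r \<longrightarrow> r \<le> u \<longrightarrow> Z r u \<in> borel_measurable G)"
proof -
  define X where "X = (\<lambda>u \<omega>. (W u \<omega> - W s \<omega>, real (N u \<omega>) - real (N s \<omega>), J s u \<omega>))"
  define G where "G = generated P X {s..}"
  have ind: "indep_set (sets (F s)) (sets G)"
    using driving assms unfolding driving_noise_def G_def X_def Let_def by blast
  have sp: "space G = space P" by (simp add: G_def)
  have Zs: "Z s u \<in> borel_measurable G" if "s \<le> u" for u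
  proof -
    have [measurable]: "X u \<in> borel_measurable G" unfolding G_def using that by (intro generated_measurable) auto
    have "(\<lambda>\<omega>. (volatility m * fst (X u \<omega>), 0, 0, snd (snd (X u \<omega>))) :: state) \<in> borel_measurable G"
      by (rule measurable_compose[OF \<open>X u \<in> borel_measurable G\<close>, of "\<lambda>p. (volatility m * fst p, 0, 0, snd (snd p))"])
        (intro borel_measurable_continuous_onI continuous_intros)
    then show ?thesis by (simp add: X_def shock_def[abs_def])
  qed
  have "Z r u \<in> borel_measurable G" if "s \<le> r" "r \<le> u" for r u
  proof -
    have "(\<lambda>\<omega>. Z s u \<omega> - Z s r \<omega>) \<in> borel_measurable G"
      using Zs[of u] Zs[of r] that by (intro borel_measurable_diff) auto
    then show ?thesis
      by (rule measurable_cong[THEN iffD1, rotated])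
        (use Z_add[of _ s r u] assms that in \<open>auto simp: sp\<close>)
  qed
  moreover have "sets G \<subseteq> events" using ind by (simp add: indep_set_def indep_sets_def UNIV_bool)
  ultimately show ?thesis using ind sp by (intro exI[of _ G]) (auto simp: subalgebra_def)
qed

lemma W_moment:
  assumes "0 \<le> s" "s \<le> r"
  shows "(\<integral>\<^sup>+\<omega>. ennreal ((W r \<omega> - W s \<omega>) ^ (2 * q)) \<partial>P) \<le> ennreal (fact (2 * q) / fact q * (r - s) ^ q)"
proof (cases "s = r")
  case True
  then show ?thesis by (cases q) (auto simp: emeasure_space_1)
next
  case False
  then have lt: "s < r" using assms by simp
  have D: "distributed P lborel (\<lambda>\<omega>. W r \<omega> - W s \<omega>) (normal_density 0 (sqrt (r - s)))"
    using driving assms lt by (simp add: driving_noise_def brownian_motion_def)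
  have \<sigma>: "0 < sqrt (r - s)" using lt by simp
  have "(\<integral>\<^sup>+\<omega>. ennreal ((W r \<omega> - W s \<omega>) ^ (2 * q)) \<partial>P)
      = (\<integral>\<^sup>+x. ennreal (normal_density 0 (sqrt (r - s)) x) * ennreal (x ^ (2 * q)) \<partial>lborel)"
    by (rule distributed_nn_integral[OF D, symmetric]) simp
  also have "\<dots> = (\<integral>\<^sup>+x. ennreal (normal_density 0 (sqrt (r - s)) x * (x - 0) ^ (2 * q)) \<partial>lborel)"
    by (intro nn_integral_cong) (simp add: ennreal_mult power_mult)
  also have "\<dots> = ennreal (fact (2 * q) / ((2 / (sqrt (r - s))\<^sup>2) ^ q * fact q))"
    using normal_moment_even[OF \<sigma>, of 0 q]
    by (subst nn_integral_eq_integral) (auto simp: has_bochner_integral_iff power_mult)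
  also have "fact (2 * q) / ((2 / (sqrt (r - s))\<^sup>2) ^ q * fact q) = fact (2 * q) / fact q * (r - s) ^ q / 2 ^ q"
    using lt by (simp add: power_divide)
  also have "ennreal \<dots> \<le> ennreal (fact (2 * q) / fact q * (r - s) ^ q)"
    using lt by (intro ennreal_leI) (simp add: divide_le_eq_1 mult_le_cancel_left1 field_simps)
  finally show ?thesis .
qed

lemma N_distr:
  assumes "0 < r" shows "distr P (count_space UNIV) (N r) = measure_pmf (poisson_pmf (intensity m * r))"
proof -
  have "distr P (count_space UNIV) (\<lambda>\<omega>. N r \<omega> - N 0 \<omega>) = measure_pmf (poisson_pmf (intensity m * (r - 0)))"
    using driving assms unfolding driving_noise_def poisson_process_def by blast
  moreover have "distr P (count_space UNIV) (\<lambda>\<omega>. N r \<omega> - N 0 \<omega>) = distr P (count_space UNIV) (N r)"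
    by (rule distr_cong) (use counting_path_N in \<open>auto simp: counting_path_def\<close>)
  ultimately show ?thesis by simp
qed

lemma indep_N_eta:
  assumes f: "f \<in> borel_measurable (count_space UNIV)" and g: "g \<in> borel_measurable borel"
    and i: "1 \<le> i" and r: "0 \<le> r"
  shows "(\<integral>\<^sup>+\<omega>. f (N r \<omega>) * g (eta i \<omega>) \<partial>P) = (\<integral>\<^sup>+\<omega>. f (N r \<omega>) \<partial>P) * (\<integral>\<^sup>+x. g x \<partial>mark_law m)"
proof -
  let ?L = "[sets (generated P W {0..}), sets (generated P N {0..}), sets (generated P eta {1..})]"
  have ind: "indep_sets ((!) ?L) {..<3}" using driving by (simp add: driving_noise_def)
  note [measurable] = N_measurable[OF r] eta_measurable[OF i]
  have "indep_set (sets (generated P N {0..})) (sets (generated P eta {1..}))"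
  proof (rule indep_setI)
    fix A B assume "A \<in> sets (generated P N {0..})" "B \<in> sets (generated P eta {1..})"
    then have "prob (\<Inter>j\<in>{1, 2::nat}. [{}, A, B] ! j) = (\<Prod>j\<in>{1, 2}. prob ([{}, A, B] ! j))"
      by (intro indep_setsD[OF ind]) auto
    then show "prob (A \<inter> B) = prob A * prob B" by simp
  qed (use ind in \<open>auto simp: indep_sets_def lessThan_nat_numeral lessThan_Suc\<close>)
  then have distr: "distr P (count_space UNIV) (N r) \<Otimes>\<^sub>M distr P borel (eta i) = distr P (count_space UNIV \<Otimes>\<^sub>M borel) (\<lambda>\<omega>. (N r \<omega>, eta i \<omega>))"
    using generated_measurable[of r "{0..}" N P] generated_measurable[of i "{1..}" eta P] r i
    by (intro distr_pair_indep_set[symmetric]) (auto simp: measurable_cong_sets[OF refl sets_borel_eq_count_space])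
  interpret E: prob_space "distr P borel (eta i)" by (rule prob_space_distr) simp
  have "(\<integral>\<^sup>+\<omega>. f (N r \<omega>) * g (eta i \<omega>) \<partial>P) = (\<integral>\<^sup>+p. f (fst p) * g (snd p) \<partial>distr P (count_space UNIV \<Otimes>\<^sub>M borel) (\<lambda>\<omega>. (N r \<omega>, eta i \<omega>)))"
    using f g by (subst nn_integral_distr) auto
  also have "\<dots> = (\<integral>\<^sup>+n. \<integral>\<^sup>+x. f n * g x \<partial>distr P borel (eta i) \<partial>distr P (count_space UNIV) (N r))"
    unfolding distr[symmetric] using f g by (subst E.nn_integral_fst[symmetric]) auto
  also have "\<dots> = (\<integral>\<^sup>+n. f n * (\<integral>\<^sup>+x. g x \<partial>distr P borel (eta i)) \<partial>distr P (count_space UNIV) (N r))"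
    using g by (subst nn_integral_cmult) auto
  also have "\<dots> = (\<integral>\<^sup>+n. f n \<partial>distr P (count_space UNIV) (N r)) * (\<integral>\<^sup>+x. g x \<partial>distr P borel (eta i))"
    by (subst nn_integral_multc) (use f in auto)
  also have "(\<integral>\<^sup>+n. f n \<partial>distr P (count_space UNIV) (N r)) = (\<integral>\<^sup>+\<omega>. f (N r \<omega>) \<partial>P)"
    using f by (subst nn_integral_distr) auto
  also have "distr P borel (eta i) = mark_law m" using driving i by (simp add: driving_noise_def)
  finally show ?thesis .
qed

text \<open>
  The jump part is dominated, whatever the time interval, by the sum of all marks up to the horizon.
  Expanding the power over the marks and using independence of marks and Poisson process leaves a
  Poisson moment of one order more.
\<close>

lemma J_moment:
  assumes s: "0 \<le> s" "s \<le> r" "r \<le> horizon m" and p: "0 < p"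
  shows "(\<integral>\<^sup>+\<omega>. ennreal (\<bar>J s r \<omega>\<bar> ^ p) \<partial>P) \<le>
    (\<integral>\<^sup>+k. ennreal (real k ^ (p + 1)) \<partial>measure_pmf (poisson_pmf (intensity m * horizon m))) *
      (\<integral>\<^sup>+x. ennreal (\<bar>x\<bar> ^ p) \<partial>mark_law m)"
proof -
  define T where "T = horizon m"
  have T: "0 < T" using valid by (simp add: T_def valid_model_def)
  have [measurable]: "N T \<in> measurable P (count_space UNIV)" using T by (intro N_measurable) simp
  note [measurable] = eta_measurable
  \<comment> \<open>The cut-off turns the random number of summands into an infinite series, to be integrated termwise.\<close>
  define f where "f i k = (if i < k then ennreal (real k ^ p) else 0)" for i k :: nat
  have bound: "ennreal (\<bar>J s r \<omega>\<bar> ^ p) \<le> (\<Sum>i. f i (N T \<omega>) * ennreal (\<bar>eta (Suc i) \<omega>\<bar> ^ p))" if \<omega>: "\<omega> \<in> space P" for \<omega>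
  proof -
    have NT: "N r \<omega> \<le> N T \<omega>" using N_mono[OF \<omega>, of r T] s by (simp add: T_def)
    have "\<bar>J s r \<omega>\<bar> \<le> (\<Sum>i\<in>{N s \<omega><..N r \<omega>}. \<bar>eta i \<omega>\<bar>)" using s by (simp add: J_eq[OF \<omega>])
    also have "\<dots> \<le> (\<Sum>i\<in>{0<..N T \<omega>}. \<bar>eta i \<omega>\<bar>)" using NT by (intro sum_mono2) auto
    finally have "\<bar>J s r \<omega>\<bar> ^ p \<le> (\<Sum>i\<in>{0<..N T \<omega>}. \<bar>eta i \<omega>\<bar>) ^ p" by (intro power_mono) auto
    also have "\<dots> \<le> real (card {0<..N T \<omega>}) ^ p * (\<Sum>i\<in>{0<..N T \<omega>}. \<bar>eta i \<omega>\<bar> ^ p)"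
      using p by (intro sum_power_le) auto
    also have "(\<Sum>i\<in>{0<..N T \<omega>}. \<bar>eta i \<omega>\<bar> ^ p) = (\<Sum>i<N T \<omega>. \<bar>eta (Suc i) \<omega>\<bar> ^ p)"
      by (rule sum.reindex_bij_witness[of _ Suc "\<lambda>i. i - 1"]) auto
    finally have "ennreal (\<bar>J s r \<omega>\<bar> ^ p) \<le> ennreal (\<Sum>i<N T \<omega>. real (N T \<omega>) ^ p * \<bar>eta (Suc i) \<omega>\<bar> ^ p)"
      by (intro ennreal_leI) (simp add: sum_distrib_left)
    also have "\<dots> = (\<Sum>i<N T \<omega>. f i (N T \<omega>) * ennreal (\<bar>eta (Suc i) \<omega>\<bar> ^ p))"
      by (subst sum_ennreal[symmetric]) (auto simp: f_def ennreal_mult)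
    also have "\<dots> \<le> (\<Sum>i. f i (N T \<omega>) * ennreal (\<bar>eta (Suc i) \<omega>\<bar> ^ p))" by (rule sum_le_suminf) auto
    finally show ?thesis .
  qed
  define Mp where "Mp = (\<integral>\<^sup>+x. ennreal (\<bar>x\<bar> ^ p) \<partial>mark_law m)"
  have "(\<integral>\<^sup>+\<omega>. ennreal (\<bar>J s r \<omega>\<bar> ^ p) \<partial>P) \<le> (\<integral>\<^sup>+\<omega>. (\<Sum>i. f i (N T \<omega>) * ennreal (\<bar>eta (Suc i) \<omega>\<bar> ^ p)) \<partial>P)"
    by (rule nn_integral_mono) (rule bound)
  also have "\<dots> = (\<Sum>i. \<integral>\<^sup>+\<omega>. f i (N T \<omega>) * ennreal (\<bar>eta (Suc i) \<omega>\<bar> ^ p) \<partial>P)"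
    by (rule nn_integral_suminf) measurable
  also have "\<dots> = (\<Sum>i. (\<integral>\<^sup>+\<omega>. f i (N T \<omega>) \<partial>P) * Mp)"
    unfolding Mp_def using T by (subst indep_N_eta) auto
  also have "\<dots> = (\<Sum>i. \<integral>\<^sup>+\<omega>. f i (N T \<omega>) \<partial>P) * Mp" by simp
  also have "(\<Sum>i. \<integral>\<^sup>+\<omega>. f i (N T \<omega>) \<partial>P) = (\<integral>\<^sup>+\<omega>. (\<Sum>i. f i (N T \<omega>)) \<partial>P)"
    by (rule nn_integral_suminf[symmetric]) measurable
  also have "\<dots> = (\<integral>\<^sup>+\<omega>. ennreal (real (N T \<omega>) ^ (p + 1)) \<partial>P)"
  proof (rule nn_integral_cong)
    fix \<omega>
    have "(\<Sum>i. f i (N T \<omega>)) = (\<Sum>i<N T \<omega>. f i (N T \<omega>))" by (rule suminf_finite) (auto simp: f_def)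
    also have "\<dots> = ennreal (real (N T \<omega>) ^ (p + 1))"
      by (simp add: f_def ennreal_mult ennreal_of_nat_eq_real_of_nat)
    finally show "(\<Sum>i. f i (N T \<omega>)) = ennreal (real (N T \<omega>) ^ (p + 1))" .
  qed
  also have "\<dots> = (\<integral>\<^sup>+k. ennreal (real k ^ (p + 1)) \<partial>distr P (count_space UNIV) (N T))"
    by (subst nn_integral_distr) auto
  finally show ?thesis unfolding N_distr[OF T] Mp_def by (simp only: T_def)
qed

lemma Z_moment:
  assumes s: "0 \<le> s" "s \<le> r" "r \<le> horizon m" and q: "0 < q"
  shows "(\<integral>\<^sup>+\<omega>. ennreal (norm (Z s r \<omega>) ^ (2 * q)) \<partial>P) \<le> shock_moment m q"
proof -
  note [measurable] = J_measurable[OF s(1,2)] W_measurable[OF s(1)] W_measurable[OF order_trans[OF s(1,2)]]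
  have "norm (Z s r \<omega>) ^ (2 * q) \<le> 2 ^ (2 * q) * (volatility m ^ (2 * q) * (W r \<omega> - W s \<omega>) ^ (2 * q) + \<bar>J s r \<omega>\<bar> ^ (2 * q))" for \<omega>
  proof -
    have "norm (Z s r \<omega>) \<le> \<bar>volatility m * (W r \<omega> - W s \<omega>)\<bar> + \<bar>J s r \<omega>\<bar>"
      unfolding shock_def by (rule order_trans[OF norm_Pair_le]) (simp add: norm_Pair)
    then have "norm (Z s r \<omega>) ^ (2 * q) \<le> (\<bar>volatility m * (W r \<omega> - W s \<omega>)\<bar> + \<bar>J s r \<omega>\<bar>) ^ (2 * q)"
      by (intro power_mono) auto
    also note power_add_le
    also have "\<bar>volatility m * (W r \<omega> - W s \<omega>)\<bar> ^ (2 * q) = volatility m ^ (2 * q) * (W r \<omega> - W s \<omega>) ^ (2 * q)"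
      by (simp add: power_even_abs power_mult_distrib)
    finally show ?thesis by simp
  qed
  moreover have rhs: "ennreal (2 ^ k * (a * b + c)) = 2 ^ k * (ennreal a * ennreal b + ennreal c)"
    if "0 \<le> a" "0 \<le> b" "0 \<le> c" for a b c :: real and k
  proof -
    have "(2::ennreal) ^ k = ennreal (2 ^ k)" by (simp add: ennreal_power[symmetric])
    then show ?thesis using that by (simp add: ennreal_mult)
  qed
  ultimately have "(\<integral>\<^sup>+\<omega>. ennreal (norm (Z s r \<omega>) ^ (2 * q)) \<partial>P) \<le>
      (\<integral>\<^sup>+\<omega>. 2 ^ (2 * q) * (ennreal (volatility m ^ (2 * q)) * ennreal ((W r \<omega> - W s \<omega>) ^ (2 * q)) + ennreal (\<bar>J s r \<omega>\<bar> ^ (2 * q))) \<partial>P)"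
    by (intro nn_integral_mono order_trans[OF ennreal_leI eq_refl[OF rhs]]) (auto simp: power_mult)
  also have "\<dots> = 2 ^ (2 * q) * (ennreal (volatility m ^ (2 * q)) * (\<integral>\<^sup>+\<omega>. ennreal ((W r \<omega> - W s \<omega>) ^ (2 * q)) \<partial>P)
      + (\<integral>\<^sup>+\<omega>. ennreal (\<bar>J s r \<omega>\<bar> ^ (2 * q)) \<partial>P))"
    by (simp add: nn_integral_cmult nn_integral_add)
  also have "\<dots> \<le> shock_moment m q"
    unfolding shock_moment_def
  proof (intro mult_left_mono add_mono J_moment s)
    have "ennreal (volatility m ^ (2 * q)) * (\<integral>\<^sup>+\<omega>. ennreal ((W r \<omega> - W s \<omega>) ^ (2 * q)) \<partial>P)
        \<le> ennreal (volatility m ^ (2 * q)) * ennreal (fact (2 * q) / fact q * (r - s) ^ q)"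
      by (intro mult_left_mono W_moment s) simp
    also have "\<dots> \<le> ennreal (volatility m ^ (2 * q) * (fact (2 * q) / fact q) * horizon m ^ q)"
      using s by (subst ennreal_mult[symmetric])
        (auto simp: power_mult mult.assoc intro!: ennreal_leI mult_left_mono power_mono divide_right_mono)
    finally show "ennreal (volatility m ^ (2 * q)) * (\<integral>\<^sup>+\<omega>. ennreal ((W r \<omega> - W s \<omega>) ^ (2 * q)) \<partial>P)
        \<le> ennreal (volatility m ^ (2 * q) * (fact (2 * q) / fact q) * horizon m ^ q)" .
  qed (use q in auto)
  finally show ?thesis .
qed

end

section \<open>The law of the noise increments on a grid\<close>

text \<open>
  The joint law of the Brownian increments over \<open>\<tau> 0, \<dots>, \<tau> n\<close>, of the Poisson increments and of
  the marks. The Poisson increments start from time \<open>0\<close>, since the number of jumps before \<open>\<tau> 0\<close>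
  decides which mark comes next. A step of length zero has increment \<open>0\<close>.
\<close>

definition source_law :: "model \<Rightarrow> (nat \<Rightarrow> real) \<Rightarrow> nat \<Rightarrow> (nat \<Rightarrow> nat \<Rightarrow> real) measure" where
  "source_law m \<tau> n = (let \<tau>' = (\<lambda>k. if k = 0 then 0 else \<tau> (k - 1)) in
     PiM {..<3} ((!)
      [PiM {..<n} (\<lambda>k. if \<tau> k = \<tau> (Suc k) then return borel 0
           else density lborel (normal_density 0 (sqrt (\<tau> (Suc k) - \<tau> k)))),
       PiM {..<Suc n} (\<lambda>k. if \<tau>' k = \<tau>' (Suc k) then return borel 0
           else distr (measure_pmf (poisson_pmf (intensity m * (\<tau>' (Suc k) - \<tau>' k)))) borel real),
       PiM {1..} (\<lambda>_. mark_law m)]))"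

text \<open>
  In \<open>x\<close> the components \<open>0, 1, 2\<close> are the Brownian increments, the Poisson increments and the
  marks; \<open>c k x\<close> recovers the number of jumps up to \<open>\<tau> k\<close>.
\<close>

definition increment_law :: "model \<Rightarrow> (nat \<Rightarrow> real) \<Rightarrow> nat \<Rightarrow> (nat \<Rightarrow> state) measure" where
  "increment_law m \<tau> n = (let c = (\<lambda>k x. nat \<lfloor>\<Sum>j\<le>k. x 1 j\<rfloor>) in
     distr (source_law m \<tau> n) (PiM {..<n} (\<lambda>_. borel))
       (\<lambda>x. \<lambda>k\<in>{..<n}. (volatility m * x 0 k, 0, 0, \<Sum>i\<in>{c k x<..c (Suc k) x}. x 2 i)))"

context noise
begin

lemma W_increment_distr:
  assumes "0 \<le> s" "s \<le> r"
  shows "distr P borel (\<lambda>\<omega>. W r \<omega> - W s \<omega>) =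
    (if s = r then return borel 0 else density lborel (normal_density 0 (sqrt (r - s))))"
proof (cases "s = r")
  case True
  then show ?thesis by (simp add: distr_const)
next
  case False
  then have "distributed P lborel (\<lambda>\<omega>. W r \<omega> - W s \<omega>) (normal_density 0 (sqrt (r - s)))"
    using driving assms by (simp add: driving_noise_def brownian_motion_def)
  from distributed_distr_eq_density[OF this] False show ?thesis by (simp cong: distr_cong)
qed

lemma N_increment_distr:
  assumes "0 \<le> s" "s \<le> r"
  shows "distr P borel (\<lambda>\<omega>. real (N r \<omega>) - real (N s \<omega>)) =
    (if s = r then return borel 0 else distr (measure_pmf (poisson_pmf (intensity m * (r - s)))) borel real)"
proof (cases "s = r")
  case True
  then show ?thesis by (simp add: distr_const)
next
  case False
  have [measurable]: "N r \<in> measurable P (count_space UNIV)" "N s \<in> measurable P (count_space UNIV)"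
    using assms by (auto intro: N_measurable)
  have "distr P (count_space UNIV) (\<lambda>\<omega>. N r \<omega> - N s \<omega>) = measure_pmf (poisson_pmf (intensity m * (r - s)))"
    using driving assms False by (simp add: driving_noise_def poisson_process_def)
  moreover have "distr (distr P (count_space UNIV) (\<lambda>\<omega>. N r \<omega> - N s \<omega>)) borel real = distr P borel (\<lambda>\<omega>. real (N r \<omega>) - real (N s \<omega>))"
    by (subst distr_distr) (auto intro!: distr_cong simp: o_def of_nat_diff N_mono assms)
  ultimately show ?thesis using False by simp
qed

text \<open>
  The increments of each process are independent with known laws, and the three sources are
  independent of each other. As all three vectors are sequences of reals, one family of random
  variables indexed by \<open>{..<3}\<close> expresses this.
\<close>

lemma sources_distr:
  fixes \<tau> :: "nat \<Rightarrow> real" and n :: nat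
  assumes \<tau>: "mono \<tau>" "0 \<le> \<tau> 0" and n: "0 < n"
  defines "I \<equiv> (!) [{..<n}, {..<Suc n}, {1..}]"
    and "\<tau>' \<equiv> \<lambda>k. if k = 0 then 0 else \<tau> (k - 1)"
  defines "X \<equiv> \<lambda>i \<omega>. [\<lambda>k\<in>{..<n}. W (\<tau> (Suc k)) \<omega> - W (\<tau> k) \<omega>,
       \<lambda>k\<in>{..<Suc n}. real (N (\<tau>' (Suc k)) \<omega>) - real (N (\<tau>' k) \<omega>), \<lambda>k\<in>{1..}. eta k \<omega>] ! i"
  shows "distr P (PiM {..<3} (\<lambda>i. PiM (I i) (\<lambda>_. borel))) (\<lambda>\<omega>. \<lambda>i\<in>{..<3}. X i \<omega>) =
    source_law m \<tau> n"
proof -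
  let ?R = "[PiM {..<n} (\<lambda>k. if \<tau> k = \<tau> (Suc k) then return borel 0
           else density lborel (normal_density 0 (sqrt (\<tau> (Suc k) - \<tau> k)))),
       PiM {..<Suc n} (\<lambda>k. if \<tau>' k = \<tau>' (Suc k) then return borel 0
           else distr (measure_pmf (poisson_pmf (intensity m * (\<tau>' (Suc k) - \<tau>' k)))) borel real),
       PiM {1..} (\<lambda>_. mark_law m)]"
  have \<tau>0: "0 \<le> \<tau> k" for k using \<tau> monoD[OF \<tau>(1), of 0 k] by simp
  have \<tau>': "mono \<tau>'" "0 \<le> \<tau>' 0" using \<tau>0 \<tau>(1) by (auto simp: \<tau>'_def mono_def)
  have \<tau>'0: "0 \<le> \<tau>' k" for k using \<tau>' monoD[OF \<tau>'(1), of 0 k] by simp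
  let ?G = "[generated P W {0..}, generated P (\<lambda>s \<omega>. N s \<omega>) {0..}, generated P eta {1..}]"
  let ?L = "[sets (generated P W {0..}), sets (generated P N {0..}), sets (generated P eta {1..})]"
  have ind: "indep_sets ((!) ?L) {..<3}" using driving by (simp add: driving_noise_def)
  have Xm: "X 0 \<in> measurable (generated P W {0..}) (PiM {..<n} (\<lambda>_. borel))"
    "X 1 \<in> measurable (generated P N {0..}) (PiM {..<Suc n} (\<lambda>_. borel))"
    "X 2 \<in> measurable (generated P eta {1..}) (PiM {1..} (\<lambda>_. borel))"
  proof -
    have "W s \<in> borel_measurable (generated P W {0..})" if "0 \<le> s" for s
      using that by (intro generated_measurable) auto
    then show "X 0 \<in> measurable (generated P W {0..}) (PiM {..<n} (\<lambda>_. borel))"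
      unfolding X_def using \<tau>0 by (auto intro!: measurable_restrict)
    have "(\<lambda>\<omega>. real (N s \<omega>)) \<in> borel_measurable (generated P N {0..})" if "0 \<le> s" for s
    proof -
      have "N s \<in> borel_measurable (generated P N {0..})" using that by (intro generated_measurable) auto
      then have "N s \<in> measurable (generated P N {0..}) (count_space UNIV)"
        by (simp add: measurable_cong_sets[OF refl sets_borel_eq_count_space])
      then show ?thesis by measurable
    qed
    then show "X 1 \<in> measurable (generated P N {0..}) (PiM {..<Suc n} (\<lambda>_. borel))"
      unfolding X_def using \<tau>'0 by (auto intro!: measurable_restrict)
    have "eta k \<in> borel_measurable (generated P eta {1..})" if "1 \<le> k" for k
      using that by (intro generated_measurable) auto
    then show "X 2 \<in> measurable (generated P eta {1..}) (PiM {1..} (\<lambda>_. borel))"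
      unfolding X_def by (auto intro!: measurable_restrict)
  qed
  have Xm': "X i \<in> measurable (?G ! i) (PiM (I i) (\<lambda>_. borel))" if "i < 3" for i
  proof -
    have "i = 0 \<or> i = 1 \<or> i = 2" using that by auto
    then show ?thesis using Xm by (auto simp: I_def)
  qed
  have Gs: "?L ! i = sets (?G ! i)" "space (?G ! i) = space P" if "i < 3" for i
  proof -
    have "i = 0 \<or> i = 1 \<or> i = 2" using that by auto
    then show "?L ! i = sets (?G ! i)" "space (?G ! i) = space P" by auto
  qed
  have rv: "random_variable (PiM (I i) (\<lambda>_. borel)) (X i)" if "i < 3" for i
  proof (rule measurable_from_subalg[OF _ Xm'[OF that]])
    show "subalgebra P (?G ! i)"
      using ind Gs[OF that] that by (auto simp: subalgebra_def indep_sets_def)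
  qed
  have iv: "indep_vars (\<lambda>i. PiM (I i) (\<lambda>_. borel)) X {..<3}"
    unfolding indep_vars_def2
  proof (intro conjI ballI indep_sets_mono_sets[OF ind])
    fix i :: nat assume "i \<in> {..<3}"
    then have i: "i < 3" by simp
    show "random_variable (PiM (I i) (\<lambda>_. borel)) (X i)" by (rule rv[OF i])
    show "{X i -` A \<inter> space P |A. A \<in> sets (PiM (I i) (\<lambda>_. borel))} \<subseteq> ?L ! i"
      using measurable_sets[OF Xm'[OF i]] unfolding Gs[OF i] by auto
  qed
  have Wv: "indep_vars (\<lambda>_. borel) (\<lambda>k \<omega>. W (\<tau> (Suc k)) \<omega> - W (\<tau> k) \<omega>) {..<n}"
    using driving \<tau> by (simp add: driving_noise_def brownian_motion_def independent_increments_def)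
  have Nv: "indep_vars (\<lambda>_. borel) (\<lambda>k \<omega>. real (N (\<tau>' (Suc k)) \<omega>) - real (N (\<tau>' k) \<omega>)) {..<Suc n}"
    using driving \<tau>' by (simp add: driving_noise_def poisson_process_def independent_increments_def)
  have Ev: "indep_vars (\<lambda>_. borel) eta {1..}" using driving by (simp add: driving_noise_def)
  have D0: "distr P (PiM {..<n} (\<lambda>_. borel)) (X 0) = ?R ! 0"
  proof -
    have "distr P (PiM {..<n} (\<lambda>_. borel)) (X 0) = PiM {..<n} (\<lambda>k. distr P borel (\<lambda>\<omega>. W (\<tau> (Suc k)) \<omega> - W (\<tau> k) \<omega>))"
      using indep_vars_iff_distr_eq_PiM'[THEN iffD1, OF _ _ Wv] n Wv unfolding X_def
      by (simp add: indep_vars_def lessThan_empty_iff)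
    also have "\<dots> = ?R ! 0" using \<tau>0 \<tau>(1) by (auto intro!: PiM_cong simp: W_increment_distr mono_iff_le_Suc)
    finally show ?thesis .
  qed
  have D1: "distr P (PiM {..<Suc n} (\<lambda>_. borel)) (X 1) = ?R ! 1"
  proof -
    have "distr P (PiM {..<Suc n} (\<lambda>_. borel)) (X 1) = PiM {..<Suc n} (\<lambda>k. distr P borel (\<lambda>\<omega>. real (N (\<tau>' (Suc k)) \<omega>) - real (N (\<tau>' k) \<omega>)))"
      using indep_vars_iff_distr_eq_PiM'[THEN iffD1, OF _ _ Nv] Nv unfolding X_def
      by (simp add: indep_vars_def lessThan_empty_iff)
    also have "\<dots> = ?R ! 1"
      unfolding nth_Cons_Suc nth_Cons_0 One_nat_def
    proof (rule PiM_cong[OF refl])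
      fix k show "distr P borel (\<lambda>\<omega>. real (N (\<tau>' (Suc k)) \<omega>) - real (N (\<tau>' k) \<omega>)) = (if \<tau>' k = \<tau>' (Suc k) then return borel 0
           else distr (measure_pmf (poisson_pmf (intensity m * (\<tau>' (Suc k) - \<tau>' k)))) borel real)"
        using \<tau>'(1) by (intro N_increment_distr \<tau>'0) (simp add: mono_iff_le_Suc)
    qed
    finally show ?thesis .
  qed
  have D2: "distr P (PiM {1..} (\<lambda>_. borel)) (X 2) = ?R ! 2"
  proof -
    have "distr P (PiM {1..} (\<lambda>_. borel)) (X 2) = PiM {1..} (\<lambda>k. distr P borel (eta k))"
      using indep_vars_iff_distr_eq_PiM'[THEN iffD1, OF _ _ Ev] Ev unfolding X_def
      by (simp add: indep_vars_def)
    also have "\<dots> = ?R ! 2" using driving by (auto intro!: PiM_cong simp: driving_noise_def)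
    finally show ?thesis .
  qed
  have "distr P (PiM {..<3} (\<lambda>i. PiM (I i) (\<lambda>_. borel))) (\<lambda>\<omega>. \<lambda>i\<in>{..<3}. X i \<omega>) = PiM {..<3} (\<lambda>i. distr P (PiM (I i) (\<lambda>_. borel)) (X i))"
    using indep_vars_iff_distr_eq_PiM'[THEN iffD1, OF _ _ iv] rv by (simp add: lessThan_empty_iff)
  also have "\<dots> = PiM {..<3} ((!) ?R)"
  proof (rule PiM_cong[OF refl])
    fix i :: nat assume "i \<in> {..<3}"
    then have "i = 0 \<or> i = 1 \<or> i = 2" by auto
    then show "distr P (PiM (I i) (\<lambda>_. borel)) (X i) = ?R ! i" using D0 D1 D2 by (auto simp: I_def)
  qed
  finally show ?thesis unfolding source_law_def Let_def \<tau>'_def .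
qed

definition increments :: "(nat \<Rightarrow> real) \<Rightarrow> nat \<Rightarrow> 'w \<Rightarrow> nat \<Rightarrow> state" where
  "increments \<tau> n \<omega> = (\<lambda>k\<in>{..<n}. Z (\<tau> k) (\<tau> (Suc k)) \<omega>)"

lemma increments_measurable:
  assumes "mono \<tau>" "0 \<le> \<tau> 0"
  shows "increments \<tau> n \<in> measurable P (PiM {..<n} (\<lambda>_. borel))"
  unfolding increments_def
proof (intro measurable_restrict Z_measurable)
  fix k show "0 \<le> \<tau> k" using assms(2) monoD[OF assms(1), of 0 k] by simp
  show "\<tau> k \<le> \<tau> (Suc k)" using assms(1) by (simp add: mono_iff_le_Suc)
qed

text \<open>
  The noise increments are a measurable function of the sources, and their law is therefore determined
  by the model alone.
\<close>

lemma increments_distr: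
  fixes \<tau> :: "nat \<Rightarrow> real" and n :: nat
  assumes \<tau>: "mono \<tau>" "0 \<le> \<tau> 0" and n: "0 < n"
  shows "distr P (PiM {..<n} (\<lambda>_. borel)) (increments \<tau> n) = increment_law m \<tau> n"
proof -
  define I where "I = (!) [{..<n}, {..<Suc n}, {1..}]"
  define \<tau>' where "\<tau>' = (\<lambda>k. if k = 0 then 0 else \<tau> (k - 1))"
  have \<tau>0: "0 \<le> \<tau> k" for k using \<tau> monoD[OF \<tau>(1), of 0 k] by simp
  define M where "M = PiM {..<3} (\<lambda>i. PiM (I i) (\<lambda>_. borel :: real measure))"
  define c where "c = (\<lambda>k (x :: nat \<Rightarrow> nat \<Rightarrow> real). nat \<lfloor>\<Sum>j\<le>k. x 1 j\<rfloor>)"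
  define \<Psi> where "\<Psi> = (\<lambda>(x :: nat \<Rightarrow> nat \<Rightarrow> real). \<lambda>k\<in>{..<n}.
     (volatility m * x 0 k, 0 :: real, 0 :: real, \<Sum>i\<in>{c k x<..c (Suc k) x}. x 2 i))"
  have comp: "(\<lambda>x. x i k) \<in> borel_measurable M" if "i < 3" "k \<in> I i" for i k
  proof -
    have "(\<lambda>x. x i) \<in> measurable M (PiM (I i) (\<lambda>_. borel))"
      unfolding M_def using that by (intro measurable_component_singleton) auto
    moreover have "(\<lambda>f. f k) \<in> borel_measurable (PiM (I i) (\<lambda>_. borel :: real measure))"
      using that by (intro measurable_component_singleton) auto
    ultimately show ?thesis by (rule measurable_compose)
  qed
  have c: "c k \<in> measurable M (count_space UNIV)" if "k \<le> n" for k
  proof -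
    have [measurable]: "(\<lambda>x. \<Sum>j\<le>k. x 1 j) \<in> borel_measurable M"
      using that by (intro borel_measurable_sum comp) (auto simp: I_def)
    show ?thesis unfolding c_def by measurable
  qed
  have \<Psi>: "\<Psi> \<in> measurable M (PiM {..<n} (\<lambda>_. borel))"
    unfolding \<Psi>_def
  proof (intro measurable_restrict borel_measurable_Pair borel_measurable_times borel_measurable_const)
    fix k assume k: "k \<in> {..<n}"
    then show "(\<lambda>x. x 0 k) \<in> borel_measurable M" by (intro comp) (auto simp: I_def)
    show "(\<lambda>x. \<Sum>i\<in>{c k x<..c (Suc k) x}. x 2 i) \<in> borel_measurable M"
      using k by (intro random_sum_measurable c comp) (auto simp: I_def)
  qed
  define X where "X = (\<lambda>i \<omega>. [\<lambda>k\<in>{..<n}. W (\<tau> (Suc k)) \<omega> - W (\<tau> k) \<omega>,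
       \<lambda>k\<in>{..<Suc n}. real (N (\<tau>' (Suc k)) \<omega>) - real (N (\<tau>' k) \<omega>), \<lambda>k\<in>{1..}. eta k \<omega>] ! i)"
  have law: "distr P M (\<lambda>\<omega>. \<lambda>i\<in>{..<3}. X i \<omega>) = source_law m \<tau> n"
    unfolding M_def X_def I_def \<tau>'_def by (rule sources_distr[OF \<tau> n])
  have Xm: "(\<lambda>\<omega>. \<lambda>i\<in>{..<3}. X i \<omega>) \<in> measurable P M"
    unfolding M_def
  proof (rule measurable_restrict)
    fix i :: nat assume "i \<in> {..<3}"
    then have i: "i = 0 \<or> i = 1 \<or> i = 2" by auto
    have [measurable]: "W (\<tau> k) \<in> borel_measurable P" "N (\<tau>' k) \<in> measurable P (count_space UNIV)" for k
      using \<tau>0 by (auto intro!: W_measurable N_measurable simp: \<tau>'_def)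
    note [measurable] = eta_measurable
    have "X 0 \<in> measurable P (PiM {..<n} (\<lambda>_. borel))"
      "X 1 \<in> measurable P (PiM {..<Suc n} (\<lambda>_. borel))" "X 2 \<in> measurable P (PiM {1..} (\<lambda>_. borel))"
      by (auto simp: X_def intro!: measurable_restrict)
    then show "X i \<in> measurable P (PiM (I i) (\<lambda>_. borel))" using i by (auto simp: I_def)
  qed
  have eq: "(\<lambda>k\<in>{..<n}. Z (\<tau> k) (\<tau> (Suc k)) \<omega>) = \<Psi> (\<lambda>i\<in>{..<3}. X i \<omega>)" if \<omega>: "\<omega> \<in> space P" for \<omega>
  proof -
    have cN: "c k (\<lambda>i\<in>{..<3}. X i \<omega>) = N (\<tau> k) \<omega>" if "k \<le> n" for k
    proof -
      have "(\<Sum>j\<le>k. (\<lambda>i\<in>{..<3}. X i \<omega>) 1 j) = (\<Sum>j\<le>k. real (N (\<tau>' (Suc j)) \<omega>) - real (N (\<tau>' j) \<omega>))"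
        using that by (intro sum.cong) (auto simp: X_def)
      also have "\<dots> = real (N (\<tau>' (Suc k)) \<omega>) - real (N (\<tau>' 0) \<omega>)"
        unfolding lessThan_Suc_atMost[symmetric] by (rule sum_lessThan_telescope)
      also have "\<dots> = real (N (\<tau> k) \<omega>)" using counting_path_N[OF \<omega>] by (simp add: \<tau>'_def counting_path_def)
      finally show ?thesis by (simp add: c_def)
    qed
    show ?thesis
      unfolding \<Psi>_def
    proof (rule restrict_ext)
      fix k assume "k \<in> {..<n}"
      then have k: "k < n" by simp
      have "J (\<tau> k) (\<tau> (Suc k)) \<omega> = (\<Sum>i\<in>{N (\<tau> k) \<omega><..N (\<tau> (Suc k)) \<omega>}. eta i \<omega>)"
        using \<tau>(1) by (intro J_eq \<omega> \<tau>0) (simp add: mono_iff_le_Suc)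
      also have "\<dots> = (\<Sum>i\<in>{N (\<tau> k) \<omega><..N (\<tau> (Suc k)) \<omega>}. (\<lambda>i\<in>{..<3}. X i \<omega>) 2 i)"
        by (rule sum.cong) (auto simp: X_def)
      finally show "Z (\<tau> k) (\<tau> (Suc k)) \<omega> = (volatility m * (\<lambda>i\<in>{..<3}. X i \<omega>) 0 k, 0, 0,
          \<Sum>i\<in>{c k (\<lambda>i\<in>{..<3}. X i \<omega>)<..c (Suc k) (\<lambda>i\<in>{..<3}. X i \<omega>)}. (\<lambda>i\<in>{..<3}. X i \<omega>) 2 i)"
        using k by (simp add: shock_def cN) (simp add: X_def)
    qed
  qed
  have "distr P (PiM {..<n} (\<lambda>_. borel)) (increments \<tau> n)
      = distr P (PiM {..<n} (\<lambda>_. borel)) (\<lambda>\<omega>. \<Psi> (\<lambda>i\<in>{..<3}. X i \<omega>))"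
    by (rule distr_cong) (simp_all add: increments_def eq)
  also have "\<dots> = distr (distr P M (\<lambda>\<omega>. \<lambda>i\<in>{..<3}. X i \<omega>)) (PiM {..<n} (\<lambda>_. borel)) \<Psi>"
    by (subst distr_distr[OF \<Psi> Xm]) (simp add: o_def)
  also have "\<dots> = increment_law m \<tau> n"
    unfolding law increment_law_def Let_def \<Psi>_def c_def ..
  finally show ?thesis .
qed

end

section \<open>Regularity of the exploratory drift\<close>

locale exploratory_model =
  fixes m :: model and \<pi> :: policy
  assumes valid: "valid_model m" and standing: "standing_assumptions m" and admissible: "admissible m \<pi>"
begin

abbreviation "T \<equiv> horizon m"
abbreviation "A \<equiv> actions m"
abbreviation "\<beta> \<equiv> exploratory_drift m \<pi>"

lemma T_pos: "0 < T" using valid by (simp add: valid_model_def)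

lemma density:
  assumes t: "t \<in> {0..T}"
  shows "\<And>v. v \<in> A \<Longrightarrow> 0 \<le> \<pi> v t y" "set_integrable lborel A (\<lambda>v. \<pi> v t y)" "(LINT v:A|lborel. \<pi> v t y) = 1"
proof -
  have "\<forall>t\<in>{0..T}. \<forall>y. (\<forall>v\<in>A. 0 \<le> \<pi> v t y) \<and> set_integrable lborel A (\<lambda>v. \<pi> v t y) \<and> (LINT v:A|lborel. \<pi> v t y) = 1"
    using admissible unfolding admissible_def by (elim conjE)
  from this[rule_format, OF t, of y]
  show "\<And>v. v \<in> A \<Longrightarrow> 0 \<le> \<pi> v t y" "set_integrable lborel A (\<lambda>v. \<pi> v t y)" "(LINT v:A|lborel. \<pi> v t y) = 1"
    by blast+
qed

text \<open>
  The distance between action densities in which admissibility requires continuity and a Lipschitz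
  bound.
\<close>

definition density_dist :: "real \<Rightarrow> state \<Rightarrow> real \<Rightarrow> state \<Rightarrow> real" where
  "density_dist t y t' y' = (LINT v:A|lborel. \<bar>\<pi> v t y - \<pi> v t' y'\<bar>)"

lemma drift_time: "drift m t y v = drift m t' y v"
  by (cases y) simp

lemma drift_measurable: "drift m t y \<in> borel_measurable borel"
proof (cases y)
  case (fields S x q \<mu>)
  have "continuous_on UNIV (\<lambda>v. drift m t y v)"
    unfolding fields drift.simps by (intro continuous_intros)
  then show ?thesis by (rule borel_measurable_continuous_onI)
qed

lemma drift_growth_ex: "\<exists>C>0. \<forall>t\<in>{0..T}. \<forall>v\<in>A. \<forall>y. norm (drift m t y v) \<le> C * (1 + norm y)"
  using standing unfolding standing_assumptions_def by (elim conjE)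

lemma drift_lipschitz_ex:
  "\<exists>C>0. \<forall>t\<in>{0..T}. \<forall>v\<in>A. \<forall>y y'. norm (drift m t y v - drift m t y' v) \<le> C * norm (y - y')"
  using standing unfolding standing_assumptions_def by (elim conjE)

lemma density_dist_lipschitz:
  "\<exists>C>0. \<forall>t\<in>{0..T}. \<forall>y y'. density_dist t y t y' \<le> C * norm (y - y')"
  using admissible unfolding admissible_def density_dist_def by (elim conjE)

lemma density_dist_tendsto:
  assumes "t' \<in> {0..T}"
  shows "((\<lambda>(t, y). density_dist t y t' y') \<longlongrightarrow> 0) (at (t', y') within {0..T} \<times> UNIV)"
proof -
  have "\<forall>t'\<in>{0..T}. \<forall>y'. ((\<lambda>(t, y). density_dist t y t' y') \<longlongrightarrow> 0) (at (t', y') within {0..T} \<times> UNIV)"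
    using admissible unfolding admissible_def density_dist_def by (elim conjE)
  then show ?thesis using assms by blast
qed

lemma weighted_drift_integrable:
  assumes g: "set_integrable lborel A g" and t: "t \<in> {0..T}"
  shows "set_integrable lborel A (\<lambda>v. g v *\<^sub>R drift m t y v)"
proof -
  obtain C where C: "C > 0" "\<And>v. v \<in> A \<Longrightarrow> norm (drift m t y v) \<le> C * (1 + norm y)"
    using drift_growth_ex t by blast
  have "integrable lborel (\<lambda>v. (indicator A v *\<^sub>R g v) *\<^sub>R (C * (1 + norm y)))"
    using g by (intro integrable_scaleR_left) (simp add: set_integrable_def)
  then have "integrable lborel (\<lambda>v. (indicator A v *\<^sub>R g v) *\<^sub>R drift m t y v)"
  proof (rule Bochner_Integration.integrable_bound)
    show "(\<lambda>v. (indicator A v *\<^sub>R g v) *\<^sub>R drift m t y v) \<in> borel_measurable lborel"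
      by (rule borel_measurable_scaleR[OF borel_measurable_integrable[OF g[unfolded set_integrable_def]]])
        (use drift_measurable in simp)
    show "AE v in lborel. norm ((indicator A v *\<^sub>R g v) *\<^sub>R drift m t y v) \<le> norm ((indicator A v *\<^sub>R g v) *\<^sub>R (C * (1 + norm y)))"
      using C by (auto intro!: AE_I2 mult_left_mono simp: indicator_def abs_mult)
  qed
  then show ?thesis by (simp add: set_integrable_def)
qed

lemma weighted_drift_bound:
  assumes g: "set_integrable lborel A g"
    and C: "\<And>v. v \<in> A \<Longrightarrow> norm (f v) \<le> C" and f: "set_integrable lborel A (\<lambda>v. g v *\<^sub>R f v)"
  shows "norm (LINT v:A|lborel. g v *\<^sub>R (f v :: state)) \<le> C * (LINT v:A|lborel. \<bar>g v\<bar>)"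
proof -
  have "norm (LINT v:A|lborel. g v *\<^sub>R f v) \<le> (LINT v:A|lborel. norm (g v *\<^sub>R f v))"
    by (rule set_integral_norm_bound[OF f])
  also have "\<dots> \<le> (LINT v:A|lborel. C * \<bar>g v\<bar>)"
  proof (rule set_integral_mono)
    show "set_integrable lborel A (\<lambda>v. norm (g v *\<^sub>R f v))" by (rule set_integrable_norm[OF f])
    show "set_integrable lborel A (\<lambda>v. C * \<bar>g v\<bar>)" using set_integrable_abs[OF g] by simp
    show "norm (g v *\<^sub>R f v) \<le> C * \<bar>g v\<bar>" if "v \<in> A" for v
      using mult_left_mono[OF C[OF that], of "\<bar>g v\<bar>"] by (simp add: mult.commute)
  qed
  finally show ?thesis by simp
qed

text \<open>
  The average over one density of the difference of drifts, plus the drift integrated against the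
  difference of the densities. The first uses that the drift is Lipschitz in the state, the second its
  linear growth.
\<close>

lemma drift_difference:
  "\<exists>C>0. \<forall>t\<in>{0..T}. \<forall>t'\<in>{0..T}. \<forall>y y'.
     norm (\<beta> t y - \<beta> t' y') \<le> C * norm (y - y') + C * (1 + norm y') * density_dist t y t' y'"
proof -
  obtain C1 where C1: "C1 > 0" "\<And>t v y. t \<in> {0..T} \<Longrightarrow> v \<in> A \<Longrightarrow> norm (drift m t y v) \<le> C1 * (1 + norm y)"
    using drift_growth_ex by blast
  obtain C2 where C2: "C2 > 0" "\<And>t v y y'. t \<in> {0..T} \<Longrightarrow> v \<in> A \<Longrightarrow>
      norm (drift m t y v - drift m t y' v) \<le> C2 * norm (y - y')"
    using drift_lipschitz_ex by blast
  have "norm (\<beta> t y - \<beta> t' y') \<le> (C1 + C2) * norm (y - y') + (C1 + C2) * (1 + norm y') * density_dist t y t' y'"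
    if t: "t \<in> {0..T}" "t' \<in> {0..T}" for t t' y y'
  proof -
    let ?p = "\<lambda>v. \<pi> v t y" and ?p' = "\<lambda>v. \<pi> v t' y'"
    note p = density(2)[OF t(1), of y] and p' = density(2)[OF t(2), of y']
    have pd: "set_integrable lborel A (\<lambda>v. ?p v - ?p' v)" by (rule set_integral_diff(1)[OF p p'])
    have i1: "set_integrable lborel A (\<lambda>v. ?p v *\<^sub>R drift m t z v)" for z by (rule weighted_drift_integrable[OF p t(1)])
    have i1': "set_integrable lborel A (\<lambda>v. ?p' v *\<^sub>R drift m t z v)" for z by (rule weighted_drift_integrable[OF p' t(1)])
    have i2: "set_integrable lborel A (\<lambda>v. ?p v *\<^sub>R (drift m t y v - drift m t y' v))"
      using set_integral_diff(1)[OF i1[of y] i1[of y']] by (simp add: scaleR_diff_right)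
    have i3: "set_integrable lborel A (\<lambda>v. (?p v - ?p' v) *\<^sub>R drift m t y' v)"
      using set_integral_diff(1)[OF i1[of y'] i1'[of y']] by (simp add: scaleR_diff_left)
    have "\<beta> t' y' = (LINT v:A|lborel. ?p' v *\<^sub>R drift m t y' v)"
      unfolding exploratory_drift_def by (simp only: drift_time[of t' _ _ t])
    then have "\<beta> t y - \<beta> t' y' = (LINT v:A|lborel. ?p v *\<^sub>R drift m t y v - ?p' v *\<^sub>R drift m t y' v)"
      using set_integral_diff(2)[OF i1[of y] i1'[of y']] by (simp add: exploratory_drift_def)
    also have "\<dots> = (LINT v:A|lborel. ?p v *\<^sub>R (drift m t y v - drift m t y' v) + (?p v - ?p' v) *\<^sub>R drift m t y' v)"
      by (simp add: algebra_simps)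
    also have "\<dots> = (LINT v:A|lborel. ?p v *\<^sub>R (drift m t y v - drift m t y' v)) + (LINT v:A|lborel. (?p v - ?p' v) *\<^sub>R drift m t y' v)"
      by (rule set_integral_add(2)[OF i2 i3])
    finally have eq: "\<beta> t y - \<beta> t' y' = \<dots>" .
    have "norm (LINT v:A|lborel. ?p v *\<^sub>R (drift m t y v - drift m t y' v)) \<le> (C2 * norm (y - y')) * (LINT v:A|lborel. \<bar>?p v\<bar>)"
      by (intro weighted_drift_bound[OF p _ i2] C2 t)
    also have "(LINT v:A|lborel. \<bar>?p v\<bar>) = (LINT v:A|lborel. ?p v)"
      using density(1)[OF t(1)] unfolding set_lebesgue_integral_def
      by (intro Bochner_Integration.integral_cong) (auto simp: indicator_def)
    also have "\<dots> = 1" by (rule density(3)[OF t(1)])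
    finally have n1: "norm (LINT v:A|lborel. ?p v *\<^sub>R (drift m t y v - drift m t y' v)) \<le> C2 * norm (y - y')" by simp
    have n2: "norm (LINT v:A|lborel. (?p v - ?p' v) *\<^sub>R drift m t y' v) \<le> (C1 * (1 + norm y')) * density_dist t y t' y'"
      unfolding density_dist_def by (intro weighted_drift_bound[OF pd _ i3] C1 t)
    have d0: "0 \<le> density_dist t y t' y'"
      unfolding density_dist_def set_lebesgue_integral_def by (rule integral_nonneg_AE) simp
    have "norm (\<beta> t y - \<beta> t' y') \<le> C2 * norm (y - y') + (C1 * (1 + norm y')) * density_dist t y t' y'"
      unfolding eq by (rule order_trans[OF norm_triangle_ineq add_mono[OF n1 n2]])
    also have "\<dots> \<le> (C1 + C2) * norm (y - y') + ((C1 + C2) * (1 + norm y')) * density_dist t y t' y'"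
      using C1(1) C2(1) d0 by (intro add_mono mult_right_mono) auto
    finally show ?thesis .
  qed
  then show ?thesis using C1(1) C2(1) by (intro exI[of _ "C1 + C2"]) auto
qed

lemma exploratory_drift_growth: "\<exists>C>0. \<forall>t\<in>{0..T}. \<forall>y. norm (\<beta> t y) \<le> C * (1 + norm y)"
proof -
  obtain C where C: "C > 0" "\<And>t v y. t \<in> {0..T} \<Longrightarrow> v \<in> A \<Longrightarrow> norm (drift m t y v) \<le> C * (1 + norm y)"
    using drift_growth_ex by blast
  have "norm (\<beta> t y) \<le> C * (1 + norm y)" if t: "t \<in> {0..T}" for t y
  proof -
    note p = density(2)[OF t, of y]
    have "norm (\<beta> t y) \<le> C * (1 + norm y) * (LINT v:A|lborel. \<bar>\<pi> v t y\<bar>)"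
      unfolding exploratory_drift_def by (intro weighted_drift_bound[OF p] weighted_drift_integrable[OF p t] C t)
    also have "(LINT v:A|lborel. \<bar>\<pi> v t y\<bar>) = (LINT v:A|lborel. \<pi> v t y)"
      using density(1)[OF t] unfolding set_lebesgue_integral_def
      by (intro Bochner_Integration.integral_cong) (auto simp: indicator_def)
    finally show ?thesis by (simp add: density(3)[OF t])
  qed
  then show ?thesis using C(1) by blast
qed

text \<open>
  The drift has linear growth, so multiplied with the Lipschitz bound for the densities it yields only
  a local Lipschitz condition. The growing factor may be attached to one state only, and \<open>euler_tendsto\<close> takes
  this state on the true path.
\<close>

lemma exploratory_drift_lipschitz:
  "\<exists>L>0. \<forall>t\<in>{0..T}. \<forall>y y'. norm (\<beta> t y - \<beta> t y') \<le> L * (1 + norm y') * norm (y - y')"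
proof -
  obtain C where C: "C > 0" "\<And>t y y'. t \<in> {0..T} \<Longrightarrow>
     norm (\<beta> t y - \<beta> t y') \<le> C * norm (y - y') + C * (1 + norm y') * density_dist t y t y'"
    using drift_difference by blast
  obtain D where D: "D > 0" "\<And>t y y'. t \<in> {0..T} \<Longrightarrow> density_dist t y t y' \<le> D * norm (y - y')"
    using density_dist_lipschitz by blast
  have "norm (\<beta> t y - \<beta> t y') \<le> (C + C * D) * (1 + norm y') * norm (y - y')" if t: "t \<in> {0..T}" for t y y'
  proof -
    have "norm (\<beta> t y - \<beta> t y') \<le> C * norm (y - y') + C * (1 + norm y') * density_dist t y t y'" by (rule C(2)[OF t])
    also have "\<dots> \<le> C * (1 + norm y') * norm (y - y') + C * (1 + norm y') * (D * norm (y - y'))"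
      using C(1) D(2)[OF t, of y y'] by (intro add_mono mult_left_mono mult_right_mono) auto
    finally show ?thesis by (simp add: algebra_simps)
  qed
  moreover have "0 < C + C * D" using C(1) D(1) by (simp add: add_pos_pos)
  ultimately show ?thesis by blast
qed

lemma exploratory_drift_continuous: "continuous_on ({0..T} \<times> UNIV) (\<lambda>p. \<beta> (fst p) (snd p))"
  unfolding continuous_on_def
proof
  fix p' :: "real \<times> state" assume p': "p' \<in> {0..T} \<times> UNIV"
  obtain t' y' where ty: "p' = (t', y')" by (rule prod.exhaust)
  then have t': "t' \<in> {0..T}" using p' by auto
  obtain C where C: "C > 0" "\<And>t t' y y'. t \<in> {0..T} \<Longrightarrow> t' \<in> {0..T} \<Longrightarrow>
     norm (\<beta> t y - \<beta> t' y') \<le> C * norm (y - y') + C * (1 + norm y') * density_dist t y t' y'"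
    using drift_difference by blast
  let ?F = "at p' within {0..T} \<times> UNIV"
  have "((\<lambda>(t, y). density_dist t y t' y') \<longlongrightarrow> 0) ?F"
    unfolding ty by (rule density_dist_tendsto[OF t'])
  then have d: "((\<lambda>p. density_dist (fst p) (snd p) t' y') \<longlongrightarrow> 0) ?F" by (simp add: split_def)
  have "((\<lambda>p. C * norm (snd p - y') + C * (1 + norm y') * density_dist (fst p) (snd p) t' y')
       \<longlongrightarrow> C * norm (snd p' - y') + C * (1 + norm y') * 0) ?F"
    by (intro tendsto_intros d)
  then have lim: "((\<lambda>p. C * norm (snd p - y') + C * (1 + norm y') * density_dist (fst p) (snd p) t' y') \<longlongrightarrow> 0) ?F"
    by (simp add: ty)
  have "((\<lambda>p. \<beta> (fst p) (snd p) - \<beta> t' y') \<longlongrightarrow> 0) ?F"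
  proof (rule Lim_null_comparison[OF _ lim])
    show "\<forall>\<^sub>F p in ?F. norm (\<beta> (fst p) (snd p) - \<beta> t' y') \<le> C * norm (snd p - y') + C * (1 + norm y') * density_dist (fst p) (snd p) t' y'"
      unfolding eventually_at_filter by (rule always_eventually) (use C(2)[OF _ t'] in auto)
  qed
  then show "((\<lambda>p. \<beta> (fst p) (snd p)) \<longlongrightarrow> \<beta> (fst p') (snd p')) ?F" by (simp add: LIM_zero_iff ty)
qed

lemma exploratory_drift_measurable:
  assumes "t \<in> {0..T}" shows "\<beta> t \<in> borel_measurable borel"
proof -
  have "continuous_on UNIV (\<lambda>y. \<beta> (fst (t, y)) (snd (t, y)))"
    by (rule continuous_on_compose2[OF exploratory_drift_continuous])
      (use assms in \<open>auto intro!: continuous_intros\<close>)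
  then show ?thesis by (intro borel_measurable_continuous_onI) simp
qed

end

section \<open>Weak solutions as limits of Euler schemes\<close>

context exploratory_model
begin

definition euler_end :: "real \<Rightarrow> real \<Rightarrow> nat \<Rightarrow> state \<Rightarrow> (nat \<Rightarrow> state) \<Rightarrow> state" where
  "euler_end s u n y D = euler \<beta> s (mesh s u n) y D (Suc n)"

lemma euler_end_cong: "(\<And>k. k \<le> n \<Longrightarrow> D k = D' k) \<Longrightarrow> euler_end s u n y D = euler_end s u n y D'"
  unfolding euler_end_def by (rule euler_cong) auto

lemma euler_end_restrict: "euler_end s u n y (\<lambda>k\<in>{..<Suc n}. D k) = euler_end s u n y D"
  by (rule euler_end_cong) simp

lemma euler_end_measurable:
  assumes "0 \<le> s" "s \<le> u" "u \<le> T"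
  shows "(\<lambda>p. euler_end s u n (fst p) (snd p)) \<in> borel_measurable (borel \<Otimes>\<^sub>M PiM {..<Suc n} (\<lambda>_. borel))"
proof -
  have *: "(\<lambda>p. euler \<beta> s (mesh s u n) (fst p) (snd p) k) \<in> borel_measurable (borel \<Otimes>\<^sub>M PiM {..<Suc n} (\<lambda>_. borel))"
    if "k \<le> Suc n" for k
    using that
  proof (induction k)
    case (Suc k)
    then have IH [measurable]: "(\<lambda>p. euler \<beta> s (mesh s u n) (fst p) (snd p) k) \<in> borel_measurable (borel \<Otimes>\<^sub>M PiM {..<Suc n} (\<lambda>_. borel))"
      by simp
    have "s + real k * mesh s u n \<in> {0..T}" using grid_in[of s u k n] Suc assms by (auto simp: grid_def)
    then have "\<beta> (s + real k * mesh s u n) \<in> borel_measurable borel" by (rule exploratory_drift_measurable)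
    then have "(\<lambda>p. \<beta> (s + real k * mesh s u n) (euler \<beta> s (mesh s u n) (fst p) (snd p) k)) \<in> borel_measurable (borel \<Otimes>\<^sub>M PiM {..<Suc n} (\<lambda>_. borel))"
      by (rule measurable_compose[OF IH])
    moreover have "(\<lambda>p. snd p k) \<in> borel_measurable (borel \<Otimes>\<^sub>M PiM {..<Suc n} (\<lambda>_. borel))"
      using Suc by (intro measurable_compose[OF measurable_snd measurable_component_singleton]) auto
    ultimately show ?case
      unfolding euler.simps using IH by (intro borel_measurable_add borel_measurable_scaleR borel_measurable_const)
  qed simp
  show ?thesis unfolding euler_end_def by (rule *[OF order_refl])
qed

text \<open>
  The constant depends on the model and on \<open>q\<close> only. It is the same for all probability spaces,
  times, step numbers and initial states, which allows passage to the limit in the number of steps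
  and later averaging over random initial states.
\<close>

lemma euler_moment_bound:
  assumes q: "0 < q"
  shows "\<exists>K\<ge>0. \<forall>(P :: 'w measure) F W N eta s u n y. noise m P F W N eta \<longrightarrow> 0 \<le> s \<longrightarrow> s \<le> u \<longrightarrow> u \<le> T \<longrightarrow>
    (\<integral>\<^sup>+\<omega>. ennreal (norm (euler_end s u n y (\<lambda>k. shock m W N eta (grid s u n k) (grid s u n (Suc k)) \<omega>)) ^ (2 * q)) \<partial>P)
      \<le> ennreal (K * (1 + norm y ^ (2 * q)))"
proof -
  obtain C where C: "C > 0" "\<And>t y. t \<in> {0..T} \<Longrightarrow> norm (\<beta> t y) \<le> C * (1 + norm y)"
    using exploratory_drift_growth by blast
  obtain c where c: "0 \<le> c" and cb: "\<And>y A B. 0 \<le> y \<Longrightarrow> 0 \<le> A \<Longrightarrow> 0 \<le> B \<Longrightarrow>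
    ((y + C * T + C * T * A) * exp (C * T) + B) ^ (2 * q) \<le> c * ((1 + y ^ (2 * q)) + (A ^ (2 * q) + B ^ (2 * q)))"
    using power_affine_bound[of "C * T" "C * T" "exp (C * T)" "2 * q"] C(1) T_pos by auto
  define M where "M = enn2real (shock_moment m q)"
  have M: "shock_moment m q = ennreal M" using shock_moment_finite[OF valid, of q] by (simp add: M_def)
  have M0: "0 \<le> M" by (simp add: M_def)
  have "(\<integral>\<^sup>+\<omega>. ennreal (norm (euler_end s u n y (\<lambda>k. shock m W N eta (grid s u n k) (grid s u n (Suc k)) \<omega>)) ^ (2 * q)) \<partial>P)
      \<le> ennreal (c * (1 + 2 * M) * (1 + norm y ^ (2 * q)))"
    if ns: "noise m P F W N eta" and s: "0 \<le> s" "s \<le> u" "u \<le> T"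
    for P :: "'w measure" and F W N eta s u n y
  proof -
    interpret noise m P F W N eta by (rule ns)
    have g: "s \<le> grid s u n k" for k using monoD[OF grid_mono[OF s(2)], of 0 k n] by simp
    have gi: "s \<le> grid s u n k" "grid s u n k \<le> u" if "k \<le> Suc n" for k
      using grid_in[OF s(2) that] by auto
    have gS: "grid s u n k \<le> grid s u n (Suc k)" for k using monoD[OF grid_mono[OF s(2)], of k "Suc k" n] by simp
    define V where "V k \<omega> = ennreal (norm (Z s (grid s u n k) \<omega>) ^ (2 * q))" for k \<omega>
    have [measurable]: "V k \<in> borel_measurable P" for k
    proof -
      have [measurable]: "Z s (grid s u n k) \<in> borel_measurable P" using s g by (intro Z_measurable) auto
      show ?thesis unfolding V_def by measurable
    qed
    have V: "(\<integral>\<^sup>+\<omega>. V k \<omega> \<partial>P) \<le> ennreal M" if "k \<le> Suc n" for k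
      unfolding V_def M[symmetric] using gi[OF that] s by (intro Z_moment q) auto
    have pt: "ennreal (norm (euler_end s u n y (dZ s u n \<omega>)) ^ (2 * q))
        \<le> ennreal (c * (1 + norm y ^ (2 * q))) + ennreal c * (ennreal (1 / real (Suc n)) * (\<Sum>j<Suc n. V j \<omega>) + V (Suc n) \<omega>)"
      if \<omega>: "\<omega> \<in> space P" for \<omega>
    proof -
      define z where "z k = Z s (grid s u n k) \<omega>" for k
      define a where "a = (\<Sum>j<Suc n. norm (z j)) / real (Suc n)"
      define b where "b = (1 / real (Suc n)) * (\<Sum>j<Suc n. norm (z j) ^ (2 * q))"
      have a0: "0 \<le> a" by (simp add: a_def sum_nonneg)
      have "euler_end s u n y (dZ s u n \<omega>) = euler_end s u n y (\<lambda>k. z (Suc k) - z k)"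
        using Z_add[OF \<omega> s(1) g gS] by (intro euler_end_cong) (simp add: z_def)
      then have "norm (euler_end s u n y (dZ s u n \<omega>))
          \<le> (norm y + C * T + C * T * a) * exp (C * T) + norm (z (Suc n))"
        unfolding euler_end_def a_def using C s
        by (simp only:) (rule euler_growth[where u=u and C=C]; auto simp: z_def Z_self)
      then have "norm (euler_end s u n y (dZ s u n \<omega>)) ^ (2 * q)
          \<le> ((norm y + C * T + C * T * a) * exp (C * T) + norm (z (Suc n))) ^ (2 * q)"
        by (rule power_mono) simp
      also have "\<dots> \<le> c * ((1 + norm y ^ (2 * q)) + (a ^ (2 * q) + norm (z (Suc n)) ^ (2 * q)))"
        using a0 by (intro cb) auto
      also have "a ^ (2 * q) \<le> b"
        unfolding a_def b_def using power_mean_le[of "{..<Suc n}" "2 * q" "\<lambda>j. norm (z j)"] by (simp add: lessThan_empty_iff)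
      finally have "norm (euler_end s u n y (dZ s u n \<omega>)) ^ (2 * q)
          \<le> c * (1 + norm y ^ (2 * q)) + c * (b + norm (z (Suc n)) ^ (2 * q))"
        using c by (simp add: mult_left_mono distrib_left)
      then have "ennreal (norm (euler_end s u n y (dZ s u n \<omega>)) ^ (2 * q))
          \<le> ennreal (c * (1 + norm y ^ (2 * q)) + c * ((1 / real (Suc n)) * (\<Sum>j<Suc n. norm (z j) ^ (2 * q)) + norm (z (Suc n)) ^ (2 * q)))"
        unfolding b_def by (rule ennreal_leI)
      also have "\<dots> = ennreal (c * (1 + norm y ^ (2 * q))) + ennreal (c * ((1 / real (Suc n)) * (\<Sum>j<Suc n. norm (z j) ^ (2 * q)) + norm (z (Suc n)) ^ (2 * q)))"
        using c by (intro ennreal_plus mult_nonneg_nonneg add_nonneg_nonneg sum_nonneg) auto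
      also have "ennreal (c * ((1 / real (Suc n)) * (\<Sum>j<Suc n. norm (z j) ^ (2 * q)) + norm (z (Suc n)) ^ (2 * q)))
          = ennreal c * (ennreal (1 / real (Suc n)) * (\<Sum>j<Suc n. V j \<omega>) + V (Suc n) \<omega>)"
        unfolding V_def z_def[symmetric]
        by (subst sum_ennreal, simp, subst ennreal_mult[symmetric], simp, simp add: sum_nonneg del: sum.lessThan_Suc,
            subst ennreal_plus[symmetric], simp add: sum_nonneg del: sum.lessThan_Suc, simp,
            subst ennreal_mult[OF c], simp_all add: sum_nonneg del: sum.lessThan_Suc)
      finally show ?thesis .
    qed
    have "(\<integral>\<^sup>+\<omega>. ennreal (norm (euler_end s u n y (dZ s u n \<omega>)) ^ (2 * q)) \<partial>P)
        \<le> (\<integral>\<^sup>+\<omega>. ennreal (c * (1 + norm y ^ (2 * q))) + ennreal c * (ennreal (1 / real (Suc n)) * (\<Sum>j<Suc n. V j \<omega>) + V (Suc n) \<omega>) \<partial>P)"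
      by (rule nn_integral_mono) (rule pt)
    also have "\<dots> = ennreal (c * (1 + norm y ^ (2 * q)))
        + ennreal c * (ennreal (1 / real (Suc n)) * (\<Sum>j<Suc n. \<integral>\<^sup>+\<omega>. V j \<omega> \<partial>P) + (\<integral>\<^sup>+\<omega>. V (Suc n) \<omega> \<partial>P))"
      by (simp add: nn_integral_add nn_integral_cmult nn_integral_sum emeasure_space_1 del: sum.lessThan_Suc)
    also have "\<dots> \<le> ennreal (c * (1 + norm y ^ (2 * q)))
        + ennreal c * (ennreal (1 / real (Suc n)) * (\<Sum>j<Suc n. ennreal M) + ennreal M)"
      by (intro add_mono mult_left_mono sum_mono V) auto
    also have "ennreal (1 / real (Suc n)) * (\<Sum>j<Suc n. ennreal M) = ennreal M"
    proof -
      have "(\<Sum>j<Suc n. ennreal M) = ennreal (real (Suc n) * M)" using M0 by (subst sum_ennreal) (auto simp: )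
      then show ?thesis using M0 by (simp add: ennreal_mult[symmetric] del: of_nat_Suc)
    qed
    also have "ennreal (c * (1 + norm y ^ (2 * q))) + ennreal c * (ennreal M + ennreal M)
        = ennreal (c * (1 + norm y ^ (2 * q)) + c * (M + M))"
      using c M0 by (simp add: ennreal_plus[symmetric] ennreal_mult[symmetric] del: ennreal_plus)
    also have "\<dots> \<le> ennreal (c * (1 + 2 * M) * (1 + norm y ^ (2 * q)))"
    proof (rule ennreal_leI)
      have "0 \<le> c * M * norm y ^ (2 * q)" using c M0 by simp
      then show "c * (1 + norm y ^ (2 * q)) + c * (M + M) \<le> c * (1 + 2 * M) * (1 + norm y ^ (2 * q))"
        by (simp add: algebra_simps)
    qed
    finally show ?thesis .
  qed
  then show ?thesis using c M0 by (intro exI[of _ "c * (1 + 2 * M)"]) auto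
qed

end

locale exploratory_solution = exploratory_model m \<pi> for m \<pi> +
  fixes t0 :: real and y0 :: state
    and P :: "'w measure" and F :: "real \<Rightarrow> 'w measure"
    and W :: "real \<Rightarrow> 'w \<Rightarrow> real" and N :: "real \<Rightarrow> 'w \<Rightarrow> nat" and eta :: "nat \<Rightarrow> 'w \<Rightarrow> real"
    and Y :: "real \<Rightarrow> 'w \<Rightarrow> state"
  assumes t0: "t0 \<in> {0..horizon m}" and solution: "weak_solution m \<pi> t0 y0 P F W N eta Y"
begin

sublocale noise m P F W N eta
  using valid solution by (auto simp: noise_def weak_solution_def)

lemma Y_adapted: "s \<in> {t0..T} \<Longrightarrow> Y s \<in> borel_measurable (F s)"
  using solution unfolding weak_solution_def by blast

lemma Y_measurable: "s \<in> {t0..T} \<Longrightarrow> Y s \<in> borel_measurable P"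
  using Y_adapted subalg measurable_from_subalg by blast

lemma Y_cadlag: "\<omega> \<in> space P \<Longrightarrow> cadlag_on t0 T (\<lambda>s. Y s \<omega>)"
  using solution unfolding weak_solution_def by blast

lemma Y_right_continuous: "\<omega> \<in> space P \<Longrightarrow> s \<in> {t0..T} \<Longrightarrow> u \<le> T \<Longrightarrow> continuous (at s within {s..u}) (\<lambda>r. Y r \<omega>)"
proof -
  assume *: "\<omega> \<in> space P" "s \<in> {t0..T}" "u \<le> T"
  have "continuous (at s within {s..T}) (\<lambda>r. Y r \<omega>)" using Y_cadlag[OF *(1)] *(2) unfolding cadlag_on_def by blast
  then show "continuous (at s within {s..u}) (\<lambda>r. Y r \<omega>)" by (rule continuous_within_subset) (use * in auto)
qed

lemma Y_initial: "AE \<omega> in P. Y t0 \<omega> = y0"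
proof -
  have "AE \<omega> in P. \<forall>s\<in>{t0..T}. set_integrable lborel {t0..s} (\<lambda>u. \<beta> u (Y u \<omega>)) \<and>
        Y s \<omega> = y0 + (LINT u:{t0..s}|lborel. \<beta> u (Y u \<omega>))
          + (volatility m * (W s \<omega> - W t0 \<omega>), 0, 0, 0) + (0, 0, 0, J t0 s \<omega>)"
    using solution unfolding weak_solution_def by (elim conjE)
  then show ?thesis
  proof eventually_elim
    fix \<omega> assume *: "\<forall>s\<in>{t0..T}. set_integrable lborel {t0..s} (\<lambda>u. \<beta> u (Y u \<omega>)) \<and>
        Y s \<omega> = y0 + (LINT u:{t0..s}|lborel. \<beta> u (Y u \<omega>))
          + (volatility m * (W s \<omega> - W t0 \<omega>), 0, 0, 0) + (0, 0, 0, J t0 s \<omega>)"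
    have "(LINT u:{t0..t0}|lborel. \<beta> u (Y u \<omega>)) = 0" by (rule set_integral_singleton)
    moreover have "J t0 t0 \<omega> = 0" using Z_self[of t0 \<omega>] unfolding shock_def zero_prod_def by simp
    ultimately show "Y t0 \<omega> = y0" using *[rule_format, of t0] t0 by (simp add: zero_prod_def[symmetric])
  qed
qed

text \<open>
  The equation may be restarted at any time along a solution, because drift integral and noise are both
  additive over adjacent intervals.
\<close>

lemma Y_flow:
  "AE \<omega> in P. \<forall>s u. t0 \<le> s \<longrightarrow> s \<le> u \<longrightarrow> u \<le> T \<longrightarrow>
     Y u \<omega> = Y s \<omega> + (LINT v:{s..u}|lborel. \<beta> v (Y v \<omega>)) + Z s u \<omega>"
proof -
  have "AE \<omega> in P. \<forall>s\<in>{t0..T}. set_integrable lborel {t0..s} (\<lambda>u. \<beta> u (Y u \<omega>)) \<and>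
        Y s \<omega> = y0 + (LINT u:{t0..s}|lborel. \<beta> u (Y u \<omega>))
          + (volatility m * (W s \<omega> - W t0 \<omega>), 0, 0, 0) + (0, 0, 0, J t0 s \<omega>)"
    using solution unfolding weak_solution_def by (elim conjE)
  then show ?thesis
    using AE_space
  proof eventually_elim
    fix \<omega> assume eq: "\<forall>s\<in>{t0..T}. set_integrable lborel {t0..s} (\<lambda>u. \<beta> u (Y u \<omega>)) \<and>
        Y s \<omega> = y0 + (LINT u:{t0..s}|lborel. \<beta> u (Y u \<omega>))
          + (volatility m * (W s \<omega> - W t0 \<omega>), 0, 0, 0) + (0, 0, 0, J t0 s \<omega>)"
      and \<omega>: "\<omega> \<in> space P"
    define f where "f = (\<lambda>u. \<beta> u (Y u \<omega>))"
    have Yeq: "Y s \<omega> = y0 + (LINT u:{t0..s}|lborel. f u) + Z t0 s \<omega>" if "s \<in> {t0..T}" for s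
      using eq that by (auto simp: shock_def f_def)
    show "\<forall>s u. t0 \<le> s \<longrightarrow> s \<le> u \<longrightarrow> u \<le> T \<longrightarrow> Y u \<omega> = Y s \<omega> + (LINT v:{s..u}|lborel. \<beta> v (Y v \<omega>)) + Z s u \<omega>"
    proof (intro allI impI)
      fix s u assume su: "t0 \<le> s" "s \<le> u" "u \<le> T"
      have i: "set_integrable lborel {t0..u} f" using eq su by (auto simp: f_def)
      have "(LINT v:{t0..u}|lborel. f v) = (LINT v:{t0..s}|lborel. f v) + (LINT v:{s..u}|lborel. f v)"
        by (rule set_integral_Icc_split[OF i su(1,2)])
      moreover have "Z t0 u \<omega> = Z t0 s \<omega> + Z s u \<omega>" using su t0 by (intro Z_add \<omega>) auto
      ultimately show "Y u \<omega> = Y s \<omega> + (LINT v:{s..u}|lborel. \<beta> v (Y v \<omega>)) + Z s u \<omega>"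
        using Yeq[of u] Yeq[of s] su by (simp add: f_def)
    qed
  qed
qed

text \<open>
  The exceptional null set is the one on which the equation fails; it does not depend on the times.
\<close>

lemma euler_end_tendsto:
  "AE \<omega> in P. \<forall>s u. t0 \<le> s \<longrightarrow> s \<le> u \<longrightarrow> u \<le> T \<longrightarrow>
     (\<lambda>n. euler_end s u n (Y s \<omega>) (dZ s u n \<omega>)) \<longlonglongrightarrow> Y u \<omega>"
  using Y_flow AE_space
proof eventually_elim
  fix \<omega> assume flow: "\<forall>s u. t0 \<le> s \<longrightarrow> s \<le> u \<longrightarrow> u \<le> T \<longrightarrow>
     Y u \<omega> = Y s \<omega> + (LINT v:{s..u}|lborel. \<beta> v (Y v \<omega>)) + Z s u \<omega>" and \<omega>: "\<omega> \<in> space P"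
  obtain B where B: "\<And>r. r \<in> {t0..T} \<Longrightarrow> norm (Y r \<omega>) \<le> B"
    using cadlag_on_bounded[OF Y_cadlag[OF \<omega>]] by blast
  obtain C where C: "C > 0" "\<And>t y. t \<in> {0..T} \<Longrightarrow> norm (\<beta> t y) \<le> C * (1 + norm y)"
    using exploratory_drift_growth by blast
  obtain L where L: "L > 0" "\<And>t y y'. t \<in> {0..T} \<Longrightarrow> norm (\<beta> t y - \<beta> t y') \<le> L * (1 + norm y') * norm (y - y')"
    using exploratory_drift_lipschitz by blast
  have in0: "r \<in> {0..T}" if "r \<in> {t0..T}" for r using that t0 by auto
  show "\<forall>s u. t0 \<le> s \<longrightarrow> s \<le> u \<longrightarrow> u \<le> T \<longrightarrow>
     (\<lambda>n. euler_end s u n (Y s \<omega>) (dZ s u n \<omega>)) \<longlonglongrightarrow> Y u \<omega>"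
  proof (intro allI impI)
    fix s u assume su: "t0 \<le> s" "s \<le> u" "u \<le> T"
    have s0: "0 \<le> s" using su t0 by auto
    show "(\<lambda>n. euler_end s u n (Y s \<omega>) (dZ s u n \<omega>)) \<longlonglongrightarrow> Y u \<omega>"
    proof (cases "s = u")
      case True
      have "euler \<beta> s 0 (Y s \<omega>) (\<lambda>k. Z s s \<omega>) k = Y s \<omega>" for k by (induction k) (auto simp: Z_self)
      then show ?thesis using True Z_self[of u \<omega>] by (simp add: euler_end_def grid_def)
    next
      case False
      then have lt: "s < u" using su by simp
      have g: "s \<le> grid s u n k" for n k using monoD[OF grid_mono[OF su(2)], of 0 k n] by simp
      have gS: "grid s u n k \<le> grid s u n (Suc k)" for n k using monoD[OF grid_mono[OF su(2)], of k "Suc k" n] by simp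
      have "(\<lambda>n. euler \<beta> s (mesh s u n) (Y s \<omega>)
            (\<lambda>k. Z s (s + real (Suc k) * mesh s u n) \<omega> - Z s (s + real k * mesh s u n) \<omega>) (Suc n)) \<longlonglongrightarrow> Y u \<omega>"
      proof (rule euler_tendsto[OF lt])
        fix r assume r: "r \<in> {s..u}"
        then have rT: "r \<in> {t0..T}" using su by auto
        show "Y r \<omega> = Y s \<omega> + (LINT v:{s..r}|lborel. \<beta> v (Y v \<omega>)) + (Z s r \<omega> - Z s s \<omega>)"
          using flow[rule_format, of s r] r su unfolding Z_self by simp
        show "norm (\<beta> r (Y r \<omega>)) \<le> C * (1 + B)"
          using B[OF rT] C(1) by (intro order_trans[OF C(2)[OF in0[OF rT]] mult_left_mono]) auto
        show "norm (\<beta> r z - \<beta> r (Y r \<omega>)) \<le> (L * (1 + B)) * norm (z - Y r \<omega>)" for z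
          using B[OF rT] L(1) by (intro order_trans[OF L(2)[OF in0[OF rT]] mult_right_mono] mult_left_mono) auto
        show "continuous (at r within {r..u}) (\<lambda>r. \<beta> r (Y r \<omega>))"
          unfolding continuous_within_sequentially
        proof (intro allI impI; elim conjE)
          fix x :: "nat \<Rightarrow> real" assume x: "\<forall>n. x n \<in> {r..u}" "x \<longlonglongrightarrow> r"
          have "((\<lambda>r. Y r \<omega>) \<circ> x) \<longlonglongrightarrow> Y r \<omega>"
            by (rule Y_right_continuous[OF \<omega> rT su(3), unfolded continuous_within_sequentially, rule_format])
              (use x in \<open>auto\<close>)
          then have "(\<lambda>n. (x n, Y (x n) \<omega>)) \<longlonglongrightarrow> (r, Y r \<omega>)"
            using x(2) by (intro tendsto_Pair) (auto simp: o_def)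
          moreover have "(x n, Y (x n) \<omega>) \<in> {0..T} \<times> UNIV" for n using x(1)[rule_format, of n] r su t0 by auto
          moreover have "(r, Y r \<omega>) \<in> {0..T} \<times> UNIV" using in0[OF rT] by blast
          ultimately have "((\<lambda>p. \<beta> (fst p) (snd p)) \<circ> (\<lambda>n. (x n, Y (x n) \<omega>))) \<longlonglongrightarrow> \<beta> (fst (r, Y r \<omega>)) (snd (r, Y r \<omega>))"
            by (intro exploratory_drift_continuous[unfolded continuous_on_sequentially, rule_format]; blast)
          then show "((\<lambda>r. \<beta> r (Y r \<omega>)) \<circ> x) \<longlonglongrightarrow> \<beta> r (Y r \<omega>)" by (simp add: o_def)
        qed
      qed
      moreover have "Z s (s + real (Suc k) * mesh s u n) \<omega> - Z s (s + real k * mesh s u n) \<omega> = Z (grid s u n k) (grid s u n (Suc k)) \<omega>" for n k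
        unfolding grid_def[symmetric] using Z_add[OF \<omega> s0 g gS] by simp
      ultimately show ?thesis unfolding euler_end_def by (simp only:)
    qed
  qed
qed

lemma euler_end_tendsto_initial:
  assumes "u \<in> {t0..T}"
  shows "AE \<omega> in P. (\<lambda>n. euler_end t0 u n y0 (\<lambda>k. Z (grid t0 u n k) (grid t0 u n (Suc k)) \<omega>)) \<longlonglongrightarrow> Y u \<omega>"
  using euler_end_tendsto Y_initial by eventually_elim (use assms in auto)

lemma euler_end_shocks_measurable:
  assumes su: "0 \<le> s" "s \<le> u" "u \<le> T" and X: "X \<in> borel_measurable P"
  shows "(\<lambda>\<omega>. euler_end s u n (X \<omega>) (dZ s u n \<omega>)) \<in> borel_measurable P"
proof -
  have "(\<lambda>\<omega>. (X \<omega>, increments (grid s u n) (Suc n) \<omega>)) \<in> measurable P (borel \<Otimes>\<^sub>M PiM {..<Suc n} (\<lambda>_. borel))"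
    using su by (intro measurable_Pair X increments_measurable grid_mono) auto
  from measurable_compose[OF this euler_end_measurable[OF su]]
  have "(\<lambda>\<omega>. euler_end s u n (X \<omega>) (increments (grid s u n) (Suc n) \<omega>)) \<in> borel_measurable P" by simp
  then show ?thesis unfolding increments_def euler_end_restrict .
qed

end

section \<open>The Markov property\<close>

context noise
begin

text \<open>
  Variables known at the first grid time are independent of the increments, so they may be held fixed
  while the increments are averaged with their law.
\<close>

lemma increments_freeze:
  assumes \<tau>: "mono \<tau>" "0 \<le> \<tau> 0" and n: "0 < n"
    and X: "X \<in> measurable (F (\<tau> 0)) S" and f: "f \<in> borel_measurable (S \<Otimes>\<^sub>M PiM {..<n} (\<lambda>_. borel))"
  shows "(\<integral>\<^sup>+\<omega>. f (X \<omega>, increments \<tau> n \<omega>) \<partial>P) = (\<integral>\<^sup>+\<omega>. \<integral>\<^sup>+d. f (X \<omega>, d) \<partial>increment_law m \<tau> n \<partial>P)"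
proof -
  obtain G where G: "subalgebra P G" "indep_set (sets (F (\<tau> 0))) (sets G)"
      "\<And>r u. \<tau> 0 \<le> r \<Longrightarrow> r \<le> u \<Longrightarrow> Z r u \<in> borel_measurable G"
    using indep_future[OF \<tau>(2)] by blast
  have D: "increments \<tau> n \<in> measurable G (PiM {..<n} (\<lambda>_. borel))"
    unfolding increments_def
  proof (intro measurable_restrict G(3))
    fix k show "\<tau> 0 \<le> \<tau> k" using monoD[OF \<tau>(1), of 0 k] by simp
    show "\<tau> k \<le> \<tau> (Suc k)" using \<tau>(1) by (simp add: mono_iff_le_Suc)
  qed
  have XP [measurable]: "X \<in> measurable P S" using X subalg measurable_from_subalg by blast
  note [measurable] = increments_measurable[OF \<tau>, of n] f
  have law: "distr P (PiM {..<n} (\<lambda>_. borel)) (increments \<tau> n) = increment_law m \<tau> n"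
    by (rule increments_distr[OF \<tau> n])
  interpret I: prob_space "increment_law m \<tau> n" unfolding law[symmetric] by (rule prob_space_distr) measurable
  have sets_law [measurable_cong]: "sets (increment_law m \<tau> n) = sets (PiM {..<n} (\<lambda>_. borel))"
    unfolding law[symmetric] by simp
  have joint: "distr P (S \<Otimes>\<^sub>M PiM {..<n} (\<lambda>_. borel)) (\<lambda>\<omega>. (X \<omega>, increments \<tau> n \<omega>)) = distr P S X \<Otimes>\<^sub>M increment_law m \<tau> n"
    unfolding law[symmetric] using G(1) by (intro distr_pair_indep_set[OF G(2)] X D) (auto simp: subalgebra_def)
  have "(\<integral>\<^sup>+\<omega>. f (X \<omega>, increments \<tau> n \<omega>) \<partial>P) = (\<integral>\<^sup>+p. f p \<partial>distr P (S \<Otimes>\<^sub>M PiM {..<n} (\<lambda>_. borel)) (\<lambda>\<omega>. (X \<omega>, increments \<tau> n \<omega>)))"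
    by (subst nn_integral_distr) auto
  also have "\<dots> = (\<integral>\<^sup>+x. \<integral>\<^sup>+d. f (x, d) \<partial>increment_law m \<tau> n \<partial>distr P S X)"
    unfolding joint by (subst I.nn_integral_fst[symmetric]) auto
  also have "\<dots> = (\<integral>\<^sup>+\<omega>. \<integral>\<^sup>+d. f (X \<omega>, d) \<partial>increment_law m \<tau> n \<partial>P)"
    by (subst nn_integral_distr) auto
  finally show ?thesis .
qed

end

lemma closed_indicator_limit:
  fixes C :: "'a::metric_space set"
  assumes "closed C" "C \<noteq> {}"
  shows "(\<lambda>k. max 0 (1 - real k * infdist x C)) \<longlonglongrightarrow> indicator C x"
proof (cases "x \<in> C")
  case True then show ?thesis by simp
next
  case False
  then have pos: "0 < infdist x C" using assms by (simp add: infdist_pos_not_in_closed)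
  have "\<forall>\<^sub>F k in sequentially. max 0 (1 - real k * infdist x C) = 0"
    using eventually_ge_at_top[of "nat \<lceil>1 / infdist x C\<rceil>"]
  proof eventually_elim
    fix k assume "nat \<lceil>1 / infdist x C\<rceil> \<le> k"
    then have "1 / infdist x C \<le> real k" by linarith
    then show "max 0 (1 - real k * infdist x C) = 0" using pos by (simp add: field_simps)
  qed
  then show ?thesis using False by (auto intro: tendsto_eventually)
qed

lemma sets_borel_closed: "sets (borel :: 'a::topological_space measure) = sigma_sets UNIV (Collect closed)"
  by (simp add: borel_eq_closed)

locale solution_family = exploratory_model m \<pi> for m \<pi> +
  fixes P :: "real \<Rightarrow> state \<Rightarrow> 'w measure" and F :: "real \<Rightarrow> state \<Rightarrow> real \<Rightarrow> 'w measure"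
    and W :: "real \<Rightarrow> state \<Rightarrow> real \<Rightarrow> 'w \<Rightarrow> real" and N :: "real \<Rightarrow> state \<Rightarrow> real \<Rightarrow> 'w \<Rightarrow> nat"
    and eta :: "real \<Rightarrow> state \<Rightarrow> nat \<Rightarrow> 'w \<Rightarrow> real" and Y :: "real \<Rightarrow> state \<Rightarrow> real \<Rightarrow> 'w \<Rightarrow> state"
  assumes solutions: "\<And>t y. t \<in> {0..horizon m} \<Longrightarrow>
    weak_solution m \<pi> t y (P t y) (F t y) (W t y) (N t y) (eta t y) (Y t y)"
begin

lemma solution_at: "t \<in> {0..T} \<Longrightarrow>
    exploratory_solution m \<pi> t y (P t y) (F t y) (W t y) (N t y) (eta t y) (Y t y)"
  by (intro exploratory_solution.intro exploratory_model_axioms exploratory_solution_axioms.intro solutions)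

text \<open>
  The transition law, from state \<open>y\<close> at time \<open>s\<close> to time \<open>u\<close>.
\<close>

definition kernel :: "real \<Rightarrow> real \<Rightarrow> state \<Rightarrow> state measure" where
  "kernel s u y = distr (P s y) borel (Y s y u)"

lemma kernel_prob: "s \<in> {0..T} \<Longrightarrow> u \<in> {s..T} \<Longrightarrow> prob_space (kernel s u y)"
proof -
  assume *: "s \<in> {0..T}" "u \<in> {s..T}"
  interpret exploratory_solution m \<pi> s y "P s y" "F s y" "W s y" "N s y" "eta s y" "Y s y" by (rule solution_at[OF *(1)])
  show ?thesis unfolding kernel_def by (rule prob_space_distr) (rule Y_measurable[OF *(2)])
qed

lemma sets_kernel [simp, measurable_cong]: "sets (kernel s u y) = sets borel" by (simp add: kernel_def)

lemma nn_integral_kernel: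
  assumes "s \<in> {0..T}" "u \<in> {s..T}" "g \<in> borel_measurable borel"
  shows "(\<integral>\<^sup>+x. g x \<partial>kernel s u y) = (\<integral>\<^sup>+\<omega>. g (Y s y u \<omega>) \<partial>P s y)"
proof -
  interpret exploratory_solution m \<pi> s y "P s y" "F s y" "W s y" "N s y" "eta s y" "Y s y" by (rule solution_at[OF assms(1)])
  show ?thesis unfolding kernel_def using Y_measurable[OF assms(2)] assms(3) by (subst nn_integral_distr) auto
qed

lemma integral_kernel:
  fixes g :: "state \<Rightarrow> real"
  assumes "s \<in> {0..T}" "u \<in> {s..T}" "g \<in> borel_measurable borel"
  shows "(LINT x|kernel s u y. g x) = (LINT \<omega>|P s y. g (Y s y u \<omega>))"
proof -
  interpret exploratory_solution m \<pi> s y "P s y" "F s y" "W s y" "N s y" "eta s y" "Y s y" by (rule solution_at[OF assms(1)])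
  show ?thesis unfolding kernel_def using Y_measurable[OF assms(2)] assms(3) by (subst integral_distr) auto
qed

text \<open>
  The transition operator of the Euler scheme with \<open>n + 1\<close> steps; it does not refer to any
  of the probability spaces.
\<close>

definition euler_kernel :: "real \<Rightarrow> real \<Rightarrow> nat \<Rightarrow> (state \<Rightarrow> ennreal) \<Rightarrow> state \<Rightarrow> ennreal" where
  "euler_kernel s u n g y = (\<integral>\<^sup>+d. g (euler_end s u n y d) \<partial>increment_law m (grid s u n) (Suc n))"

lemma increment_law_prob:
  assumes "s \<in> {0..T}" "u \<in> {s..T}"
  shows "prob_space (increment_law m (grid s u n) (Suc n))"
    "sets (increment_law m (grid s u n) (Suc n)) = sets (PiM {..<Suc n} (\<lambda>_. borel))"
proof -
  interpret exploratory_solution m \<pi> s 0 "P s 0" "F s 0" "W s 0" "N s 0" "eta s 0" "Y s 0" by (rule solution_at[OF assms(1)])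
  have g: "mono (grid s u n)" "0 \<le> grid s u n 0" using assms by (auto intro: grid_mono)
  have law: "distr (P s 0) (PiM {..<Suc n} (\<lambda>_. borel)) (increments (grid s u n) (Suc n)) = increment_law m (grid s u n) (Suc n)"
    by (rule increments_distr[OF g]) simp
  show "prob_space (increment_law m (grid s u n) (Suc n))"
    unfolding law[symmetric] by (rule prob_space_distr) (rule increments_measurable[OF g])
  show "sets (increment_law m (grid s u n) (Suc n)) = sets (PiM {..<Suc n} (\<lambda>_. borel))"
    unfolding law[symmetric] by simp
qed

lemma euler_kernel_measurable:
  assumes su: "s \<in> {0..T}" "u \<in> {s..T}" and g: "g \<in> borel_measurable borel"
  shows "euler_kernel s u n g \<in> borel_measurable borel"
proof -
  interpret I: prob_space "increment_law m (grid s u n) (Suc n)" by (rule increment_law_prob[OF su])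
  have "(\<lambda>p. euler_end s u n (fst p) (snd p)) \<in> borel_measurable (borel \<Otimes>\<^sub>M PiM {..<Suc n} (\<lambda>_. borel))"
    using su by (intro euler_end_measurable) auto
  from measurable_compose[OF this g]
  have "(\<lambda>(y, d). g (euler_end s u n y d)) \<in> borel_measurable (borel \<Otimes>\<^sub>M increment_law m (grid s u n) (Suc n))"
    by (simp add: split_def measurable_cong_sets[OF sets_pair_measure_cong[OF refl increment_law_prob(2)[OF su]] refl])
  then show ?thesis unfolding euler_kernel_def by (rule I.borel_measurable_nn_integral)
qed

lemma euler_kernel_le_1:
  assumes su: "s \<in> {0..T}" "u \<in> {s..T}" and g: "\<And>x. g x \<le> 1"
  shows "euler_kernel s u n g y \<le> 1"
proof -
  interpret I: prob_space "increment_law m (grid s u n) (Suc n)" by (rule increment_law_prob[OF su])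
  have "euler_kernel s u n g y \<le> (\<integral>\<^sup>+d. 1 \<partial>increment_law m (grid s u n) (Suc n))"
    unfolding euler_kernel_def by (intro nn_integral_mono g)
  then show ?thesis by (simp add: I.emeasure_space_1)
qed

text \<open>
  An Euler scheme started in a random state known at time \<open>s\<close>, on an arbitrary probability
  space of the family, acts through the common transition operator.
\<close>

lemma euler_freeze:
  assumes t: "t \<in> {0..T}" and su: "s \<in> {t..T}" "u \<in> {s..T}" and g: "g \<in> borel_measurable borel"
    and X: "X \<in> borel_measurable (F t y s)" and H: "H \<in> sets (F t y s)"
  shows "(\<integral>\<^sup>+\<omega>. indicator H \<omega> * g (euler_end s u n (X \<omega>) (\<lambda>k. shock m (W t y) (N t y) (eta t y) (grid s u n k) (grid s u n (Suc k)) \<omega>)) \<partial>P t y)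
    = (\<integral>\<^sup>+\<omega>. indicator H \<omega> * euler_kernel s u n g (X \<omega>) \<partial>P t y)"
proof -
  interpret exploratory_solution m \<pi> t y "P t y" "F t y" "W t y" "N t y" "eta t y" "Y t y" by (rule solution_at[OF t])
  have su': "s \<in> {0..T}" "u \<in> {s..T}" using su t by auto
  have gr: "mono (grid s u n)" "0 \<le> grid s u n 0" using su su' by (auto intro: grid_mono)
  define f where "f = (\<lambda>(x :: state \<times> ennreal, d). snd x * g (euler_end s u n (fst x) d))"
  have E: "(\<lambda>p. euler_end s u n (fst p) (snd p)) \<in> borel_measurable (borel \<Otimes>\<^sub>M PiM {..<Suc n} (\<lambda>_. borel))"
    using su' by (intro euler_end_measurable) auto
  have m1: "(\<lambda>p. (fst (fst p), snd p)) \<in> measurable ((borel \<Otimes>\<^sub>M borel) \<Otimes>\<^sub>M PiM {..<Suc n} (\<lambda>_. borel)) (borel \<Otimes>\<^sub>M PiM {..<Suc n} (\<lambda>_. borel))"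
    by measurable
  have fm: "f \<in> borel_measurable ((borel \<Otimes>\<^sub>M borel) \<Otimes>\<^sub>M PiM {..<Suc n} (\<lambda>_. borel))"
    unfolding f_def split_def using measurable_compose[OF measurable_compose[OF m1 E] g]
    by (intro borel_measurable_times_ennreal) simp_all
  have Xm: "(\<lambda>\<omega>. (X \<omega>, indicator H \<omega> :: ennreal)) \<in> measurable (F t y (grid s u n 0)) (borel \<Otimes>\<^sub>M borel)"
    using X H by simp
  have "(\<integral>\<^sup>+\<omega>. indicator H \<omega> * g (euler_end s u n (X \<omega>) (dZ s u n \<omega>)) \<partial>P t y)
     = (\<integral>\<^sup>+\<omega>. f ((X \<omega>, indicator H \<omega>), increments (grid s u n) (Suc n) \<omega>) \<partial>P t y)"
    unfolding f_def increments_def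
    by (simp add: euler_end_restrict del: lessThan_Suc)
  also have "\<dots> = (\<integral>\<^sup>+\<omega>. \<integral>\<^sup>+d. f ((X \<omega>, indicator H \<omega>), d) \<partial>increment_law m (grid s u n) (Suc n) \<partial>P t y)"
    by (rule increments_freeze[OF gr _ Xm fm]) simp
  also have "\<dots> = (\<integral>\<^sup>+\<omega>. indicator H \<omega> * euler_kernel s u n g (X \<omega>) \<partial>P t y)"
  proof (rule nn_integral_cong)
    fix \<omega>
    have "(\<lambda>d. g (euler_end s u n (X \<omega>) d)) \<in> borel_measurable (increment_law m (grid s u n) (Suc n))"
      using measurable_compose[OF measurable_Pair1'[of "X \<omega>"] measurable_compose[OF E g]]
      by (simp add: measurable_cong_sets[OF increment_law_prob(2)[OF su'] refl])
    then show "(\<integral>\<^sup>+d. f ((X \<omega>, indicator H \<omega>), d) \<partial>increment_law m (grid s u n) (Suc n)) = indicator H \<omega> * euler_kernel s u n g (X \<omega>)"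
      unfolding f_def euler_kernel_def by (simp add: nn_integral_cmult)
  qed
  finally show ?thesis .
qed

lemma euler_kernel_tendsto:
  assumes su: "s \<in> {0..T}" "u \<in> {s..T}" and g: "continuous_on UNIV g" "\<And>x. 0 \<le> g x" "\<And>x. g x \<le> (1::real)"
  shows "(\<lambda>n. euler_kernel s u n (\<lambda>x. ennreal (g x)) y) \<longlonglongrightarrow> (\<integral>\<^sup>+x. ennreal (g x) \<partial>kernel s u y)"
proof -
  interpret exploratory_solution m \<pi> s y "P s y" "F s y" "W s y" "N s y" "eta s y" "Y s y" by (rule solution_at[OF su(1)])
  have gm [measurable]: "g \<in> borel_measurable borel" by (rule borel_measurable_continuous_onI[OF g(1)])
  define E where "E n \<omega> = euler_end s u n y (dZ s u n \<omega>)" for n \<omega>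
  have Em [measurable]: "E n \<in> borel_measurable (P s y)" for n
    unfolding E_def using su by (intro euler_end_shocks_measurable borel_measurable_const) auto
  have eq: "euler_kernel s u n (\<lambda>x. ennreal (g x)) y = (\<integral>\<^sup>+\<omega>. ennreal (g (E n \<omega>)) \<partial>P s y)" for n
    using euler_freeze[where t=s and s=s and u=u and g="\<lambda>x. ennreal (g x)" and X="\<lambda>_. y" and y=y and H="space (P s y)" and n=n] su
      sets.top[of "F s y s"]
    by (simp add: E_def emeasure_space_1 nn_integral_cmult cong: nn_integral_cong)
  have "(\<lambda>n. \<integral>\<^sup>+\<omega>. ennreal (g (E n \<omega>)) \<partial>P s y) \<longlonglongrightarrow> (\<integral>\<^sup>+\<omega>. ennreal (g (Y s y u \<omega>)) \<partial>P s y)"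
  proof (rule nn_integral_dominated_convergence[where w="\<lambda>_. 1"])
    show "AE \<omega> in P s y. (\<lambda>n. ennreal (g (E n \<omega>))) \<longlonglongrightarrow> ennreal (g (Y s y u \<omega>))"
      using euler_end_tendsto_initial[OF su(2)]
    proof eventually_elim
      fix \<omega> assume "(\<lambda>n. euler_end s u n y (dZ s u n \<omega>)) \<longlonglongrightarrow> Y s y u \<omega>"
      then show "(\<lambda>n. ennreal (g (E n \<omega>))) \<longlonglongrightarrow> ennreal (g (Y s y u \<omega>))"
        unfolding E_def[symmetric]
        by (intro tendsto_ennrealI continuous_on_tendsto_compose[OF g(1)]) auto
    qed
  qed (use g Y_measurable[OF su(2)] in \<open>auto simp: emeasure_space_1 intro!: ennreal_leI[of _ 1, simplified]\<close>)
  then show ?thesis by (simp add: eq nn_integral_kernel[OF su])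
qed

text \<open>
  Started in \<open>Y t y s\<close>, the Euler schemes converge to \<open>Y t y u\<close> on the space for \<open>(t, y)\<close>; started in
  a fixed \<open>y'\<close>, they converge to the solution on the space for \<open>(s, y')\<close>. Both sides are limits of
  the same expectations.
\<close>

lemma markov_continuous:
  assumes t: "t \<in> {0..T}" and su: "s \<in> {t..T}" "u \<in> {s..T}" and H: "H \<in> sets (F t y s)"
    and g: "continuous_on UNIV g" "\<And>x. 0 \<le> g x" "\<And>x. g x \<le> (1::real)"
  shows "(\<integral>\<^sup>+\<omega>. indicator H \<omega> * ennreal (g (Y t y u \<omega>)) \<partial>P t y)
    = (\<integral>\<^sup>+\<omega>. indicator H \<omega> * (\<integral>\<^sup>+x. ennreal (g x) \<partial>kernel s u (Y t y s \<omega>)) \<partial>P t y)"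
proof -
  interpret exploratory_solution m \<pi> t y "P t y" "F t y" "W t y" "N t y" "eta t y" "Y t y" by (rule solution_at[OF t])
  have su': "s \<in> {0..T}" "u \<in> {s..T}" using su t by auto
  have gm [measurable]: "g \<in> borel_measurable borel" by (rule borel_measurable_continuous_onI[OF g(1)])
  have g1: "ennreal (g x) \<le> 1" for x using ennreal_leI[OF g(3)[of x]] by simp
  have AP [measurable]: "H \<in> sets (P t y)" using H subalg[of s] by (auto simp: subalgebra_def)
  note Ym = Y_measurable[OF su(1)]
  have Yu [measurable]: "Y t y u \<in> borel_measurable (P t y)" using su t by (intro Y_measurable) auto
  define E where "E n \<omega> = euler_end s u n (Y t y s \<omega>) (dZ s u n \<omega>)" for n \<omega>
  have Em [measurable]: "E n \<in> borel_measurable (P t y)" for n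
    unfolding E_def using su' by (intro euler_end_shocks_measurable Ym) auto
  have ind1: "indicator H \<omega> * x \<le> (1::ennreal)" if "x \<le> 1" for \<omega> x
    using that by (simp add: indicator_def)
  have "(\<lambda>n. \<integral>\<^sup>+\<omega>. indicator H \<omega> * ennreal (g (E n \<omega>)) \<partial>P t y) \<longlonglongrightarrow> (\<integral>\<^sup>+\<omega>. indicator H \<omega> * ennreal (g (Y t y u \<omega>)) \<partial>P t y)"
  proof (rule nn_integral_dominated_convergence[where w="\<lambda>_. 1"])
    show "AE \<omega> in P t y. (\<lambda>n. indicator H \<omega> * ennreal (g (E n \<omega>))) \<longlonglongrightarrow> indicator H \<omega> * ennreal (g (Y t y u \<omega>))"
      using euler_end_tendsto
    proof eventually_elim
      fix \<omega> assume "\<forall>s u. t \<le> s \<longrightarrow> s \<le> u \<longrightarrow> u \<le> T \<longrightarrow>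
          (\<lambda>n. euler_end s u n (Y t y s \<omega>) (dZ s u n \<omega>)) \<longlonglongrightarrow> Y t y u \<omega>"
      then have "(\<lambda>n. E n \<omega>) \<longlonglongrightarrow> Y t y u \<omega>" unfolding E_def using su by simp
      then have "(\<lambda>n. ennreal (g (E n \<omega>))) \<longlonglongrightarrow> ennreal (g (Y t y u \<omega>))"
        by (intro tendsto_ennrealI continuous_on_tendsto_compose[OF g(1)]) auto
      then show "(\<lambda>n. indicator H \<omega> * ennreal (g (E n \<omega>))) \<longlonglongrightarrow> indicator H \<omega> * ennreal (g (Y t y u \<omega>))"
        by (cases "\<omega> \<in> H") auto
    qed
  qed (use g1 ind1 in \<open>auto simp: emeasure_space_1\<close>)
  moreover have "(\<lambda>n. \<integral>\<^sup>+\<omega>. indicator H \<omega> * euler_kernel s u n (\<lambda>x. ennreal (g x)) (Y t y s \<omega>) \<partial>P t y)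
      \<longlonglongrightarrow> (\<integral>\<^sup>+\<omega>. indicator H \<omega> * (\<integral>\<^sup>+x. ennreal (g x) \<partial>kernel s u (Y t y s \<omega>)) \<partial>P t y)"
  proof (rule nn_integral_dominated_convergence[where w="\<lambda>_. 1"])
    have km: "(\<lambda>y'. euler_kernel s u n (\<lambda>x. ennreal (g x)) y') \<in> borel_measurable borel" for n
      by (rule euler_kernel_measurable[OF su']) simp
    show m: "(\<lambda>\<omega>. indicator H \<omega> * euler_kernel s u n (\<lambda>x. ennreal (g x)) (Y t y s \<omega>)) \<in> borel_measurable (P t y)" for n
      using measurable_compose[OF Ym km] by (intro borel_measurable_times_ennreal) simp_all
    have lim: "(\<lambda>n. euler_kernel s u n (\<lambda>x. ennreal (g x)) y') \<longlonglongrightarrow> (\<integral>\<^sup>+x. ennreal (g x) \<partial>kernel s u y')" for y'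
      by (rule euler_kernel_tendsto[OF su' g])
    then show "AE \<omega> in P t y. (\<lambda>n. indicator H \<omega> * euler_kernel s u n (\<lambda>x. ennreal (g x)) (Y t y s \<omega>))
        \<longlonglongrightarrow> indicator H \<omega> * (\<integral>\<^sup>+x. ennreal (g x) \<partial>kernel s u (Y t y s \<omega>))"
      by (intro AE_I2) (auto simp: indicator_def)
    have lm: "(\<lambda>y'. \<integral>\<^sup>+x. ennreal (g x) \<partial>kernel s u y') \<in> borel_measurable borel"
      by (rule borel_measurable_LIMSEQ_order[OF lim km])
    show "(\<lambda>\<omega>. indicator H \<omega> * (\<integral>\<^sup>+x. ennreal (g x) \<partial>kernel s u (Y t y s \<omega>))) \<in> borel_measurable (P t y)"
      using measurable_compose[OF Ym lm] by (intro borel_measurable_times_ennreal) simp_all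
    show "AE \<omega> in P t y. indicator H \<omega> * euler_kernel s u n (\<lambda>x. ennreal (g x)) (Y t y s \<omega>) \<le> 1" for n
      by (intro AE_I2 ind1 euler_kernel_le_1[OF su'] g1)
  qed (auto simp: emeasure_space_1)
  moreover have "(\<integral>\<^sup>+\<omega>. indicator H \<omega> * ennreal (g (E n \<omega>)) \<partial>P t y)
      = (\<integral>\<^sup>+\<omega>. indicator H \<omega> * euler_kernel s u n (\<lambda>x. ennreal (g x)) (Y t y s \<omega>) \<partial>P t y)" for n
    unfolding E_def by (rule euler_freeze[OF t su _ Y_adapted[OF su(1)] H]) simp
  ultimately show ?thesis by (simp add: LIMSEQ_unique)
qed

end

text \<open>
  The indicator of a closed set is a decreasing limit of continuous functions with values in \<open>[0, 1]\<close>.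
\<close>

lemma closed_emeasure_limit:
  fixes M :: "'a::metric_space measure"
  assumes fin: "finite_measure M" and sets: "sets M = sets borel" and C: "closed C" "C \<noteq> {}"
  shows "(\<lambda>k. \<integral>\<^sup>+x. ennreal (max 0 (1 - real k * infdist x C)) \<partial>M) \<longlonglongrightarrow> emeasure M C"
proof -
  interpret finite_measure M by (rule fin)
  note [measurable_cong] = sets
  have [measurable]: "(\<lambda>x. max 0 (1 - real k * infdist x C)) \<in> borel_measurable borel" for k
    by (intro borel_measurable_continuous_onI continuous_intros)
  have "(\<lambda>k. \<integral>\<^sup>+x. ennreal (max 0 (1 - real k * infdist x C)) \<partial>M) \<longlonglongrightarrow> (\<integral>\<^sup>+x. indicator C x \<partial>M)"
  proof (rule nn_integral_dominated_convergence[where w="\<lambda>_. 1"])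
    show "AE x in M. (\<lambda>k. ennreal (max 0 (1 - real k * infdist x C))) \<longlonglongrightarrow> indicator C x"
    proof (rule AE_I2)
      fix x show "(\<lambda>k. ennreal (max 0 (1 - real k * infdist x C))) \<longlonglongrightarrow> indicator C x"
        using tendsto_ennrealI[OF closed_indicator_limit[OF C, of x]] by (simp add: ennreal_indicator)
    qed
    show "AE x in M. ennreal (max 0 (1 - real k * infdist x C)) \<le> 1" for k
      by (intro AE_I2 ennreal_leI[of _ 1, simplified]) (simp add: infdist_nonneg)
    show "(\<lambda>x. ennreal (max 0 (1 - real k * infdist x C))) \<in> borel_measurable M" for k
      unfolding measurable_cong_sets[OF sets refl] by measurable
    show "indicator C \<in> borel_measurable M"
      unfolding measurable_cong_sets[OF sets refl] using C by simp
  qed (simp_all add: emeasure_eq_measure)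
  then show ?thesis using C sets by simp
qed

lemma Int_stable_closed: "Int_stable (Collect closed)"
  by (auto simp: Int_stable_def)

text \<open>
  Closed sets form an intersection-stable generator of the Borel sets.
\<close>

lemma measure_eqI_continuous:
  fixes M1 M2 :: "'a::metric_space measure"
  assumes "finite_measure M1" "sets M1 = sets borel" "finite_measure M2" "sets M2 = sets borel"
    and eq: "\<And>g. continuous_on UNIV g \<Longrightarrow> (\<And>x. 0 \<le> g x) \<Longrightarrow> (\<And>x. g x \<le> (1::real)) \<Longrightarrow>
       (\<integral>\<^sup>+x. ennreal (g x) \<partial>M1) = (\<integral>\<^sup>+x. ennreal (g x) \<partial>M2)"
  shows "M1 = M2"
proof (rule measure_eqI_generator_eq[where E="Collect closed" and \<Omega>=UNIV and A="\<lambda>_. UNIV"])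
  fix C :: "'a set" assume "C \<in> Collect closed"
  then have C: "closed C" by simp
  show "emeasure M1 C = emeasure M2 C"
  proof (cases "C = {}")
    case False
    have "(\<integral>\<^sup>+x. ennreal (max 0 (1 - real k * infdist x C)) \<partial>M1) = (\<integral>\<^sup>+x. ennreal (max 0 (1 - real k * infdist x C)) \<partial>M2)" for k
      by (intro eq continuous_intros) (auto simp: infdist_nonneg)
    then show ?thesis
      using closed_emeasure_limit[OF assms(1,2) C False] closed_emeasure_limit[OF assms(3,4) C False]
      by (simp add: LIMSEQ_unique)
  qed simp
next
  show "emeasure M1 UNIV \<noteq> \<infinity>"
    using finite_measure.emeasure_finite[OF assms(1), of UNIV] by simp
qed (use assms(2,4) in \<open>auto simp: Int_stable_closed sets_borel_closed\<close>)

context solution_family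
begin

text \<open>
  For fixed \<open>u\<close> the integral is a limit of Euler expectations, hence measurable in the state; for
  a fixed state it is right-continuous in \<open>u\<close>, because the paths are.
\<close>

lemma kernel_continuous_integral_measurable:
  assumes s: "s \<in> {0..T}" and g: "continuous_on UNIV g" "\<And>x. 0 \<le> g x" "\<And>x. g x \<le> (1::real)"
  shows "(\<lambda>(u, y). LINT x|kernel s (max s (min T u)) y. g x) \<in> borel_measurable (borel \<Otimes>\<^sub>M borel)"
proof -
  have gm [measurable]: "g \<in> borel_measurable borel" by (rule borel_measurable_continuous_onI[OF g(1)])
  have "(\<lambda>(u, y). (\<lambda>u y. LINT x|kernel s u y. g x) (max s (min T u)) y) \<in> borel_measurable (borel \<Otimes>\<^sub>M (borel :: state measure))"
  proof (rule jointly_measurable_right_continuous)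
    show "s \<le> T" using s by simp
  next
    fix u assume u: "u \<in> {s..T}"
    have "(\<lambda>y. \<integral>\<^sup>+x. ennreal (g x) \<partial>kernel s u y) \<in> borel_measurable borel"
      by (rule borel_measurable_LIMSEQ_order[OF euler_kernel_tendsto[OF s u g] euler_kernel_measurable[OF s u]]) simp
    moreover have "(LINT x|kernel s u y. g x) = enn2real (\<integral>\<^sup>+x. ennreal (g x) \<partial>kernel s u y)" for y
      by (rule integral_eq_nn_integral) (use g in auto)
    ultimately show "(\<lambda>y. LINT x|kernel s u y. g x) \<in> borel_measurable borel" by simp
  next
    fix u y assume u: "u \<in> {s..T}"
    interpret exploratory_solution m \<pi> s y "P s y" "F s y" "W s y" "N s y" "eta s y" "Y s y" by (rule solution_at[OF s])
    show "continuous (at u within {u..T}) (\<lambda>u. LINT x|kernel s u y. g x)"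
      unfolding continuous_within_sequentially
    proof (intro allI impI; elim conjE)
      fix r :: "nat \<Rightarrow> real" assume r: "\<forall>n. r n \<in> {u..T}" "r \<longlonglongrightarrow> u"
      have rs: "r n \<in> {s..T}" for n using r(1)[rule_format, of n] u by auto
      have "(\<lambda>n. LINT \<omega>|P s y. g (Y s y (r n) \<omega>)) \<longlonglongrightarrow> (LINT \<omega>|P s y. g (Y s y u \<omega>))"
      proof (rule integral_dominated_convergence[where w="\<lambda>_. 1"])
        show "(\<lambda>\<omega>. g (Y s y u \<omega>)) \<in> borel_measurable (P s y)" "(\<lambda>\<omega>. g (Y s y (r n) \<omega>)) \<in> borel_measurable (P s y)" for n
          using Y_measurable[OF u] Y_measurable[OF rs[of n]] by measurable
        show "AE \<omega> in P s y. (\<lambda>n. g (Y s y (r n) \<omega>)) \<longlonglongrightarrow> g (Y s y u \<omega>)"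
        proof (rule AE_I2)
          fix \<omega> assume \<omega>: "\<omega> \<in> space (P s y)"
          have "((\<lambda>r. Y s y r \<omega>) \<circ> r) \<longlonglongrightarrow> Y s y u \<omega>"
            by (rule Y_right_continuous[OF \<omega> u order_refl, unfolded continuous_within_sequentially, rule_format])
              (use r in auto)
          then show "(\<lambda>n. g (Y s y (r n) \<omega>)) \<longlonglongrightarrow> g (Y s y u \<omega>)"
            by (intro continuous_on_tendsto_compose[OF g(1)]) (auto simp: o_def)
        qed
        show "AE \<omega> in P s y. norm (g (Y s y (r n) \<omega>)) \<le> 1" for n using g by simp
      qed simp
      then show "((\<lambda>u. LINT x|kernel s u y. g x) \<circ> r) \<longlonglongrightarrow> (LINT x|kernel s u y. g x)"
        by (simp add: o_def integral_kernel[OF s u] integral_kernel[OF s rs])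
    qed
  qed
  then show ?thesis by simp
qed

text \<open>
  Fubini's theorem for the running reward needs measurability jointly in time and state. It suffices to
  check closed sets, whose mass is a limit of integrals of continuous functions.
\<close>

lemma kernel_measurable:
  assumes s: "s \<in> {0..T}"
  shows "(\<lambda>p. kernel s (max s (min T (fst p))) (snd p)) \<in> measurable (borel \<Otimes>\<^sub>M borel) (prob_algebra borel)"
proof (rule measurable_prob_algebra_generated[OF sets_borel_closed Int_stable_closed])
  have c: "max s (min T u) \<in> {s..T}" for u using s by auto
  show "prob_space (kernel s (max s (min T (fst p))) (snd p))" for p by (rule kernel_prob[OF s c])
  fix C :: "state set" assume "C \<in> Collect closed"
  then have C: "closed C" by simp
  show "(\<lambda>p. emeasure (kernel s (max s (min T (fst p))) (snd p)) C) \<in> borel_measurable (borel \<Otimes>\<^sub>M borel)"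
  proof (cases "C = {}")
    case False
    show ?thesis
    proof (rule borel_measurable_LIMSEQ_order)
      fix k
      define g where "g x = max 0 (1 - real k * infdist x C)" for x
      have g: "continuous_on UNIV g" "\<And>x. 0 \<le> g x" "\<And>x. g x \<le> 1"
        unfolding g_def[abs_def] by (intro continuous_intros) (auto simp: infdist_nonneg)
      have gm: "g \<in> borel_measurable borel" by (rule borel_measurable_continuous_onI[OF g(1)])
      have "(\<integral>\<^sup>+x. ennreal (g x) \<partial>kernel s (max s (min T (fst p))) (snd p)) = ennreal (LINT x|kernel s (max s (min T (fst p))) (snd p). g x)" for p
      proof -
        interpret K: prob_space "kernel s (max s (min T (fst p))) (snd p)" by (rule kernel_prob[OF s c])
        show ?thesis using g gm
          by (intro nn_integral_eq_integral K.integrable_const_bound[where B=1]) auto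
      qed
      then show "(\<lambda>p. \<integral>\<^sup>+x. ennreal (max 0 (1 - real k * infdist x C)) \<partial>kernel s (max s (min T (fst p))) (snd p)) \<in> borel_measurable (borel \<Otimes>\<^sub>M borel)"
        unfolding g_def[symmetric] using kernel_continuous_integral_measurable[OF s g] by (simp add: split_def)
    next
      fix p :: "real \<times> state"
      show "(\<lambda>k. \<integral>\<^sup>+x. ennreal (max 0 (1 - real k * infdist x C)) \<partial>kernel s (max s (min T (fst p))) (snd p))
          \<longlonglongrightarrow> emeasure (kernel s (max s (min T (fst p))) (snd p)) C"
        using kernel_prob[OF s c] by (intro closed_emeasure_limit C False) (auto simp: prob_space_def)
    qed
  qed simp
qed auto

lemma kernel_measurable_state:
  assumes s: "s \<in> {0..T}" and u: "u \<in> {s..T}"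
  shows "kernel s u \<in> measurable borel (subprob_algebra borel)"
proof -
  have "(\<lambda>y. kernel s (max s (min T (fst (u, y)))) (snd (u, y))) \<in> measurable borel (prob_algebra borel)"
    by (rule measurable_compose[OF _ kernel_measurable[OF s]]) simp
  then show ?thesis using u by (intro measurable_prob_algebraD) (simp add: max_absorb2 min_absorb2)
qed

text \<open>
  Both sides, as functions of \<open>g\<close>, are integrals with respect to finite measures that agree on
  continuous functions.
\<close>

lemma markov_nn_integral:
  assumes t: "t \<in> {0..T}" and su: "s \<in> {t..T}" "u \<in> {s..T}" and H: "H \<in> sets (F t y s)"
    and g: "g \<in> borel_measurable borel"
  shows "(\<integral>\<^sup>+\<omega>. indicator H \<omega> * g (Y t y u \<omega>) \<partial>P t y)
    = (\<integral>\<^sup>+\<omega>. indicator H \<omega> * (\<integral>\<^sup>+x. g x \<partial>kernel s u (Y t y s \<omega>)) \<partial>P t y)"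
proof -
  interpret exploratory_solution m \<pi> t y "P t y" "F t y" "W t y" "N t y" "eta t y" "Y t y" by (rule solution_at[OF t])
  have su': "s \<in> {0..T}" "u \<in> {s..T}" using su t by auto
  have HP [measurable]: "H \<in> sets (P t y)" using H subalg[of s] by (auto simp: subalgebra_def)
  have Yu [measurable]: "Y t y u \<in> borel_measurable (P t y)" using su t by (intro Y_measurable) auto
  note Ys [measurable] = Y_measurable[OF su(1)]
  note K = kernel_measurable_state[OF su']
  \<comment> \<open>Conditioning on \<open>H\<close> is expressed by the restriction of the probability measure to \<open>H\<close>.\<close>
  define M where "M = density (P t y) (indicator H)"
  have finM: "finite_measure M"
    by (rule finite_measureI) (simp add: M_def emeasure_density emeasure_eq_measure)
  have Ms: "sets M = sets (P t y)" "space M \<noteq> {}" using not_empty by (auto simp: M_def)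
  have KM: "(\<lambda>\<omega>. kernel s u (Y t y s \<omega>)) \<in> measurable M (subprob_algebra borel)"
    using measurable_compose[OF Ys K] by (simp add: measurable_cong_sets[OF Ms(1) refl])
  have YM: "Y t y u \<in> borel_measurable M" using Yu by (simp add: measurable_cong_sets[OF Ms(1) refl])
  have d: "(\<integral>\<^sup>+\<omega>. f \<omega> \<partial>M) = (\<integral>\<^sup>+\<omega>. indicator H \<omega> * f \<omega> \<partial>P t y)" if "f \<in> borel_measurable (P t y)" for f
    unfolding M_def using that by (subst nn_integral_density) auto
  have e1: "(\<integral>\<^sup>+x. f x \<partial>distr M borel (Y t y u)) = (\<integral>\<^sup>+\<omega>. indicator H \<omega> * f (Y t y u \<omega>) \<partial>P t y)"
    if f: "f \<in> borel_measurable borel" for f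
    using f YM by (subst nn_integral_distr) (auto intro!: d)
  have e2: "(\<integral>\<^sup>+x. f x \<partial>(M \<bind> (\<lambda>\<omega>. kernel s u (Y t y s \<omega>)))) = (\<integral>\<^sup>+\<omega>. indicator H \<omega> * (\<integral>\<^sup>+x. f x \<partial>kernel s u (Y t y s \<omega>)) \<partial>P t y)"
    if f: "f \<in> borel_measurable borel" for f
    unfolding nn_integral_bind[OF f KM]
    by (rule d) (rule measurable_compose[OF measurable_compose[OF Ys K] nn_integral_measurable_subprob_algebra[OF f]])
  have s2: "sets (M \<bind> (\<lambda>\<omega>. kernel s u (Y t y s \<omega>))) = sets borel" by (rule sets_bind) (use Ms in auto)
  have "distr M borel (Y t y u) = M \<bind> (\<lambda>\<omega>. kernel s u (Y t y s \<omega>))"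
  proof (rule measure_eqI_continuous)
    show "finite_measure (distr M borel (Y t y u))" by (rule finite_measure.finite_measure_distr[OF finM YM])
    have "emeasure (M \<bind> (\<lambda>\<omega>. kernel s u (Y t y s \<omega>))) UNIV = (\<integral>\<^sup>+\<omega>. emeasure (kernel s u (Y t y s \<omega>)) UNIV \<partial>M)"
      by (rule emeasure_bind[OF Ms(2) KM]) simp
    also have "\<dots> = (\<integral>\<^sup>+\<omega>. 1 \<partial>M)"
      using prob_space.emeasure_space_1[OF kernel_prob[OF su']] by (simp add: sets_eq_imp_space_eq[OF sets_kernel])
    also have "\<dots> < \<infinity>" using finite_measure.emeasure_finite[OF finM, of "space M"] by (simp add: top.not_eq_extremum)
    finally show "finite_measure (M \<bind> (\<lambda>\<omega>. kernel s u (Y t y s \<omega>)))"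
      by (intro finite_measureI) (simp add: sets_eq_imp_space_eq[OF s2])
    fix f :: "state \<Rightarrow> real" assume f: "continuous_on UNIV f" "\<And>x. 0 \<le> f x" "\<And>x. f x \<le> 1"
    have "f \<in> borel_measurable borel" by (rule borel_measurable_continuous_onI[OF f(1)])
    then show "(\<integral>\<^sup>+x. ennreal (f x) \<partial>distr M borel (Y t y u)) = (\<integral>\<^sup>+x. ennreal (f x) \<partial>(M \<bind> (\<lambda>\<omega>. kernel s u (Y t y s \<omega>))))"
      using markov_continuous[OF t su H f] by (simp add: e1 e2)
  qed (use s2 in auto)
  then show ?thesis using e1[OF g] e2[OF g] by simp
qed

lemma solution_moment:
  assumes q: "0 < q"
  shows "\<exists>K\<ge>0. \<forall>s\<in>{0..T}. \<forall>u\<in>{s..T}. \<forall>y.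
    (\<integral>\<^sup>+\<omega>. ennreal (norm (Y s y u \<omega>) ^ (2 * q)) \<partial>P s y) \<le> ennreal (K * (1 + norm y ^ (2 * q)))"
proof -
  obtain K where K: "K \<ge> 0" "\<And>(P :: 'w measure) F W N eta s u n y. noise m P F W N eta \<Longrightarrow> 0 \<le> s \<Longrightarrow> s \<le> u \<Longrightarrow> u \<le> T \<Longrightarrow>
    (\<integral>\<^sup>+\<omega>. ennreal (norm (euler_end s u n y (\<lambda>k. shock m W N eta (grid s u n k) (grid s u n (Suc k)) \<omega>)) ^ (2 * q)) \<partial>P)
      \<le> ennreal (K * (1 + norm y ^ (2 * q)))"
    using euler_moment_bound[OF q] by blast
  have "(\<integral>\<^sup>+\<omega>. ennreal (norm (Y s y u \<omega>) ^ (2 * q)) \<partial>P s y) \<le> ennreal (K * (1 + norm y ^ (2 * q)))"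
    if su: "s \<in> {0..T}" "u \<in> {s..T}" for s u y
  proof -
    interpret exploratory_solution m \<pi> s y "P s y" "F s y" "W s y" "N s y" "eta s y" "Y s y" by (rule solution_at[OF su(1)])
    define E where "E n \<omega> = euler_end s u n y (dZ s u n \<omega>)" for n \<omega>
    have Em [measurable]: "E n \<in> borel_measurable (P s y)" for n
      unfolding E_def using su by (intro euler_end_shocks_measurable borel_measurable_const) auto
    have "(\<integral>\<^sup>+\<omega>. ennreal (norm (Y s y u \<omega>) ^ (2 * q)) \<partial>P s y) = (\<integral>\<^sup>+\<omega>. liminf (\<lambda>n. ennreal (norm (E n \<omega>) ^ (2 * q))) \<partial>P s y)"
    proof (rule nn_integral_cong_AE)
      show "AE \<omega> in P s y. ennreal (norm (Y s y u \<omega>) ^ (2 * q)) = liminf (\<lambda>n. ennreal (norm (E n \<omega>) ^ (2 * q)))"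
        using euler_end_tendsto_initial[OF su(2)]
      proof eventually_elim
        fix \<omega> assume "(\<lambda>n. euler_end s u n y (dZ s u n \<omega>)) \<longlonglongrightarrow> Y s y u \<omega>"
        then have "(\<lambda>n. ennreal (norm (E n \<omega>) ^ (2 * q))) \<longlonglongrightarrow> ennreal (norm (Y s y u \<omega>) ^ (2 * q))"
          unfolding E_def[symmetric] by (intro tendsto_ennrealI tendsto_intros)
        then show "ennreal (norm (Y s y u \<omega>) ^ (2 * q)) = liminf (\<lambda>n. ennreal (norm (E n \<omega>) ^ (2 * q)))"
          by (rule lim_imp_Liminf[OF trivial_limit_sequentially, symmetric])
      qed
    qed
    also have "\<dots> \<le> liminf (\<lambda>n. \<integral>\<^sup>+\<omega>. ennreal (norm (E n \<omega>) ^ (2 * q)) \<partial>P s y)"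
      by (rule nn_integral_liminf) simp
    also have "\<dots> \<le> liminf (\<lambda>n. ennreal (K * (1 + norm y ^ (2 * q))))"
      unfolding E_def using su by (intro Liminf_mono always_eventually allI K(2)[OF noise_axioms]) auto
    also have "\<dots> = ennreal (K * (1 + norm y ^ (2 * q)))" by (rule Liminf_const) simp
    finally show ?thesis .
  qed
  then show ?thesis using K(1) by blast
qed

lemma growth_moment:
  assumes q: "0 < q"
  shows "\<exists>K\<ge>0. \<forall>s\<in>{0..T}. \<forall>u\<in>{s..T}. \<forall>y C h. 0 \<le> C \<longrightarrow> (\<forall>x. \<bar>h x\<bar> \<le> C * (1 + norm x ^ (2 * q))) \<longrightarrow>
    (\<integral>\<^sup>+\<omega>. ennreal \<bar>h (Y s y u \<omega>)\<bar> \<partial>P s y) \<le> ennreal (C * K * (1 + norm y ^ (2 * q)))"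
proof -
  obtain K where K: "K \<ge> 0" "\<And>s u y. s \<in> {0..T} \<Longrightarrow> u \<in> {s..T} \<Longrightarrow>
    (\<integral>\<^sup>+\<omega>. ennreal (norm (Y s y u \<omega>) ^ (2 * q)) \<partial>P s y) \<le> ennreal (K * (1 + norm y ^ (2 * q)))"
    using solution_moment[OF q] by blast
  have "(\<integral>\<^sup>+\<omega>. ennreal \<bar>h (Y s y u \<omega>)\<bar> \<partial>P s y) \<le> ennreal (C * (1 + K) * (1 + norm y ^ (2 * q)))"
    if su: "s \<in> {0..T}" "u \<in> {s..T}" and C: "0 \<le> C" and h: "\<And>x. \<bar>h x\<bar> \<le> C * (1 + norm x ^ (2 * q))" for s u y C h
  proof -
    interpret exploratory_solution m \<pi> s y "P s y" "F s y" "W s y" "N s y" "eta s y" "Y s y" by (rule solution_at[OF su(1)])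
    note [measurable] = Y_measurable[OF su(2)]
    have "(\<integral>\<^sup>+\<omega>. ennreal \<bar>h (Y s y u \<omega>)\<bar> \<partial>P s y) \<le> (\<integral>\<^sup>+\<omega>. ennreal C * (1 + ennreal (norm (Y s y u \<omega>) ^ (2 * q))) \<partial>P s y)"
    proof (rule nn_integral_mono)
      fix \<omega>
      have "ennreal \<bar>h (Y s y u \<omega>)\<bar> \<le> ennreal (C * (1 + norm (Y s y u \<omega>) ^ (2 * q)))" by (intro ennreal_leI h)
      also have "\<dots> = ennreal C * (1 + ennreal (norm (Y s y u \<omega>) ^ (2 * q)))"
        using C by (subst ennreal_mult) (auto simp flip: ennreal_1)
      finally show "ennreal \<bar>h (Y s y u \<omega>)\<bar> \<le> ennreal C * (1 + ennreal (norm (Y s y u \<omega>) ^ (2 * q)))" .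
    qed
    also have "\<dots> = ennreal C * (1 + (\<integral>\<^sup>+\<omega>. ennreal (norm (Y s y u \<omega>) ^ (2 * q)) \<partial>P s y))"
      by (simp add: nn_integral_cmult nn_integral_add emeasure_space_1)
    also have "\<dots> \<le> ennreal C * (1 + ennreal (K * (1 + norm y ^ (2 * q))))"
      by (intro mult_left_mono add_left_mono K su) auto
    also have "\<dots> = ennreal (C * (1 + K * (1 + norm y ^ (2 * q))))"
      using C K by (subst ennreal_mult) (auto simp flip: ennreal_1 simp: ennreal_plus)
    also have "\<dots> \<le> ennreal (C * (1 + K) * (1 + norm y ^ (2 * q)))"
    proof (rule ennreal_leI)
      have "0 \<le> C * norm y ^ (2 * q)" using C by simp
      then show "C * (1 + K * (1 + norm y ^ (2 * q))) \<le> C * (1 + K) * (1 + norm y ^ (2 * q))" by (simp add: algebra_simps)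
    qed
    finally show ?thesis .
  qed
  then show ?thesis using K(1) by (intro exI[of _ "1 + K"]) auto
qed

end

section \<open>Rewards and the value function\<close>

text \<open>
  A bound on the expectations that is uniform in time makes the product integral finite.
\<close>

lemma integral_swap_interval:
  fixes f :: "real \<Rightarrow> 'w \<Rightarrow> real"
  assumes P: "prob_space P" and sT: "s \<le> T"
    and meas: "(\<lambda>(u, \<omega>). f (max s (min T u)) \<omega>) \<in> borel_measurable (borel \<Otimes>\<^sub>M P)"
    and bound: "\<And>u. u \<in> {s..T} \<Longrightarrow> (\<integral>\<^sup>+\<omega>. ennreal \<bar>f u \<omega>\<bar> \<partial>P) \<le> ennreal B"
  shows "integrable P (\<lambda>\<omega>. LINT u:{s..T}|lborel. f u \<omega>)"
    and "(LINT \<omega>|P. (LINT u:{s..T}|lborel. f u \<omega>)) = (LINT u:{s..T}|lborel. (LINT \<omega>|P. f u \<omega>))"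
    and "AE \<omega> in P. set_integrable lborel {s..T} (\<lambda>u. f u \<omega>)"
proof -
  interpret prob_space P by (rule P)
  interpret pair_sigma_finite lborel P ..
  define g where "g = (\<lambda>u \<omega>. indicator {s..T} u *\<^sub>R f (max s (min T u)) \<omega>)"
  have g: "g u \<omega> = indicator {s..T} u *\<^sub>R f u \<omega>" for u \<omega>
    by (auto simp: g_def indicator_def max_absorb2 min_absorb2)
  have gm: "case_prod g \<in> borel_measurable (lborel \<Otimes>\<^sub>M P)"
    using meas unfolding g_def split_def by measurable
  have "integrable (lborel \<Otimes>\<^sub>M P) (case_prod g)"
  proof (rule integrableI_bounded[OF gm])
    have "(\<integral>\<^sup>+p. ennreal (norm (case_prod g p)) \<partial>(lborel \<Otimes>\<^sub>M P)) = (\<integral>\<^sup>+u. \<integral>\<^sup>+\<omega>. ennreal \<bar>g u \<omega>\<bar> \<partial>P \<partial>lborel)"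
      using sigma_finite_measure.nn_integral_fst[OF prob_space_imp_sigma_finite[OF P], of "\<lambda>p. ennreal (norm (case_prod g p))" lborel] gm
      by simp
    also have "\<dots> \<le> (\<integral>\<^sup>+u. ennreal B * indicator {s..T} u \<partial>lborel)"
    proof (rule nn_integral_mono)
      fix u show "(\<integral>\<^sup>+\<omega>. ennreal \<bar>g u \<omega>\<bar> \<partial>P) \<le> ennreal B * indicator {s..T} u"
        unfolding g using bound[of u] by (cases "u \<in> {s..T}") auto
    qed
    also have "\<dots> = ennreal B * emeasure lborel {s..T}" by (subst nn_integral_cmult_indicator) auto
    also have "\<dots> < \<infinity>" using sT by (simp add: ennreal_mult_less_top)
    finally show "(\<integral>\<^sup>+p. ennreal (norm (case_prod g p)) \<partial>(lborel \<Otimes>\<^sub>M P)) < \<infinity>" .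
  qed
  note * = integrable_snd[OF this] Fubini_integral[OF this] AE_integrable_snd[OF this]
  show "integrable P (\<lambda>\<omega>. LINT u:{s..T}|lborel. f u \<omega>)"
    using *(1) by (simp add: g set_lebesgue_integral_def)
  show "(LINT \<omega>|P. (LINT u:{s..T}|lborel. f u \<omega>)) = (LINT u:{s..T}|lborel. (LINT \<omega>|P. f u \<omega>))"
    using *(2) by (simp add: g set_lebesgue_integral_def)
  show "AE \<omega> in P. set_integrable lborel {s..T} (\<lambda>u. f u \<omega>)"
    using *(3) by (simp add: g set_integrable_def)
qed

lemma integral_measurable_kernel:
  fixes f :: "'a \<Rightarrow> 'b \<Rightarrow> real"
  assumes f[measurable]: "(\<lambda>(x, y). f x y) \<in> borel_measurable (M \<Otimes>\<^sub>M N)"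
    and L[measurable]: "L \<in> measurable M (subprob_algebra N)"
  shows "(\<lambda>x. integral\<^sup>L (L x) (f x)) \<in> borel_measurable M"
proof -
  note integral_measurable_subprob_algebra[measurable] measurable_distr2[measurable]
  have "(\<lambda>x. integral\<^sup>L (distr (L x) (M \<Otimes>\<^sub>M N) (\<lambda>y. (x, y))) (\<lambda>(x, y). f x y)) \<in> borel_measurable M"
    by measurable
  then show ?thesis
  proof (rule measurable_cong[THEN iffD1, rotated])
    fix x assume x: "x \<in> space M"
    have [measurable_cong]: "sets (L x) = sets N" by (rule sets_kernel[OF L x])
    show "integral\<^sup>L (distr (L x) (M \<Otimes>\<^sub>M N) (\<lambda>y. (x, y))) (\<lambda>(x, y). f x y) = integral\<^sup>L (L x) (f x)"
      using x by (subst integral_distr) auto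
  qed
qed

text \<open>
  Growth bounds with real exponents are replaced by even powers, for which the moments of the noise are
  computed.
\<close>

lemma powr_le_even_power:
  fixes x :: real
  assumes "0 \<le> x" "1 \<le> p" "p \<le> real (2 * q)"
  shows "1 + x powr p \<le> 2 * (1 + x ^ (2 * q))"
proof (cases "x \<le> 1")
  case True
  then have "x powr p \<le> 1" using assms by (intro powr_le1) auto
  then have "1 + x powr p \<le> 2 * (1 + 0)" by simp
  also have "\<dots> \<le> 2 * (1 + x ^ (2 * q))"
    using assms(1) by (intro mult_left_mono add_left_mono) auto
  finally show ?thesis .
next
  case False
  then have "x powr p \<le> x powr real (2 * q)" using assms by (intro powr_mono) auto
  also have "\<dots> = x ^ (2 * q)" using False by (intro powr_realpow) auto
  finally have "1 + x powr p \<le> 1 * (1 + x ^ (2 * q))" by simp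
  also have "\<dots> \<le> 2 * (1 + x ^ (2 * q))" using assms(1) by (intro mult_right_mono) auto
  finally show ?thesis .
qed

context exploratory_model
begin

abbreviation "R \<equiv> entropic_reward m \<pi>"
abbreviation "f \<equiv> terminal_reward m"

lemma terminal_reward_measurable [measurable]: "f \<in> borel_measurable borel"
proof -
  have "f = (\<lambda>y. fst (snd y) + fst (snd (snd y)) * (fst y - term_penalty m * fst (snd (snd y))))"
    by (auto simp: fun_eq_iff)
  moreover have "continuous_on UNIV \<dots>" by (intro continuous_intros)
  ultimately show ?thesis by (simp add: borel_measurable_continuous_onI)
qed

lemma reward_eq: "reward m y v = - run_penalty m * (v - tracking m * snd (snd (snd y)))\<^sup>2"
  by (cases y) simp

text \<open>
  The entropic reward is bounded by the integral that admissibility controls. One exponent is chosen for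
  running and terminal reward.
\<close>

lemma rewards_growth:
  "\<exists>C q. 0 \<le> C \<and> 0 < q \<and> (\<forall>u\<in>{0..T}. \<forall>x. \<bar>R u x\<bar> \<le> C * (1 + norm x ^ (2 * q))) \<and>
     (\<forall>x. \<bar>f x\<bar> \<le> C * (1 + norm x ^ (2 * q)))"
proof -
  have "\<exists>C>0. \<exists>p\<ge>1. \<forall>y. \<bar>f y\<bar> \<le> C * (1 + norm y powr p)"
    using standing unfolding standing_assumptions_def by (elim conjE)
  then obtain C1 p1 where C1: "C1 > 0" "p1 \<ge> 1" "\<And>y. \<bar>f y\<bar> \<le> C1 * (1 + norm y powr p1)" by blast
  have "\<exists>C>0. \<exists>p\<ge>1. \<forall>t\<in>{0..T}. \<forall>S x q \<mu>.
        let g = (\<lambda>v. \<bar>run_penalty m * (v - tracking m * \<mu>)\<^sup>2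
                     + temperature m * ln (\<pi> v t (S, x, q, \<mu>))\<bar> * \<pi> v t (S, x, q, \<mu>)) in
        set_integrable lborel A g \<and>
        (LINT v:A|lborel. g v) \<le> C * (1 + norm (S, x, q, \<mu>) powr p)"
    using admissible unfolding admissible_def by (elim conjE)
  then obtain C2 p2 where C2: "C2 > 0" "p2 \<ge> 1" and C2': "\<And>t S x q \<mu>. t \<in> {0..T} \<Longrightarrow>
        (LINT v:A|lborel. \<bar>run_penalty m * (v - tracking m * \<mu>)\<^sup>2
                     + temperature m * ln (\<pi> v t (S, x, q, \<mu>))\<bar> * \<pi> v t (S, x, q, \<mu>)) \<le> C2 * (1 + norm (S, x, q, \<mu>) powr p2)"
    unfolding Let_def by blast
  have R: "\<bar>R t y\<bar> \<le> C2 * (1 + norm y powr p2)" if t: "t \<in> {0..T}" for t y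
  proof (cases y)
    case (fields S x q \<mu>)
    have "\<bar>R t y\<bar> \<le> (LINT v|lborel. norm (indicator A v *\<^sub>R ((reward m y v - temperature m * ln (\<pi> v t y)) * \<pi> v t y)))"
      unfolding entropic_reward_def set_lebesgue_integral_def real_norm_def[symmetric] by (rule integral_norm_bound)
    also have "\<dots> = (LINT v:A|lborel. \<bar>run_penalty m * (v - tracking m * \<mu>)\<^sup>2
                     + temperature m * ln (\<pi> v t (S, x, q, \<mu>))\<bar> * \<pi> v t (S, x, q, \<mu>))"
      unfolding set_lebesgue_integral_def
    proof (rule Bochner_Integration.integral_cong[OF refl])
      fix v show "norm (indicator A v *\<^sub>R ((reward m y v - temperature m * ln (\<pi> v t y)) * \<pi> v t y)) =
         indicator A v *\<^sub>R (\<bar>run_penalty m * (v - tracking m * \<mu>)\<^sup>2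
                     + temperature m * ln (\<pi> v t (S, x, q, \<mu>))\<bar> * \<pi> v t (S, x, q, \<mu>))"
        using density(1)[OF t, of v y] by (cases "v \<in> A") (auto simp: fields abs_mult)
    qed
    also have "\<dots> \<le> C2 * (1 + norm y powr p2)" unfolding fields by (rule C2'[OF t])
    finally show ?thesis .
  qed
  define q where "q = nat \<lceil>max p1 p2\<rceil>"
  have q: "p1 \<le> real (2 * q)" "p2 \<le> real (2 * q)" "0 < q"
    using C1(2) C2(2) by (auto simp: q_def) linarith+
  define C where "C = 2 * (C1 + C2)"
  have b: "c * (1 + norm y powr p) \<le> C * (1 + norm y ^ (2 * q))"
    if "0 < c" "c \<le> C1 + C2" "1 \<le> p" "p \<le> real (2 * q)" for c p and y :: state
  proof -
    have "1 + norm y powr p \<le> 2 * (1 + norm y ^ (2 * q))"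
      by (rule powr_le_even_power[OF norm_ge_zero that(3,4)])
    then have "c * (1 + norm y powr p) \<le> (C1 + C2) * (2 * (1 + norm y ^ (2 * q)))"
      using that C1 C2 by (intro mult_mono) auto
    then show ?thesis by (simp add: C_def algebra_simps)
  qed
  have "\<bar>R u x\<bar> \<le> C * (1 + norm x ^ (2 * q))" if "u \<in> {0..T}" for u x
    by (rule order_trans[OF R[OF that] b]) (use C1 C2 q in auto)
  moreover have "\<bar>f x\<bar> \<le> C * (1 + norm x ^ (2 * q))" for x
    by (rule order_trans[OF C1(3) b]) (use C1 C2 q in auto)
  moreover have "0 \<le> C" using C1 C2 by (simp add: C_def)
  ultimately show ?thesis using q(3) by blast
qed

text \<open>
  Outside the action space the density is replaced by \<open>0\<close>, where the integrand vanishes as well.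
\<close>

lemma entropic_reward_measurable:
  "(\<lambda>(u, y). R (max 0 (min T u)) y) \<in> borel_measurable (borel \<Otimes>\<^sub>M borel)"
proof -
  have A: "A \<in> sets borel" using valid by (simp add: valid_model_def)
  let ?D = "A \<times> {0..T} \<times> (UNIV :: state set)"
  have D: "?D \<in> sets borel"
  proof -
    have "(fst :: real \<times> real \<times> state \<Rightarrow> real) -` A \<inter> space borel \<in> sets borel"
      using A by (intro measurable_sets[OF borel_measurable_continuous_onI] continuous_intros)
    moreover have "(\<lambda>p :: real \<times> real \<times> state. fst (snd p)) -` {0..T} \<inter> space borel \<in> sets borel"
      by (intro measurable_sets[OF borel_measurable_continuous_onI] continuous_intros) auto
    moreover have "?D = (fst -` A \<inter> space borel) \<inter> ((\<lambda>p. fst (snd p)) -` {0..T} \<inter> space borel)" by auto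
    ultimately show ?thesis by (simp only: sets.Int)
  qed
  define g where "g p = indicator ?D p *\<^sub>R (case p of (v, t, y) \<Rightarrow> \<pi> v t y)" for p
  have "(\<lambda>(v, t, y). \<pi> v t y) \<in> borel_measurable (restrict_space borel ?D)"
    using admissible unfolding admissible_def by (elim conjE)
  then have g: "g \<in> borel_measurable borel"
    unfolding g_def[abs_def] using D by (subst (asm) borel_measurable_restrict_space_iff) auto
  define h where "h p v = (v, max 0 (min T (fst p)), snd p)" for p :: "real \<times> state" and v :: real
  have h: "case_prod h \<in> borel_measurable ((borel \<Otimes>\<^sub>M borel) \<Otimes>\<^sub>M lborel)"
    unfolding h_def split_def by (intro borel_measurable_Pair) measurable
  have gh [measurable]: "(\<lambda>q. g (h (fst q) (snd q))) \<in> borel_measurable ((borel \<Otimes>\<^sub>M borel) \<Otimes>\<^sub>M lborel)"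
    using measurable_compose[OF h g] by (simp add: split_def)
  have [measurable]: "(\<lambda>y :: state. snd (snd (snd y))) \<in> borel_measurable borel"
    by (intro borel_measurable_continuous_onI continuous_intros)
  define k where "k p v = (reward m (snd p) v - temperature m * ln (g (h p v))) * g (h p v)" for p v
  have "case_prod k \<in> borel_measurable ((borel \<Otimes>\<^sub>M borel) \<Otimes>\<^sub>M lborel)"
    unfolding k_def split_def reward_eq by measurable
  then have "(\<lambda>p. LINT v|lborel. k p v) \<in> borel_measurable (borel \<Otimes>\<^sub>M borel)"
    by (rule lborel.borel_measurable_lebesgue_integral)
  moreover have "(LINT v|lborel. k p v) = R (max 0 (min T (fst p))) (snd p)" for p
    unfolding entropic_reward_def set_lebesgue_integral_def
  proof (rule Bochner_Integration.integral_cong[OF refl])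
    fix v
    have "max 0 (min T (fst p)) \<in> {0..T}" using T_pos by auto
    then have "g (h p v) = indicator A v * \<pi> v (max 0 (min T (fst p))) (snd p)"
      by (auto simp: g_def h_def indicator_def)
    then show "k p v = indicator A v *\<^sub>R ((reward m (snd p) v - temperature m * ln (\<pi> v (max 0 (min T (fst p))) (snd p))) * \<pi> v (max 0 (min T (fst p))) (snd p))"
      unfolding k_def by (cases "v \<in> A") auto
  qed
  ultimately show ?thesis by (simp add: split_def)
qed

lemma entropic_reward_measurable_state: "u \<in> {0..T} \<Longrightarrow> R u \<in> borel_measurable borel"
  using measurable_compose[OF measurable_Pair1'[of u borel borel] entropic_reward_measurable]
  by (simp add: max_absorb2 min_absorb2)

end

context solution_family
begin

lemma growth_integrable:
  fixes h :: "state \<Rightarrow> real"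
  assumes q: "0 < q" and C: "0 \<le> C" "\<And>x. \<bar>h x\<bar> \<le> C * (1 + norm x ^ (2 * q))" and h: "h \<in> borel_measurable borel"
    and su: "s \<in> {0..T}" "u \<in> {s..T}"
  shows "integrable (P s y) (\<lambda>\<omega>. h (Y s y u \<omega>))" "integrable (kernel s u y) h"
proof -
  interpret exploratory_solution m \<pi> s y "P s y" "F s y" "W s y" "N s y" "eta s y" "Y s y" by (rule solution_at[OF su(1)])
  obtain K where "(\<integral>\<^sup>+\<omega>. ennreal \<bar>h (Y s y u \<omega>)\<bar> \<partial>P s y) \<le> ennreal (C * K * (1 + norm y ^ (2 * q)))"
    using growth_moment[OF q] C su by blast
  note Ym = Y_measurable[OF su(2)]
  show i: "integrable (P s y) (\<lambda>\<omega>. h (Y s y u \<omega>))"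
    using \<open>(\<integral>\<^sup>+\<omega>. ennreal \<bar>h (Y s y u \<omega>)\<bar> \<partial>P s y) \<le> _\<close> measurable_compose[OF Ym h]
    by (intro integrableI_bounded) (auto intro: le_less_trans)
  then show "integrable (kernel s u y) h" unfolding kernel_def using Ym h by (subst integrable_distr_eq) auto
qed

text \<open>
  Integration against the transition law keeps polynomial growth of a given order. So conditional
  expectations can again be evaluated along a solution.
\<close>

lemma kernel_growth:
  assumes q: "0 < q"
  shows "\<exists>K\<ge>0. \<forall>s\<in>{0..T}. \<forall>u\<in>{s..T}. \<forall>y C h. 0 \<le> C \<longrightarrow> h \<in> borel_measurable borel \<longrightarrow>
    (\<forall>x. \<bar>h x\<bar> \<le> C * (1 + norm x ^ (2 * q))) \<longrightarrow>
    \<bar>LINT x|kernel s u y. h x\<bar> \<le> C * K * (1 + norm y ^ (2 * q))"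
proof -
  obtain K where K: "K \<ge> 0" "\<And>s u y C h. s \<in> {0..T} \<Longrightarrow> u \<in> {s..T} \<Longrightarrow> 0 \<le> C \<Longrightarrow> (\<And>x. \<bar>h x\<bar> \<le> C * (1 + norm x ^ (2 * q))) \<Longrightarrow>
    (\<integral>\<^sup>+\<omega>. ennreal \<bar>h (Y s y u \<omega>)\<bar> \<partial>P s y) \<le> ennreal (C * K * (1 + norm y ^ (2 * q)))"
    using growth_moment[OF q] by blast
  have "\<bar>LINT x|kernel s u y. h x\<bar> \<le> C * K * (1 + norm y ^ (2 * q))"
    if su: "s \<in> {0..T}" "u \<in> {s..T}" and C: "0 \<le> C" and h: "h \<in> borel_measurable borel" "\<And>x. \<bar>h x\<bar> \<le> C * (1 + norm x ^ (2 * q))"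
    for s u y C h
  proof -
    have i: "integrable (P s y) (\<lambda>\<omega>. h (Y s y u \<omega>))" by (rule growth_integrable(1)[OF q C h(2,1) su])
    have le: "\<bar>LINT x|kernel s u y. h x\<bar> \<le> (LINT \<omega>|P s y. \<bar>h (Y s y u \<omega>)\<bar>)"
      unfolding integral_kernel[OF su h(1)] by (rule integral_abs_bound)
    have "ennreal (LINT \<omega>|P s y. \<bar>h (Y s y u \<omega>)\<bar>) = (\<integral>\<^sup>+\<omega>. ennreal \<bar>h (Y s y u \<omega>)\<bar> \<partial>P s y)"
      by (rule nn_integral_eq_integral[symmetric]) (use i in auto)
    also have "\<dots> \<le> ennreal (C * K * (1 + norm y ^ (2 * q)))" by (rule K(2)[OF su C h(2)])
    finally have "(LINT \<omega>|P s y. \<bar>h (Y s y u \<omega>)\<bar>) \<le> C * K * (1 + norm y ^ (2 * q))"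
      using C K(1) by (subst (asm) ennreal_le_iff) auto
    with le show ?thesis by linarith
  qed
  then show ?thesis using K(1) by blast
qed

lemma markov_integral_nonneg:
  fixes h :: "state \<Rightarrow> real"
  assumes t: "t \<in> {0..T}" and su: "s \<in> {t..T}" "u \<in> {s..T}" and H: "H \<in> sets (F t y s)"
    and h: "h \<in> borel_measurable borel" "\<And>x. 0 \<le> h x" and i: "\<And>y. integrable (kernel s u y) h"
  shows "(LINT \<omega>|P t y. indicator H \<omega> * h (Y t y u \<omega>)) = (LINT \<omega>|P t y. indicator H \<omega> * (LINT x|kernel s u (Y t y s \<omega>). h x))"
proof -
  interpret exploratory_solution m \<pi> t y "P t y" "F t y" "W t y" "N t y" "eta t y" "Y t y" by (rule solution_at[OF t])
  have su': "s \<in> {0..T}" "u \<in> {s..T}" using su t by auto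
  have HP [measurable]: "H \<in> sets (P t y)" using H subalg[of s] by (auto simp: subalgebra_def)
  have Yu: "Y t y u \<in> borel_measurable (P t y)" using su t by (intro Y_measurable) auto
  note Ys = Y_measurable[OF su(1)]
  have hY: "(\<lambda>\<omega>. h (Y t y u \<omega>)) \<in> borel_measurable (P t y)" by (rule measurable_compose[OF Yu h(1)])
  have kY: "(\<lambda>\<omega>. LINT x|kernel s u (Y t y s \<omega>). h x) \<in> borel_measurable (P t y)"
    by (rule measurable_compose[OF measurable_compose[OF Ys kernel_measurable_state[OF su']] integral_measurable_subprob_algebra[OF h(1)]])
  have "(LINT \<omega>|P t y. indicator H \<omega> * h (Y t y u \<omega>)) = enn2real (\<integral>\<^sup>+\<omega>. ennreal (indicator H \<omega> * h (Y t y u \<omega>)) \<partial>P t y)"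
    using h hY by (intro integral_eq_nn_integral) (auto simp: )
  also have "(\<integral>\<^sup>+\<omega>. ennreal (indicator H \<omega> * h (Y t y u \<omega>)) \<partial>P t y) = (\<integral>\<^sup>+\<omega>. indicator H \<omega> * ennreal (h (Y t y u \<omega>)) \<partial>P t y)"
    by (intro nn_integral_cong) (simp add: indicator_def)
  also have "\<dots> = (\<integral>\<^sup>+\<omega>. indicator H \<omega> * (\<integral>\<^sup>+x. ennreal (h x) \<partial>kernel s u (Y t y s \<omega>)) \<partial>P t y)"
    using h(1) by (intro markov_nn_integral[OF t su H]) simp
  also have "\<dots> = (\<integral>\<^sup>+\<omega>. ennreal (indicator H \<omega> * (LINT x|kernel s u (Y t y s \<omega>). h x)) \<partial>P t y)"
    using h by (intro nn_integral_cong) (simp add: indicator_def nn_integral_eq_integral[OF i])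
  also have "enn2real \<dots> = (LINT \<omega>|P t y. indicator H \<omega> * (LINT x|kernel s u (Y t y s \<omega>). h x))"
    using h kY by (intro integral_eq_nn_integral[symmetric]) (auto intro!: AE_I2 mult_nonneg_nonneg Bochner_Integration.integral_nonneg)
  finally show ?thesis .
qed

text \<open>
  The nonnegative case applied to positive and negative part; the growth bound makes all integrals
  finite.
\<close>

lemma markov_integral:
  fixes h :: "state \<Rightarrow> real"
  assumes t: "t \<in> {0..T}" and su: "s \<in> {t..T}" "u \<in> {s..T}" and H: "H \<in> sets (F t y s)"
    and h: "h \<in> borel_measurable borel" and q: "0 < q" and C: "0 \<le> C" "\<And>x. \<bar>h x\<bar> \<le> C * (1 + norm x ^ (2 * q))"
  shows "(LINT \<omega>|P t y. indicator H \<omega> * h (Y t y u \<omega>)) = (LINT \<omega>|P t y. indicator H \<omega> * (LINT x|kernel s u (Y t y s \<omega>). h x))"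
proof -
  interpret exploratory_solution m \<pi> t y "P t y" "F t y" "W t y" "N t y" "eta t y" "Y t y" by (rule solution_at[OF t])
  have su': "s \<in> {0..T}" "u \<in> {s..T}" and ut: "u \<in> {t..T}" using su t by auto
  have HP [measurable]: "H \<in> sets (P t y)" using H subalg[of s] by (auto simp: subalgebra_def)
  obtain K where K: "K \<ge> 0" "\<And>s u y C h. s \<in> {0..T} \<Longrightarrow> u \<in> {s..T} \<Longrightarrow> 0 \<le> C \<Longrightarrow> h \<in> borel_measurable borel \<Longrightarrow>
    (\<And>x. \<bar>h x\<bar> \<le> C * (1 + norm x ^ (2 * q))) \<Longrightarrow> \<bar>LINT x|kernel s u y. h x\<bar> \<le> C * K * (1 + norm y ^ (2 * q))"
    using kernel_growth[OF q] by blast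
  \<comment> \<open>Both parts obey the growth bound of \<open>h\<close>.\<close>
  define hp where "hp x = max 0 (h x)" for x
  define hn where "hn x = max 0 (- h x)" for x
  have hpn: "h x = hp x - hn x" for x by (simp add: hp_def hn_def)
  have m: "hp \<in> borel_measurable borel" "hn \<in> borel_measurable borel" using h by (auto simp: hp_def[abs_def] hn_def[abs_def])
  have b: "\<bar>hp x\<bar> \<le> C * (1 + norm x ^ (2 * q))" "\<bar>hn x\<bar> \<le> C * (1 + norm x ^ (2 * q))" for x
    using C(2)[of x] by (auto simp: hp_def hn_def)
  note iK = growth_integrable(2)[OF q C(1) b(1) m(1) su'] growth_integrable(2)[OF q C(1) b(2) m(2) su']
  have iY: "integrable (P t y) (\<lambda>\<omega>. indicator H \<omega> * hp (Y t y u \<omega>))" "integrable (P t y) (\<lambda>\<omega>. indicator H \<omega> * hn (Y t y u \<omega>))"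
    using integrable_mult_indicator[OF HP growth_integrable(1)[OF q C(1) b(1) m(1) t ut]]
      integrable_mult_indicator[OF HP growth_integrable(1)[OF q C(1) b(2) m(2) t ut]] by auto
  have kI: "integrable (P t y) (\<lambda>\<omega>. indicator H \<omega> * (LINT x|kernel s u (Y t y s \<omega>). k x))"
    if k: "k \<in> borel_measurable borel" "\<And>x. \<bar>k x\<bar> \<le> C * (1 + norm x ^ (2 * q))" for k
  proof -
    have "integrable (P t y) (\<lambda>\<omega>. LINT x|kernel s u (Y t y s \<omega>). k x)"
    proof (rule growth_integrable(1)[OF q _ _ _ t su(1)])
      show "0 \<le> C * K" using C K by simp
      show "\<bar>LINT x|kernel s u y'. k x\<bar> \<le> C * K * (1 + norm y' ^ (2 * q))" for y' by (rule K(2)[OF su' C(1) k])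
      show "(\<lambda>y'. LINT x|kernel s u y'. k x) \<in> borel_measurable borel"
        by (rule measurable_compose[OF kernel_measurable_state[OF su'] integral_measurable_subprob_algebra[OF k(1)]])
    qed
    from integrable_mult_indicator[OF HP this] show ?thesis by simp
  qed
  have "(LINT \<omega>|P t y. indicator H \<omega> * h (Y t y u \<omega>)) = (LINT \<omega>|P t y. indicator H \<omega> * hp (Y t y u \<omega>)) - (LINT \<omega>|P t y. indicator H \<omega> * hn (Y t y u \<omega>))"
    using iY by (subst Bochner_Integration.integral_diff[symmetric]) (auto simp: hpn algebra_simps)
  also have "\<dots> = (LINT \<omega>|P t y. indicator H \<omega> * (LINT x|kernel s u (Y t y s \<omega>). hp x)) - (LINT \<omega>|P t y. indicator H \<omega> * (LINT x|kernel s u (Y t y s \<omega>). hn x))"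
    using iK m by (subst (1 2) markov_integral_nonneg[OF t su H]) (auto simp: hp_def hn_def)
  also have "\<dots> = (LINT \<omega>|P t y. indicator H \<omega> * (LINT x|kernel s u (Y t y s \<omega>). hp x) - indicator H \<omega> * (LINT x|kernel s u (Y t y s \<omega>). hn x))"
    using kI[OF m(1) b(1)] kI[OF m(2) b(2)] by (subst Bochner_Integration.integral_diff) auto
  also have "\<dots> = (LINT \<omega>|P t y. indicator H \<omega> * (LINT x|kernel s u (Y t y s \<omega>). h x))"
    using iK by (simp add: hpn[abs_def] right_diff_distrib)
  finally show ?thesis .
qed

abbreviation "V \<equiv> value_function m \<pi> P Y"

lemma reward_along_measurable:
  fixes X :: "real \<Rightarrow> 'v \<Rightarrow> state"
  assumes G: "\<And>r. r \<in> {a..b} \<Longrightarrow> X r \<in> borel_measurable G" and ab: "0 \<le> a" "a \<le> b" "b \<le> T"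
    and rc: "\<And>r \<omega>. r \<in> {a..b} \<Longrightarrow> \<omega> \<in> space G \<Longrightarrow> continuous (at r within {r..b}) (\<lambda>r. X r \<omega>)"
  shows "(\<lambda>(u, \<omega>). R (max a (min b u)) (X (max a (min b u)) \<omega>)) \<in> borel_measurable (borel \<Otimes>\<^sub>M G)"
proof -
  have "(\<lambda>(u, \<omega>). X (max a (min b u)) \<omega>) \<in> borel_measurable (borel \<Otimes>\<^sub>M G)"
    by (rule jointly_measurable_right_continuous[OF ab(2) G rc])
  then have "(\<lambda>p. (max a (min b (fst p)), X (max a (min b (fst p))) (snd p))) \<in> measurable (borel \<Otimes>\<^sub>M G) (borel \<Otimes>\<^sub>M borel)"
    by (intro measurable_Pair) (simp_all add: split_def)
  from measurable_compose[OF this entropic_reward_measurable] show ?thesis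
  proof (rule measurable_cong[THEN iffD1, rotated])
    fix p :: "real \<times> 'v"
    have "max 0 (min T (max a (min b (fst p)))) = max a (min b (fst p))" using ab by auto
    then show "(case (max a (min b (fst p)), X (max a (min b (fst p))) (snd p)) of (u, y) \<Rightarrow> R (max 0 (min T u)) y)
       = (case p of (u, \<omega>) \<Rightarrow> R (max a (min b u)) (X (max a (min b u)) \<omega>))"
      by (simp add: split_def)
  qed
qed

lemma running_reward:
  assumes t: "t \<in> {0..T}" and ab: "t \<le> a" "a \<le> b" "b \<le> T" and H: "H \<in> sets (P t y)"
  shows "integrable (P t y) (\<lambda>\<omega>. LINT u:{a..b}|lborel. indicator H \<omega> * R u (Y t y u \<omega>))"
    and "(LINT \<omega>|P t y. (LINT u:{a..b}|lborel. indicator H \<omega> * R u (Y t y u \<omega>)))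
       = (LINT u:{a..b}|lborel. (LINT \<omega>|P t y. indicator H \<omega> * R u (Y t y u \<omega>)))"
    and "AE \<omega> in P t y. set_integrable lborel {a..b} (\<lambda>u. indicator H \<omega> * R u (Y t y u \<omega>))"
proof -
  interpret exploratory_solution m \<pi> t y "P t y" "F t y" "W t y" "N t y" "eta t y" "Y t y" by (rule solution_at[OF t])
  obtain C q where C: "0 \<le> C" and q: "0 < q" and R: "\<And>u x. u \<in> {0..T} \<Longrightarrow> \<bar>R u x\<bar> \<le> C * (1 + norm x ^ (2 * q))"
    using rewards_growth by blast
  obtain K where K: "\<And>s u y C h. s \<in> {0..T} \<Longrightarrow> u \<in> {s..T} \<Longrightarrow> 0 \<le> C \<Longrightarrow> (\<And>x. \<bar>h x\<bar> \<le> C * (1 + norm x ^ (2 * q))) \<Longrightarrow>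
    (\<integral>\<^sup>+\<omega>. ennreal \<bar>h (Y s y u \<omega>)\<bar> \<partial>P s y) \<le> ennreal (C * K * (1 + norm y ^ (2 * q)))"
    using growth_moment[OF q] by blast
  have m: "(\<lambda>(u, \<omega>). indicator H \<omega> * R (max a (min b u)) (Y t y (max a (min b u)) \<omega>)) \<in> borel_measurable (borel \<Otimes>\<^sub>M P t y)"
  proof -
    have "(\<lambda>(u, \<omega>). R (max a (min b u)) (Y t y (max a (min b u)) \<omega>)) \<in> borel_measurable (borel \<Otimes>\<^sub>M P t y)"
      using ab t by (intro reward_along_measurable Y_measurable Y_right_continuous) auto
    moreover have "(\<lambda>p. indicator H (snd p) :: real) \<in> borel_measurable (borel \<Otimes>\<^sub>M P t y)" using H by measurable
    ultimately show ?thesis unfolding split_def by (rule borel_measurable_times[rotated])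
  qed
  have B: "(\<integral>\<^sup>+\<omega>. ennreal \<bar>indicator H \<omega> * R u (Y t y u \<omega>)\<bar> \<partial>P t y) \<le> ennreal (C * K * (1 + norm y ^ (2 * q)))"
    if u: "u \<in> {a..b}" for u
  proof -
    have "(\<integral>\<^sup>+\<omega>. ennreal \<bar>indicator H \<omega> * R u (Y t y u \<omega>)\<bar> \<partial>P t y) \<le> (\<integral>\<^sup>+\<omega>. ennreal \<bar>R u (Y t y u \<omega>)\<bar> \<partial>P t y)"
      by (intro nn_integral_mono ennreal_leI) (auto simp: indicator_def)
    also have "\<dots> \<le> ennreal (C * K * (1 + norm y ^ (2 * q)))" using u ab t by (intro K C R) auto
    finally show ?thesis .
  qed
  note * = integral_swap_interval[OF prob_space_axioms ab(2) m B]
  show "integrable (P t y) (\<lambda>\<omega>. LINT u:{a..b}|lborel. indicator H \<omega> * R u (Y t y u \<omega>))" by (rule *(1))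
  show "(LINT \<omega>|P t y. (LINT u:{a..b}|lborel. indicator H \<omega> * R u (Y t y u \<omega>)))
       = (LINT u:{a..b}|lborel. (LINT \<omega>|P t y. indicator H \<omega> * R u (Y t y u \<omega>)))" by (rule *(2))
  show "AE \<omega> in P t y. set_integrable lborel {a..b} (\<lambda>u. indicator H \<omega> * R u (Y t y u \<omega>))" by (rule *(3))
qed

lemma running_reward_whole:
  assumes t: "t \<in> {0..T}" and ab: "t \<le> a" "a \<le> b" "b \<le> T"
  shows "integrable (P t y) (\<lambda>\<omega>. LINT u:{a..b}|lborel. R u (Y t y u \<omega>))"
    and "(LINT \<omega>|P t y. (LINT u:{a..b}|lborel. R u (Y t y u \<omega>)))
       = (LINT u:{a..b}|lborel. (LINT \<omega>|P t y. R u (Y t y u \<omega>)))"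
    and "AE \<omega> in P t y. set_integrable lborel {a..b} (\<lambda>u. R u (Y t y u \<omega>))"
  using running_reward[OF assms sets.top[of "P t y"]]
  by (simp_all cong: Bochner_Integration.integral_cong Bochner_Integration.integrable_cong AE_cong)

definition expected_reward :: "real \<Rightarrow> real \<Rightarrow> state \<Rightarrow> real" where
  "expected_reward s u y = (LINT x|kernel s u y. R u x)"

lemma expected_reward_measurable:
  assumes s: "s \<in> {0..T}"
  shows "(\<lambda>(u, y). expected_reward s (max s (min T u)) y) \<in> borel_measurable (borel \<Otimes>\<^sub>M borel)"
proof -
  let ?c = "\<lambda>p :: real \<times> state. max s (min T (fst p))"
  have c: "max 0 (min T (?c p)) = ?c p" for p using s by auto
  have "(\<lambda>q. (?c (fst q), snd q)) \<in> measurable ((borel \<Otimes>\<^sub>M borel) \<Otimes>\<^sub>M borel) (borel \<Otimes>\<^sub>M (borel :: state measure))" by measurable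
  from measurable_compose[OF this entropic_reward_measurable]
  have "(\<lambda>(p, x). R (?c p) x) \<in> borel_measurable ((borel \<Otimes>\<^sub>M borel) \<Otimes>\<^sub>M borel)"
    by (simp add: split_def c)
  then have "(\<lambda>p. integral\<^sup>L (kernel s (?c p) (snd p)) (R (?c p))) \<in> borel_measurable (borel \<Otimes>\<^sub>M borel)"
    by (rule integral_measurable_kernel[OF _ measurable_prob_algebraD[OF kernel_measurable[OF s]]])
  then show ?thesis by (simp add: expected_reward_def split_def)
qed

text \<open>
  In this form the value function is expressed through the transition laws, which are measurable in the
  state and to which the Markov property applies.
\<close>

lemma value_eq:
  assumes s: "s \<in> {0..T}"
  shows "V s y = (LINT x|kernel s T y. f x) + (LINT u:{s..T}|lborel. expected_reward s u y)"
proof -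
  interpret exploratory_solution m \<pi> s y "P s y" "F s y" "W s y" "N s y" "eta s y" "Y s y" by (rule solution_at[OF s])
  obtain C q where C: "0 \<le> C" and q: "0 < q" and f: "\<And>x. \<bar>f x\<bar> \<le> C * (1 + norm x ^ (2 * q))"
    using rewards_growth by blast
  have T: "T \<in> {s..T}" using s by simp
  have "V s y = (LINT \<omega>|P s y. f (Y s y T \<omega>)) + (LINT \<omega>|P s y. (LINT u:{s..T}|lborel. R u (Y s y u \<omega>)))"
    unfolding value_function_def using s
    by (intro Bochner_Integration.integral_add growth_integrable(1)[OF q C f _ s T] running_reward_whole(1)[OF s]) auto
  also have "(LINT \<omega>|P s y. f (Y s y T \<omega>)) = (LINT x|kernel s T y. f x)"
    by (rule integral_kernel[OF s T, symmetric]) simp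
  also have "(LINT \<omega>|P s y. (LINT u:{s..T}|lborel. R u (Y s y u \<omega>))) = (LINT u:{s..T}|lborel. (LINT \<omega>|P s y. R u (Y s y u \<omega>)))"
    using s by (intro running_reward_whole(2)[OF s]) auto
  also have "\<dots> = (LINT u:{s..T}|lborel. expected_reward s u y)"
    unfolding expected_reward_def
  proof (rule set_lebesgue_integral_cong)
    show "\<forall>u. u \<in> {s..T} \<longrightarrow> (LINT \<omega>|P s y. R u (Y s y u \<omega>)) = (LINT x|kernel s u y. R u x)"
    proof (intro allI impI)
      fix u assume u: "u \<in> {s..T}"
      then have "R u \<in> borel_measurable borel" using s by (intro entropic_reward_measurable_state) auto
      then show "(LINT \<omega>|P s y. R u (Y s y u \<omega>)) = (LINT x|kernel s u y. R u x)"
        by (rule integral_kernel[OF s u, symmetric])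
    qed
  qed simp
  finally show ?thesis .
qed

lemma value_terminal: "V T y = f y"
proof -
  have T: "T \<in> {0..T}" using T_pos by simp
  interpret exploratory_solution m \<pi> T y "P T y" "F T y" "W T y" "N T y" "eta T y" "Y T y" by (rule solution_at[OF T])
  have "V T y = (LINT \<omega>|P T y. f (Y T y T \<omega>))"
    unfolding value_function_def by (simp only: set_integral_singleton add_0_right)
  also have "\<dots> = (LINT \<omega>|P T y. f y)"
  proof (rule integral_cong_AE)
    show "AE \<omega> in P T y. f (Y T y T \<omega>) = f y" using Y_initial by eventually_elim simp
    show "(\<lambda>\<omega>. f (Y T y T \<omega>)) \<in> borel_measurable (P T y)"
      by (rule measurable_compose[OF Y_measurable terminal_reward_measurable]) simp
  qed simp
  finally show ?thesis by (simp add: prob_space)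
qed

lemma value_measurable:
  assumes s: "s \<in> {0..T}"
  shows "V s \<in> borel_measurable borel"
proof -
  have T: "T \<in> {s..T}" using s by simp
  have "(\<lambda>(y, u). indicator {s..T} u *\<^sub>R expected_reward s (max s (min T u)) y) \<in> borel_measurable (borel \<Otimes>\<^sub>M lborel)"
    using measurable_compose[OF measurable_pair_swap' expected_reward_measurable[OF s]]
    by (simp add: split_def)
  then have "(\<lambda>y. LINT u|lborel. indicator {s..T} u *\<^sub>R expected_reward s (max s (min T u)) y) \<in> borel_measurable borel"
    by (rule lborel.borel_measurable_lebesgue_integral)
  moreover have "(LINT u|lborel. indicator {s..T} u *\<^sub>R expected_reward s (max s (min T u)) y) = (LINT u:{s..T}|lborel. expected_reward s u y)" for y
    unfolding set_lebesgue_integral_def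
    by (rule Bochner_Integration.integral_cong) (auto simp: indicator_def max_absorb2 min_absorb2)
  moreover have "(\<lambda>y. LINT x|kernel s T y. f x) \<in> borel_measurable borel"
    by (rule measurable_compose[OF kernel_measurable_state[OF s T] integral_measurable_subprob_algebra]) simp
  ultimately have "(\<lambda>y. V s y) \<in> borel_measurable borel" unfolding value_eq[OF s] by simp
  then show ?thesis by simp
qed

lemma value_growth:
  "\<exists>C q. 0 \<le> C \<and> 0 < q \<and> (\<forall>s\<in>{0..T}. \<forall>y. \<bar>V s y\<bar> \<le> C * (1 + norm y ^ (2 * q)))"
proof -
  obtain C q where C: "0 \<le> C" and q: "0 < q" and R: "\<And>u x. u \<in> {0..T} \<Longrightarrow> \<bar>R u x\<bar> \<le> C * (1 + norm x ^ (2 * q))"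
    and f: "\<And>x. \<bar>f x\<bar> \<le> C * (1 + norm x ^ (2 * q))"
    using rewards_growth by blast
  obtain K where K: "K \<ge> 0" "\<And>s u y C h. s \<in> {0..T} \<Longrightarrow> u \<in> {s..T} \<Longrightarrow> 0 \<le> C \<Longrightarrow> h \<in> borel_measurable borel \<Longrightarrow>
    (\<And>x. \<bar>h x\<bar> \<le> C * (1 + norm x ^ (2 * q))) \<Longrightarrow> \<bar>LINT x|kernel s u y. h x\<bar> \<le> C * K * (1 + norm y ^ (2 * q))"
    using kernel_growth[OF q] by blast
  have "\<bar>V s y\<bar> \<le> (C * K + T * (C * K)) * (1 + norm y ^ (2 * q))" if s: "s \<in> {0..T}" for s y
  proof -
    define B where "B = C * K * (1 + norm y ^ (2 * q))"
    have B0: "0 \<le> B" using C K by (simp add: B_def)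
    have "\<bar>LINT x|kernel s T y. f x\<bar> \<le> B" unfolding B_def using s by (intro K(2) C f) auto
    moreover have "\<bar>LINT u:{s..T}|lborel. expected_reward s u y\<bar> \<le> T * B"
    proof -
      have "\<bar>LINT u:{s..T}|lborel. expected_reward s u y\<bar> \<le> (LINT u|lborel. \<bar>indicator {s..T} u *\<^sub>R expected_reward s u y\<bar>)"
        unfolding set_lebesgue_integral_def by (rule integral_abs_bound)
      also have "\<dots> \<le> (LINT u|lborel. indicator {s..T} u *\<^sub>R B)"
      proof (rule integral_mono')
        show "integrable lborel (\<lambda>u. indicator {s..T} u *\<^sub>R B)"
          using s by (intro integrable_scaleR_left) (auto simp: emeasure_lborel_Icc_eq)
        fix u show "\<bar>indicator {s..T} u *\<^sub>R expected_reward s u y\<bar> \<le> indicator {s..T} u *\<^sub>R B"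
        proof (cases "u \<in> {s..T}")
          case True
          then have "\<bar>expected_reward s u y\<bar> \<le> B"
            unfolding B_def expected_reward_def using s by (intro K(2) C R entropic_reward_measurable_state) auto
          with True show ?thesis by simp
        qed simp
        show "0 \<le> indicator {s..T} u *\<^sub>R B" using B0 by simp
      qed
      also have "\<dots> = (T - s) * B" using s by simp
      also have "\<dots> \<le> T * B" using s B0 by (intro mult_right_mono) auto
      finally show ?thesis .
    qed
    ultimately show ?thesis unfolding value_eq[OF s] B_def by (simp add: algebra_simps)
  qed
  moreover have "0 \<le> C * K + T * (C * K)" using C K T_pos by simp
  ultimately show ?thesis using q by blast
qed

lemma value_integrable:
  assumes t: "t \<in> {0..T}" and s: "s \<in> {t..T}"
  shows "integrable (P t y) (\<lambda>\<omega>. V s (Y t y s \<omega>))"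
proof -
  have s0: "s \<in> {0..T}" using s t by auto
  obtain C q where "0 \<le> C" "0 < q" "\<And>y. \<bar>V s y\<bar> \<le> C * (1 + norm y ^ (2 * q))"
    using value_growth s0 by blast
  then show ?thesis by (intro growth_integrable(1)[OF _ _ _ value_measurable[OF s0] t s]) auto
qed

section \<open>The martingale characterization\<close>

text \<open>
  The expected reward after \<open>s\<close> on an event of the past is the expected value there. Fubini moves
  the time integral outside, the Markov property acts at each single time, and Fubini moves the time
  integral back inside.
\<close>

lemma future_reward:
  assumes t: "t \<in> {0..T}" and s: "s \<in> {t..T}" and H: "H \<in> sets (F t y s)"
  shows "(LINT \<omega>|P t y. indicator H \<omega> * (f (Y t y T \<omega>) + (LINT u:{s..T}|lborel. R u (Y t y u \<omega>))))
    = (LINT \<omega>|P t y. indicator H \<omega> * V s (Y t y s \<omega>))"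
proof -
  interpret exploratory_solution m \<pi> t y "P t y" "F t y" "W t y" "N t y" "eta t y" "Y t y" by (rule solution_at[OF t])
  have s0: "s \<in> {0..T}" and Ts: "T \<in> {s..T}" and Tt: "T \<in> {t..T}" using s t by auto
  have HP [measurable]: "H \<in> sets (P t y)" using H subalg[of s] by (auto simp: subalgebra_def)
  obtain C q where C: "0 \<le> C" and q: "0 < q" and R: "\<And>u x. u \<in> {0..T} \<Longrightarrow> \<bar>R u x\<bar> \<le> C * (1 + norm x ^ (2 * q))"
    and f: "\<And>x. \<bar>f x\<bar> \<le> C * (1 + norm x ^ (2 * q))"
    using rewards_growth by blast
  obtain K where K: "K \<ge> 0" "\<And>s u y C h. s \<in> {0..T} \<Longrightarrow> u \<in> {s..T} \<Longrightarrow> 0 \<le> C \<Longrightarrow> h \<in> borel_measurable borel \<Longrightarrow>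
    (\<And>x. \<bar>h x\<bar> \<le> C * (1 + norm x ^ (2 * q))) \<Longrightarrow> \<bar>LINT x|kernel s u y. h x\<bar> \<le> C * K * (1 + norm y ^ (2 * q))"
    using kernel_growth[OF q] by blast
  obtain L where L: "\<And>s u y C h. s \<in> {0..T} \<Longrightarrow> u \<in> {s..T} \<Longrightarrow> 0 \<le> C \<Longrightarrow> (\<And>x. \<bar>h x\<bar> \<le> C * (1 + norm x ^ (2 * q))) \<Longrightarrow>
    (\<integral>\<^sup>+\<omega>. ennreal \<bar>h (Y s y u \<omega>)\<bar> \<partial>P s y) \<le> ennreal (C * L * (1 + norm y ^ (2 * q)))"
    using growth_moment[OF q] by blast
  have Rm: "R u \<in> borel_measurable borel" if "u \<in> {s..T}" for u using that s0 by (intro entropic_reward_measurable_state) auto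
  have hb: "\<bar>expected_reward s u y'\<bar> \<le> (C * K) * (1 + norm y' ^ (2 * q))" if u: "u \<in> {s..T}" for u y'
    unfolding expected_reward_def using u s0 by (intro K(2) C R Rm) auto
  let ?h = "\<lambda>u \<omega>. indicator H \<omega> * expected_reward s u (Y t y s \<omega>)"
  have hm: "(\<lambda>(u, \<omega>). ?h (max s (min T u)) \<omega>) \<in> borel_measurable (borel \<Otimes>\<^sub>M P t y)"
  proof -
    have "(\<lambda>p. (fst p, Y t y s (snd p))) \<in> measurable (borel \<Otimes>\<^sub>M P t y) (borel \<Otimes>\<^sub>M borel)"
      using Y_measurable[OF s] by measurable
    from measurable_compose[OF this expected_reward_measurable[OF s0]]
    have "(\<lambda>p. expected_reward s (max s (min T (fst p))) (Y t y s (snd p))) \<in> borel_measurable (borel \<Otimes>\<^sub>M P t y)"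
      by (simp add: split_def)
    then show ?thesis unfolding split_def by measurable
  qed
  have hB: "(\<integral>\<^sup>+\<omega>. ennreal \<bar>?h u \<omega>\<bar> \<partial>P t y) \<le> ennreal (C * K * L * (1 + norm y ^ (2 * q)))" if u: "u \<in> {s..T}" for u
  proof -
    have "(\<integral>\<^sup>+\<omega>. ennreal \<bar>?h u \<omega>\<bar> \<partial>P t y) \<le> (\<integral>\<^sup>+\<omega>. ennreal \<bar>expected_reward s u (Y t y s \<omega>)\<bar> \<partial>P t y)"
      by (intro nn_integral_mono ennreal_leI) (auto simp: indicator_def)
    also have "\<dots> \<le> ennreal (C * K * L * (1 + norm y ^ (2 * q)))" using C K by (intro L t s hb u) auto
    finally show ?thesis .
  qed
  have sT: "s \<le> T" using s by simp
  note swap = integral_swap_interval[where f="?h", OF prob_space_axioms sT hm hB]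
  have fi: "integrable (P t y) (\<lambda>\<omega>. indicator H \<omega> * f (Y t y T \<omega>))"
    using integrable_mult_indicator[OF HP growth_integrable(1)[OF q C f _ t Tt]] by simp
  have fk: "integrable (P t y) (\<lambda>\<omega>. indicator H \<omega> * (LINT x|kernel s T (Y t y s \<omega>). f x))"
  proof -
    have "integrable (P t y) (\<lambda>\<omega>. LINT x|kernel s T (Y t y s \<omega>). f x)"
    proof (rule growth_integrable(1)[OF q _ _ _ t s])
      show "0 \<le> C * K" using C K by simp
      show "\<bar>LINT x|kernel s T y'. f x\<bar> \<le> C * K * (1 + norm y' ^ (2 * q))" for y' by (rule K(2)[OF s0 Ts C _ f]) simp
      show "(\<lambda>y'. LINT x|kernel s T y'. f x) \<in> borel_measurable borel"
        by (rule measurable_compose[OF kernel_measurable_state[OF s0 Ts] integral_measurable_subprob_algebra]) simp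
    qed
    from integrable_mult_indicator[OF HP this] show ?thesis by simp
  qed
  have ts: "t \<le> s" using s by simp
  note run = running_reward[OF t ts sT order_refl HP]
  have "(LINT \<omega>|P t y. indicator H \<omega> * (f (Y t y T \<omega>) + (LINT u:{s..T}|lborel. R u (Y t y u \<omega>))))
      = (LINT \<omega>|P t y. indicator H \<omega> * f (Y t y T \<omega>) + (LINT u:{s..T}|lborel. indicator H \<omega> * R u (Y t y u \<omega>)))"
    by (simp add: distrib_left)
  also have "\<dots> = (LINT \<omega>|P t y. indicator H \<omega> * f (Y t y T \<omega>)) + (LINT \<omega>|P t y. (LINT u:{s..T}|lborel. indicator H \<omega> * R u (Y t y u \<omega>)))"
    by (rule Bochner_Integration.integral_add[OF fi run(1)])
  also have "(LINT \<omega>|P t y. indicator H \<omega> * f (Y t y T \<omega>)) = (LINT \<omega>|P t y. indicator H \<omega> * (LINT x|kernel s T (Y t y s \<omega>). f x))"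
    by (rule markov_integral[OF t s Ts H _ q C f]) simp
  also have "(LINT \<omega>|P t y. (LINT u:{s..T}|lborel. indicator H \<omega> * R u (Y t y u \<omega>))) = (LINT u:{s..T}|lborel. (LINT \<omega>|P t y. indicator H \<omega> * R u (Y t y u \<omega>)))"
    by (rule run(2))
  also have "\<dots> = (LINT u:{s..T}|lborel. (LINT \<omega>|P t y. ?h u \<omega>))"
  proof (rule set_lebesgue_integral_cong)
    show "\<forall>u. u \<in> {s..T} \<longrightarrow> (LINT \<omega>|P t y. indicator H \<omega> * R u (Y t y u \<omega>)) = (LINT \<omega>|P t y. ?h u \<omega>)"
      unfolding expected_reward_def using s0 by (intro allI impI markov_integral[OF t s _ H Rm q C] R) auto
  qed simp
  also have "\<dots> = (LINT \<omega>|P t y. (LINT u:{s..T}|lborel. ?h u \<omega>))" by (rule swap(2)[symmetric])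
  also have "(LINT \<omega>|P t y. indicator H \<omega> * (LINT x|kernel s T (Y t y s \<omega>). f x)) + \<dots>
      = (LINT \<omega>|P t y. indicator H \<omega> * (LINT x|kernel s T (Y t y s \<omega>). f x) + (LINT u:{s..T}|lborel. ?h u \<omega>))"
    by (rule Bochner_Integration.integral_add[OF fk swap(1), symmetric])
  also have "\<dots> = (LINT \<omega>|P t y. indicator H \<omega> * V s (Y t y s \<omega>))"
    by (simp add: value_eq[OF s0] distrib_left)
  finally show ?thesis .
qed

text \<open>
  The natural filtration of the state is contained in the filtration of the noise, so \<open>future_reward\<close>
  applies to its events and identifies each \<open>M\<^sub>s\<close> with the conditional expectation of \<open>M\<^sub>T\<close>.
\<close>

lemma performance_martingale:
  assumes U: "\<And>s y. s \<in> {0..T} \<Longrightarrow> U s y = V s y" and t: "t \<in> {0..T}"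
  shows "martingale_on (P t y) (\<lambda>s. generated (P t y) (Y t y) {t..s}) t T (performance_process m \<pi> U t (Y t y))"
proof -
  interpret exploratory_solution m \<pi> t y "P t y" "F t y" "W t y" "N t y" "eta t y" "Y t y" by (rule solution_at[OF t])
  let ?P = "P t y" and ?Y = "Y t y"
  define G where "G s = generated ?P ?Y {t..s}" for s
  define X where "X = performance_process m \<pi> U t ?Y"
  define I where "I s \<omega> = (LINT u:{t..s}|lborel. R u (?Y u \<omega>))" for s \<omega>
  have in0: "s \<in> {0..T}" if "s \<in> {t..T}" for s using that t by auto
  have spG: "space (G s) = space ?P" for s by (simp add: G_def)
  have GF: "sets (G s) \<subseteq> sets (F t y s)" if s: "s \<in> {t..T}" for s
    unfolding G_def
  proof (rule sets_generated_subset)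
    fix r assume r: "r \<in> {t..s}"
    have "subalgebra (F t y s) (F t y r)" using F_mono[of r s] r by (auto simp: subalgebra_def)
    then show "?Y r \<in> borel_measurable (F t y s)"
      using Y_adapted[of r] r s by (intro measurable_from_subalg[of "F t y s" "F t y r"]) auto
  qed simp
  have subG: "subalgebra ?P (G s)" if "s \<in> {t..T}" for s
    using GF[OF that] subalg[of s] by (auto simp: subalgebra_def spG)
  have GG: "sets (G s) \<subseteq> sets (G u)" if "s \<le> u" for s u
    unfolding G_def using that by (intro sets_generated_subset generated_measurable) auto
  have X_eq: "X s \<omega> = V s (?Y s \<omega>) + I s \<omega>" if "s \<in> {t..T}" for s \<omega>
    using U[OF in0[OF that]] by (simp add: X_def performance_process_def I_def)
  have X_fun: "X s = (\<lambda>\<omega>. V s (?Y s \<omega>) + I s \<omega>)" if "s \<in> {t..T}" for s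
    by (rule ext) (rule X_eq[OF that])
  have YG: "?Y r \<in> borel_measurable (G s)" if "r \<in> {t..s}" for r s
    unfolding G_def by (rule generated_measurable[OF that])
  have IG: "I s \<in> borel_measurable (G s)" if s: "s \<in> {t..T}" for s
  proof -
    have "(\<lambda>(u, \<omega>). R (max t (min s u)) (?Y (max t (min s u)) \<omega>)) \<in> borel_measurable (borel \<Otimes>\<^sub>M G s)"
      using s t by (intro reward_along_measurable YG Y_right_continuous) (auto simp: spG)
    from measurable_compose[OF measurable_pair_swap' this]
    have "(\<lambda>(\<omega>, u). indicator {t..s} u *\<^sub>R R (max t (min s u)) (?Y (max t (min s u)) \<omega>)) \<in> borel_measurable (G s \<Otimes>\<^sub>M lborel)"
      by (simp add: split_def)
    then have "(\<lambda>\<omega>. LINT u|lborel. indicator {t..s} u *\<^sub>R R (max t (min s u)) (?Y (max t (min s u)) \<omega>)) \<in> borel_measurable (G s)"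
      by (rule lborel.borel_measurable_lebesgue_integral)
    moreover have "(LINT u|lborel. indicator {t..s} u *\<^sub>R R (max t (min s u)) (?Y (max t (min s u)) \<omega>)) = I s \<omega>" for \<omega>
      unfolding I_def set_lebesgue_integral_def
      by (rule Bochner_Integration.integral_cong) (auto simp: indicator_def max_absorb2 min_absorb2)
    ultimately show ?thesis by simp
  qed
  have XG: "X s \<in> borel_measurable (G s)" if s: "s \<in> {t..T}" for s
  proof -
    have "(\<lambda>\<omega>. V s (?Y s \<omega>)) \<in> borel_measurable (G s)"
      using s by (intro measurable_compose[OF YG value_measurable] in0) auto
    then have "(\<lambda>\<omega>. V s (?Y s \<omega>) + I s \<omega>) \<in> borel_measurable (G s)" using IG[OF s] by simp
    then show ?thesis unfolding X_fun[OF s] .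
  qed
  have Ii: "integrable ?P (I s)" if s: "s \<in> {t..T}" for s
    unfolding I_def using s by (intro running_reward_whole(1)[OF t]) auto
  have Xi: "integrable ?P (X s)" if s: "s \<in> {t..T}" for s
  proof -
    have "integrable ?P (\<lambda>\<omega>. V s (?Y s \<omega>) + I s \<omega>)"
      by (intro Bochner_Integration.integrable_add value_integrable[OF t s] Ii[OF s])
    then show ?thesis unfolding X_fun[OF s] .
  qed
  have Tt: "T \<in> {t..T}" using t by simp
  \<comment> \<open>The martingale is closed by its terminal value.\<close>
  have closed: "AE \<omega> in ?P. real_cond_exp ?P (G s) (X T) \<omega> = X s \<omega>" if s: "s \<in> {t..T}" for s
  proof -
    interpret finite_measure_subalgebra ?P "G s"
      by (intro finite_measure_subalgebra.intro finite_measure_axioms finite_measure_subalgebra_axioms.intro subG s)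
    show ?thesis
    proof (rule real_cond_exp_charact)
      fix H assume HG: "H \<in> sets (G s)"
      then have HF: "H \<in> sets (F t y s)" using GF[OF s] by blast
      have HP [measurable]: "H \<in> sets ?P" using HG subG[OF s] by (auto simp: subalgebra_def)
      let ?C = "\<lambda>\<omega>. f (?Y T \<omega>) + (LINT u:{s..T}|lborel. R u (?Y u \<omega>))"
      have split: "AE \<omega> in ?P. X T \<omega> = I s \<omega> + ?C \<omega>"
      proof -
        have "AE \<omega> in ?P. set_integrable lborel {t..T} (\<lambda>u. R u (?Y u \<omega>))"
          using t by (intro running_reward_whole(3)[OF t]) auto
        then show ?thesis
        proof eventually_elim
        fix \<omega> assume "set_integrable lborel {t..T} (\<lambda>u. R u (?Y u \<omega>))"
        from set_integral_Icc_split[OF this, of s] show "X T \<omega> = I s \<omega> + ?C \<omega>"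
          using s by (simp add: X_eq[OF Tt] value_terminal I_def)
        qed
      qed
      have iI: "integrable ?P (\<lambda>\<omega>. indicator H \<omega> * I s \<omega>)"
        using integrable_mult_indicator[OF HP Ii[OF s]] by simp
      have iV: "integrable ?P (\<lambda>\<omega>. indicator H \<omega> * V s (?Y s \<omega>))"
        using integrable_mult_indicator[OF HP value_integrable[OF t s]] by simp
      have "integrable ?P ?C"
      proof -
        obtain C q where "0 \<le> C" "0 < q" "\<And>x. \<bar>f x\<bar> \<le> C * (1 + norm x ^ (2 * q))"
          using rewards_growth by blast
        then show ?thesis
          using s by (intro Bochner_Integration.integrable_add growth_integrable(1)[OF _ _ _ _ t Tt] running_reward_whole(1)[OF t]) auto
      qed
      then have iC: "integrable ?P (\<lambda>\<omega>. indicator H \<omega> * ?C \<omega>)"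
        using integrable_mult_indicator[OF HP, of ?C] by simp
      have "(LINT \<omega>:H|?P. X T \<omega>) = (LINT \<omega>|?P. indicator H \<omega> * I s \<omega> + indicator H \<omega> * ?C \<omega>)"
        unfolding set_lebesgue_integral_def[of ?P]
      proof (rule integral_cong_AE)
        show "AE \<omega> in ?P. indicator H \<omega> *\<^sub>R X T \<omega> = indicator H \<omega> * I s \<omega> + indicator H \<omega> * ?C \<omega>"
          using split by eventually_elim (simp add: algebra_simps)
        show "(\<lambda>\<omega>. indicator H \<omega> *\<^sub>R X T \<omega>) \<in> borel_measurable ?P"
          using borel_measurable_integrable[OF Xi[OF Tt]] by simp
        show "(\<lambda>\<omega>. indicator H \<omega> * I s \<omega> + indicator H \<omega> * ?C \<omega>) \<in> borel_measurable ?P"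
          using borel_measurable_integrable[OF iI] borel_measurable_integrable[OF iC] by (rule borel_measurable_add)
      qed
      also have "\<dots> = (LINT \<omega>|?P. indicator H \<omega> * I s \<omega>) + (LINT \<omega>|?P. indicator H \<omega> * ?C \<omega>)"
        by (rule Bochner_Integration.integral_add[OF iI iC])
      also have "(LINT \<omega>|?P. indicator H \<omega> * ?C \<omega>) = (LINT \<omega>|?P. indicator H \<omega> * V s (?Y s \<omega>))"
        by (rule future_reward[OF t s HF])
      also have "(LINT \<omega>|?P. indicator H \<omega> * I s \<omega>) + \<dots> = (LINT \<omega>|?P. indicator H \<omega> * I s \<omega> + indicator H \<omega> * V s (?Y s \<omega>))"
        by (rule Bochner_Integration.integral_add[OF iI iV, symmetric])
      also have "\<dots> = (LINT \<omega>:H|?P. X s \<omega>)"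
        unfolding set_lebesgue_integral_def by (simp add: X_eq[OF s] algebra_simps)
      finally show "(LINT \<omega>:H|?P. X T \<omega>) = (LINT \<omega>:H|?P. X s \<omega>)" .
    qed (use Xi[OF Tt] Xi[OF s] XG[OF s] in auto)
  qed
  have mart: "AE \<omega> in ?P. real_cond_exp ?P (G s) (X u) \<omega> = X s \<omega>" if su: "t \<le> s" "s \<le> u" "u \<le> T" for s u
  proof -
    have s: "s \<in> {t..T}" and u: "u \<in> {t..T}" using su by auto
    interpret finite_measure_subalgebra ?P "G s"
      by (intro finite_measure_subalgebra.intro finite_measure_axioms finite_measure_subalgebra_axioms.intro subG s)
    have "subalgebra (G u) (G s)" using GG[OF su(2)] by (simp add: subalgebra_def spG)
    then have "AE \<omega> in ?P. real_cond_exp ?P (G s) (real_cond_exp ?P (G u) (X T)) \<omega> = real_cond_exp ?P (G s) (X T) \<omega>"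
      by (intro real_cond_exp_nested_subalg subG u Xi Tt)
    moreover have "AE \<omega> in ?P. real_cond_exp ?P (G s) (real_cond_exp ?P (G u) (X T)) \<omega> = real_cond_exp ?P (G s) (X u) \<omega>"
      using Xi[OF u] by (intro real_cond_exp_cong closed u) (auto intro: borel_measurable_cond_exp2)
    ultimately show ?thesis using closed[OF s] by eventually_elim simp
  qed
  show ?thesis
    unfolding martingale_on_def G_def[symmetric] X_def[symmetric]
    using subG GG XG Xi mart by blast
qed

lemma value_of_martingale:
  assumes terminal: "\<And>y. U T y = f y" and t: "t \<in> {0..T}"
    and mart: "martingale_on (P t y) (\<lambda>s. generated (P t y) (Y t y) {t..s}) t T (performance_process m \<pi> U t (Y t y))"
  shows "U t y = V t y"
proof -
  interpret exploratory_solution m \<pi> t y "P t y" "F t y" "W t y" "N t y" "eta t y" "Y t y" by (rule solution_at[OF t])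
  let ?P = "P t y" and ?Y = "Y t y"
  let ?X = "performance_process m \<pi> U t ?Y" and ?G = "generated ?P ?Y {t..t}"
  have tT: "t \<le> T" using t by simp
  have sub: "subalgebra ?P ?G" and Xi: "integrable ?P (?X T)" and Xt: "integrable ?P (?X t)"
    and ce: "AE \<omega> in ?P. real_cond_exp ?P ?G (?X T) \<omega> = ?X t \<omega>"
    using mart tT unfolding martingale_on_def by (auto simp del: atLeastAtMost_singleton)
  interpret finite_measure_subalgebra ?P ?G
    by (intro finite_measure_subalgebra.intro finite_measure_axioms finite_measure_subalgebra_axioms.intro sub)
  have "V t y = (LINT \<omega>|?P. ?X T \<omega>)"
    by (simp add: value_function_def performance_process_def terminal)
  also have "\<dots> = (LINT \<omega>|?P. real_cond_exp ?P ?G (?X T) \<omega>)" by (rule real_cond_exp_int(2)[OF Xi, symmetric])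
  also have "\<dots> = (LINT \<omega>|?P. U t y)"
  proof (rule integral_cong_AE)
    show "AE \<omega> in ?P. real_cond_exp ?P ?G (?X T) \<omega> = U t y"
      using ce Y_initial
    proof eventually_elim
      fix \<omega> assume "real_cond_exp ?P ?G (?X T) \<omega> = ?X t \<omega>" "?Y t \<omega> = y"
      then show "real_cond_exp ?P ?G (?X T) \<omega> = U t y"
        unfolding performance_process_def set_integral_singleton by simp
    qed
  qed auto
  finally show ?thesis by (simp add: prob_space)
qed

end

theorem theorem3:
  fixes m :: model and \<pi> :: policy and U :: "real \<Rightarrow> state \<Rightarrow> real"
    and P :: "real \<Rightarrow> state \<Rightarrow> 'w measure"
    and F :: "real \<Rightarrow> state \<Rightarrow> real \<Rightarrow> 'w measure"
    and W :: "real \<Rightarrow> state \<Rightarrow> real \<Rightarrow> 'w \<Rightarrow> real"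
    and N :: "real \<Rightarrow> state \<Rightarrow> real \<Rightarrow> 'w \<Rightarrow> nat"
    and eta :: "real \<Rightarrow> state \<Rightarrow> nat \<Rightarrow> 'w \<Rightarrow> real"
    and Y :: "real \<Rightarrow> state \<Rightarrow> real \<Rightarrow> 'w \<Rightarrow> state"
  assumes "valid_model m" and "standing_assumptions m"
    and "admissible m \<pi>"
    and "\<And>t y. t \<in> {0..horizon m} \<Longrightarrow>
           weak_solution m \<pi> t y (P t y) (F t y) (W t y) (N t y) (eta t y) (Y t y)"
  shows "(\<forall>t\<in>{0..horizon m}. \<forall>y. U t y = value_function m \<pi> P Y t y) \<longleftrightarrow>
         (\<forall>y. U (horizon m) y = terminal_reward m y) \<and>
         (\<forall>t\<in>{0..horizon m}. \<forall>y.
            martingale_on (P t y) (\<lambda>s. generated (P t y) (Y t y) {t..s}) t (horizon m)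
              (performance_process m \<pi> U t (Y t y)))"
proof -
  interpret solution_family m \<pi> P F W N eta Y
    using assms by (intro solution_family.intro exploratory_model.intro solution_family_axioms.intro)
  have "horizon m \<in> {0..horizon m}" using T_pos by simp
  then show ?thesis
    using performance_martingale[of U] value_of_martingale[of U] value_terminal by metis
qed

end
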